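(* Let $\varepsilon_0>0$, $C_3<\infty$, let $\{\varepsilon_n\}$ be a sequence of positive numbers with $\sup_n|\varepsilon_n|\le\varepsilon_0$, and let $\{w_n\}\subset\mathcal{A}$ satisfy $\mathcal{E}_{\varepsilon_n}(w_n)\le C_3$ for all $n$. Then $\{w_n\}$ is precompact in $L^2(\mathbb{T}^2)$.
   Context: $\mathbb{T}^2=[0,1)^2$ is the flat torus with Lebesgue measure; functions are real valued and 1-periodic in each variable. Fourier coefficients $\widehat f(k)$ are indexed by $k=(k_1,k_2)\in(2\pi\mathbb{Z})^2$. A periodic distribution $f$ on $\mathbb{T}^2$ has vanishing mean in $x_1$ if $\widehat f(k)=0$ for all $k\in(2\pi\mathbb{Z})^2$ with $k_1=0$ (for integrable functions: $\int_0^1 f(x_1,x_2)\,dx_1=0$ for a.e. $x_2$). For such $f$, $|\partial_1|^{-1}f$ is defined by $\widehat{|\partial_1|^{-1}f}(k)=|k_1|^{-1}\widehat f(k)$ for $k_1\ne0$ (and $0$ for $k_1=0$). For $w\in L^2(\mathbb{T}^2)$ with vanishing mean in $x_1$, put $\eta_w=\partial_2 w-\partial_1\tfrac12w^2$ (a distribution with vanishing mean in $x_1$), and for $\varepsilon>0$ $$\mathcal{E}(w)=\left(\int_{\mathbb{T}^2}(|\partial_1|^{-1}\eta_w)^2dx\right)^{1/2}\left(\int_{\mathbb{T}^2}(\partial_1 w)^2dx\right)^{1/2},\qquad \mathcal{E}_\varepsilon(w)=\frac12\int_{\mathbb{T}^2}\frac1\varepsilon(|\partial_1|^{-1}\eta_w)^2+\varepsilon(\partial_1w)^2\,dx,$$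 where an integral is $+\infty$ if the corresponding distribution is not in $L^2(\mathbb{T}^2)$, and $\mathcal{E}(w)=+\infty$ if one of the two integrals is $+\infty$. The set $\mathcal{A}$ consists of all $w\in L^2(\mathbb{T}^2)$ with vanishing mean in $x_1$ and $\mathcal{E}(w)<\infty$. Precompact means that every subsequence has a further subsequence converging strongly in the indicated norm. *)

theory Defs
  imports "HOL-Analysis.Analysis"
begin

definition torus :: "(real \<times> real) measure" where
  "torus = restrict_space lborel ({0..<1} \<times> {0..<1})"

definition periodic :: "(real \<times> real \<Rightarrow> 'a) \<Rightarrow> bool" where
  "periodic f \<longleftrightarrow> (\<forall>x. f (x + (1, 0)) = f x \<and> f (x + (0, 1)) = f x)"

text \<open>Elements of \<open>L\<^sup>2\<close> are represented by periodic Borel functions; two functions that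
  agree almost everywhere are not identified.\<close>

definition L2_torus :: "(real \<times> real \<Rightarrow> real) set" where
  "L2_torus = {f. f \<in> borel_measurable borel \<and> periodic f \<and> integrable torus (\<lambda>x. (f x)\<^sup>2)}"

definition L2_norm :: "(real \<times> real \<Rightarrow> real) \<Rightarrow> real" where
  "L2_norm f = sqrt (\<integral>x. (f x)\<^sup>2 \<partial>torus)"

definition partial1 :: "(real \<times> real \<Rightarrow> complex) \<Rightarrow> real \<times> real \<Rightarrow> complex" where
  "partial1 \<phi> x = frechet_derivative \<phi> (at x) (1, 0)"

definition partial2 :: "(real \<times> real \<Rightarrow> complex) \<Rightarrow> real \<times> real \<Rightarrow> complex" where
  "partial2 \<phi> x = frechet_derivative \<phi> (at x) (0, 1)"

text \<open>Smoothness: every iterated partial derivative (in any order) exists and is again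
  Frechet differentiable everywhere.\<close>

inductive_set iterated_partials :: "(real \<times> real \<Rightarrow> complex) \<Rightarrow> (real \<times> real \<Rightarrow> complex) set"
  for \<phi> where
  base: "\<phi> \<in> iterated_partials \<phi>"
| step1: "\<psi> \<in> iterated_partials \<phi> \<Longrightarrow> partial1 \<psi> \<in> iterated_partials \<phi>"
| step2: "\<psi> \<in> iterated_partials \<phi> \<Longrightarrow> partial2 \<psi> \<in> iterated_partials \<phi>"

definition test_functions :: "(real \<times> real \<Rightarrow> complex) set" where
  "test_functions =
     {\<phi>. periodic \<phi> \<and> (\<forall>\<psi> \<in> iterated_partials \<phi>. \<psi> differentiable_on UNIV)}"

text \<open>A periodic distribution is given by its (complex bilinear) pairing with complex-valued test
  functions; its values outside \<^const>\<open>test_functions\<close> carry no meaning.\<close>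

type_synonym distribution = "(real \<times> real \<Rightarrow> complex) \<Rightarrow> complex"

definition of_fun :: "(real \<times> real \<Rightarrow> real) \<Rightarrow> distribution" where
  "of_fun f \<phi> = (\<integral>x. of_real (f x) * \<phi> x \<partial>torus)"

definition dist_partial1 :: "distribution \<Rightarrow> distribution" where
  "dist_partial1 T \<phi> = - T (partial1 \<phi>)"

definition dist_partial2 :: "distribution \<Rightarrow> distribution" where
  "dist_partial2 T \<phi> = - T (partial2 \<phi>)"

definition freqs :: "(real \<times> real) set" where
  "freqs = range (\<lambda>m::int. 2 * pi * of_int m) \<times> range (\<lambda>m::int. 2 * pi * of_int m)"

definition fourier_char :: "real \<times> real \<Rightarrow> real \<times> real \<Rightarrow> complex" where
  "fourier_char k x = cis (k \<bullet> x)"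

definition fourier_coeff :: "distribution \<Rightarrow> real \<times> real \<Rightarrow> complex" where
  "fourier_coeff T k = T (fourier_char (- k))"

definition vanishing_mean1 :: "distribution \<Rightarrow> bool" where
  "vanishing_mean1 T \<longleftrightarrow> (\<forall>k \<in> freqs. fst k = 0 \<longrightarrow> fourier_coeff T k = 0)"

text \<open>The distribution with Fourier coefficients \<open>\<bar>k\<^sub>1\<bar>\<^sup>-\<^sup>1 T^(k)\<close> for \<open>k\<^sub>1 \<noteq> 0\<close> and \<open>0\<close> for
  \<open>k\<^sub>1 = 0\<close>, written as the pairing of its Fourier series with \<open>\<phi>\<close>. The series converges
  absolutely, since the coefficients of a distribution grow at most polynomially and those of a
  test function decay rapidly.\<close>

definition inv_abs_partial1 :: "distribution \<Rightarrow> distribution" where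
  "inv_abs_partial1 T \<phi> =
     (\<Sum>\<^sub>\<infinity>k \<in> {k \<in> freqs. fst k \<noteq> 0}.
        of_real (1 / \<bar>fst k\<bar>) * fourier_coeff T k * (\<integral>x. fourier_char k x * \<phi> x \<partial>torus))"

definition represents :: "(real \<times> real \<Rightarrow> real) \<Rightarrow> distribution \<Rightarrow> bool" where
  "represents g T \<longleftrightarrow> g \<in> L2_torus \<and> (\<forall>\<phi> \<in> test_functions. T \<phi> = of_fun g \<phi>)"

text \<open>The integral of \<open>T\<^sup>2\<close>, which is \<open>\<infinity>\<close> if \<open>T\<close> is not in \<open>L\<^sup>2\<close>. The representative is unique up to
  null sets, so its choice does not matter.\<close>

definition square_integral :: "distribution \<Rightarrow> ennreal" where
  "square_integral T =
     (if \<exists>g. represents g T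
      then \<integral>\<^sup>+ x. ennreal (((SOME g. represents g T) x)\<^sup>2) \<partial>torus
      else \<infinity>)"

definition eta :: "(real \<times> real \<Rightarrow> real) \<Rightarrow> distribution" where
  "eta w \<phi> = dist_partial2 (of_fun w) \<phi> - dist_partial1 (of_fun (\<lambda>x. 1 / 2 * (w x)\<^sup>2)) \<phi>"

definition energy :: "(real \<times> real \<Rightarrow> real) \<Rightarrow> ennreal" where
  "energy w =
     (let I = square_integral (inv_abs_partial1 (eta w));
          J = square_integral (dist_partial1 (of_fun w))
      in if I = \<infinity> \<or> J = \<infinity> then \<infinity>
         else ennreal (sqrt (enn2real I) * sqrt (enn2real J)))"

definition energy_eps :: "real \<Rightarrow> (real \<times> real \<Rightarrow> real) \<Rightarrow> ennreal" where
  "energy_eps \<epsilon> w =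
     ennreal (1 / 2) *
       (ennreal (1 / \<epsilon>) * square_integral (inv_abs_partial1 (eta w))
        + ennreal \<epsilon> * square_integral (dist_partial1 (of_fun w)))"

definition admissible :: "(real \<times> real \<Rightarrow> real) set" where
  "admissible = {w \<in> L2_torus. vanishing_mean1 (of_fun w) \<and> energy w < \<infinity>}"

definition precompact_L2 :: "(nat \<Rightarrow> real \<times> real \<Rightarrow> real) \<Rightarrow> bool" where
  "precompact_L2 w \<longleftrightarrow>
     (\<forall>r. strict_mono r \<longrightarrow>
       (\<exists>s f. strict_mono (s :: nat \<Rightarrow> nat) \<and> f \<in> L2_torus \<and>
          (\<lambda>n. L2_norm (\<lambda>x. w (r (s n)) x - f x)) \<longlonglongrightarrow> 0))"

end

(*
  Write eta_w = d_1 g with g the Hilbert transform in x_1 of |d_1|^-1 eta_w, so that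
  d_2 w = w d_1 w + d_1 g in a weak sense. The Howarth-Karman-Monin type balance for the increments
  D = w(x + h e_1) - w(x) bounds the h-derivative of a convex functional of D by the product of the
  L^2 norms of d_1 D and of g(x + h e_1) - g(x), hence by a multiple of E(w) <= E_eps(w). To justify
  this for rough w, the balance is applied to the Fejer means of w, which solve the equation up to
  a commutator that vanishes in L^1. Hence increments in x_1 are small in L^2 uniformly in n, which
  gives uniform decay of the Fourier coefficients in k_1. For fixed k_1 the equation itself gives
  |k_2| |w^(k)| <= C |k_1|, and the decay in k_2 follows. Uniformly small Fourier tails and L^2
  bounds imply precompactness.
*)

theory Submission
  imports Defs "HOL-Library.Diagonal_Subsequence"
begin

text \<open>Two features shape the balance argument. The product of \<open>w\<close> and d_1 w lies
  in L^1 only, and so does the control of the commutator. The logarithmic weight answers this: it is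
  bounded by \<open>ln M\<close>, its derivative by 1 for every \<open>M\<close>, and the first
  bound meets only the commutator while the second meets the main term. But \<open>M\<close> must
  dominate the increments of a Fejer mean and may grow with its index; two indices are therefore
  kept apart, one that fixes \<open>M\<close> and one that goes to infinity before it.

  No bound on the L^2 norms of the w_n is given. It comes from the increment estimate itself:
  averaging over shifts in [0, 1] controls all frequencies with nonzero k_1, and the vanishing mean
  disposes of the others. In that estimate \<epsilon> cancels. The upper bound on \<epsilon>_n
  enters for the decay in k_2, where the L^2 norm of |d_1|^-1 eta_w has to be bounded alone.\<close>

section \<open>Integration over the unit square\<close>

lemma space_torus: "space torus = {0..<1} \<times> {0..<1}"
  by (simp add: torus_def space_restrict_space)

lemma sets_unit_square: "{0..<1::real} \<times> {0..<1::real} \<in> sets borel"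
  unfolding borel_prod[symmetric] by (intro pair_measureI) auto

lemma measurable_torus: "f \<in> borel_measurable borel \<Longrightarrow> f \<in> borel_measurable torus"
  unfolding torus_def by (intro measurable_restrict_space1) simp

lemma emeasure_unit_square: "emeasure lborel ({0..<1::real} \<times> {0..<1::real}) = 1"
proof -
  have "emeasure (lborel \<Otimes>\<^sub>M lborel) ({0..<1::real} \<times> {0..<1::real}) = 1"
    by (subst lborel.emeasure_pair_measure_Times) auto
  then show ?thesis by (simp add: lborel_prod)
qed

lemma emeasure_torus: "emeasure torus (space torus) = 1"
  using sets_unit_square
  by (simp add: space_torus torus_def emeasure_restrict_space emeasure_unit_square)

interpretation torus: finite_measure torus
  by standard (simp add: emeasure_torus)

lemma measure_torus: "measure torus (space torus) = 1"
  by (simp add: measure_def emeasure_torus)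

lemma integrable_torus_bounded:
  fixes f :: "real \<times> real \<Rightarrow> 'a::{banach, second_countable_topology}"
  assumes "f \<in> borel_measurable torus" "\<And>x. x \<in> space torus \<Longrightarrow> norm (f x) \<le> B"
  shows "integrable torus f"
  using assms by (intro torus.integrable_const_bound[where B = B]) auto

lemma integral_torus_le_const:
  fixes f :: "real \<times> real \<Rightarrow> real"
  assumes "integrable torus f" "\<And>x. x \<in> space torus \<Longrightarrow> f x \<le> B"
  shows "integral\<^sup>L torus f \<le> B"
proof -
  have "integral\<^sup>L torus f \<le> integral\<^sup>L torus (\<lambda>_. B)"
    using assms by (intro integral_mono) auto
  then show ?thesis by (simp add: measure_torus)
qed

text \<open>The half-open and the closed square differ by a part of the boundary, a null set. As a
  gauge integral over a closed box, the integral over \<open>torus\<close> is open to Fubini, the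
  fundamental theorem of calculus and differentiation under the integral sign for continuous
  integrands.\<close>

lemma
  fixes f :: "real \<times> real \<Rightarrow> 'a::euclidean_space"
  assumes "continuous_on UNIV f"
  shows integrable_torus_continuous: "integrable torus f"
    and integral_torus_eq: "integral\<^sup>L torus f = integral (cbox (0, 0) (1, 1)) f"
proof -
  let ?S = "{0..<1::real} \<times> {0..<1::real}"
  have c: "continuous_on (cbox (0,0) (1,1)) f"
    using assms continuous_on_subset by blast
  have "compact (f ` cbox (0,0) (1,1))"
    by (intro compact_continuous_image c compact_cbox)
  then obtain B where B: "\<And>x. x \<in> cbox (0,0) (1,1) \<Longrightarrow> norm (f x) \<le> B"
    using compact_imp_bounded bounded_iff by (metis imageI)
  have m: "f \<in> borel_measurable borel"
    using assms by (simp add: borel_measurable_continuous_onI)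
  show i: "integrable torus f"
    by (rule integrable_torus_bounded[where B = B])
       (use B m measurable_torus in \<open>auto simp: space_torus cbox_Pair_eq\<close>)
  have si: "set_integrable lborel ?S f"
    using i sets_unit_square unfolding torus_def set_integrable_def
    by (subst (asm) integrable_restrict_space) auto
  have "integral\<^sup>L torus f = (LINT x:?S|lborel. f x)"
    using sets_unit_square unfolding torus_def set_lebesgue_integral_def
    by (subst integral_restrict_space) auto
  also have "\<dots> = integral ?S f"
    using si by (rule set_borel_integral_eq_integral(2))
  also have "\<dots> = integral (cbox (0, 0) (1, 1)) f"
  proof (rule integral_spike_set)
    have "negligible (cbox (0::real, 0::real) (1, 1) - box (0, 0) (1, 1))"
      by (rule negligible_frontier_interval)
    moreover have "cbox (0, 0) (1, 1) - ?S \<subseteq> cbox (0::real, 0::real) (1, 1) - box (0, 0) (1, 1)"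
      by (auto simp: mem_box Basis_prod_def)
    ultimately show "negligible {x \<in> cbox (0, 0) (1, 1) - ?S. f x \<noteq> 0}"
      by (elim negligible_subset) blast
    show "negligible {x \<in> ?S - cbox (0, 0) (1, 1). f x \<noteq> 0}"
      by (rule negligible_subset[of "{}"]) (auto simp: cbox_Pair_eq)
  qed
  finally show "integral\<^sup>L torus f = integral (cbox (0, 0) (1, 1)) f" .
qed

lemma integral_torus_iterated:
  fixes f :: "real \<times> real \<Rightarrow> 'a::euclidean_space"
  assumes "continuous_on UNIV f"
  shows "integral\<^sup>L torus f = integral {0..1} (\<lambda>x. integral {0..1} (\<lambda>y. f (x, y)))"
    and "integral\<^sup>L torus f = integral {0..1} (\<lambda>y. integral {0..1} (\<lambda>x. f (x, y)))"
proof -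
  have c: "continuous_on (cbox (0,0) (1,1)) f"
    using assms continuous_on_subset by blast
  show *: "integral\<^sup>L torus f = integral {0..1} (\<lambda>x. integral {0..1} (\<lambda>y. f (x, y)))"
    using integral_prod_continuous[OF c] by (simp add: integral_torus_eq[OF assms])
  show "integral\<^sup>L torus f = integral {0..1} (\<lambda>y. integral {0..1} (\<lambda>x. f (x, y)))"
    unfolding * using integral_swap_continuous[of 0 0 1 1 "\<lambda>x y. f (x, y)"] c
    by simp
qed

text \<open>Fubini puts the direction of differentiation innermost; there the fundamental theorem
  leaves the difference of \<open>F\<close> at opposite sides, zero by periodicity. Integration by
  parts is used in this form throughout, and derivatives along coordinate lines suffice for
  it.\<close>

lemma
  fixes F :: "real \<times> real \<Rightarrow> 'a::euclidean_space"
  assumes per: "periodic F" and cont: "continuous_on UNIV f"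
  shows integral_partial1_periodic:
    "(\<And>x y. ((\<lambda>t. F (t, y)) has_vector_derivative f (x, y)) (at x)) \<Longrightarrow> integral\<^sup>L torus f = 0"
    and integral_partial2_periodic:
    "(\<And>x y. ((\<lambda>t. F (x, t)) has_vector_derivative f (x, y)) (at y)) \<Longrightarrow> integral\<^sup>L torus f = 0"
proof -
  assume d: "\<And>x y. ((\<lambda>t. F (t, y)) has_vector_derivative f (x, y)) (at x)"
  have "integral {0..1} (\<lambda>x. f (x, y)) = 0" for y
  proof -
    have "((\<lambda>x. f (x, y)) has_integral F (1, y) - F (0, y)) {0..1}"
      by (rule fundamental_theorem_of_calculus)
         (auto intro: has_vector_derivative_at_within d)
    moreover have "F (1, y) = F (0, y)"
      using per[unfolded periodic_def, rule_format, of "(0, y)"] by simp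
    ultimately show ?thesis by (simp add: integral_unique)
  qed
  then show "integral\<^sup>L torus f = 0" by (simp add: integral_torus_iterated(2)[OF cont])
next
  assume d: "\<And>x y. ((\<lambda>t. F (x, t)) has_vector_derivative f (x, y)) (at y)"
  have "integral {0..1} (\<lambda>y. f (x, y)) = 0" for x
  proof -
    have "((\<lambda>y. f (x, y)) has_integral F (x, 1) - F (x, 0)) {0..1}"
      by (rule fundamental_theorem_of_calculus)
         (auto intro: has_vector_derivative_at_within d)
    moreover have "F (x, 1) = F (x, 0)"
      using per[unfolded periodic_def, rule_format, of "(x, 0)"] by simp
    ultimately show ?thesis by (simp add: integral_unique)
  qed
  then show "integral\<^sup>L torus f = 0" by (simp add: integral_torus_iterated(1)[OF cont])
qed

section \<open>Characters of the torus\<close>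

text \<open>Integer pairs as indices, instead of elements of \<open>freqs\<close>, form a countable
  type and an additive group: the diagonal argument relies on the former, the calculus of characters
  on the latter.\<close>

definition torus_char :: "int \<times> int \<Rightarrow> real \<times> real \<Rightarrow> complex" where
  "torus_char k x = cis (2 * pi * (of_int (fst k) * fst x + of_int (snd k) * snd x))"

lemma torus_char_0 [simp]: "torus_char 0 x = 1"
  by (simp add: torus_char_def)

lemma torus_char_add: "torus_char (k + l) x = torus_char k x * torus_char l x"
  by (simp add: torus_char_def cis_mult algebra_simps)

lemma cnj_torus_char: "cnj (torus_char k x) = torus_char (- k) x"
  by (simp add: torus_char_def cis_cnj flip: minus_add_distrib) (simp add: algebra_simps)

lemma torus_char_diff: "torus_char (k - l) x = torus_char k x * cnj (torus_char l x)"
  by (metis torus_char_add cnj_torus_char diff_conv_add_uminus)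

lemma torus_char_diff_arg: "torus_char k (x - y) = torus_char k x * cnj (torus_char k y)"
  by (simp add: torus_char_def cis_cnj cis_mult algebra_simps)

lemma torus_char_add_arg: "torus_char k (x + y) = torus_char k x * torus_char k y"
  by (simp add: torus_char_def cis_mult algebra_simps)

lemma norm_torus_char [simp]: "norm (torus_char k x) = 1"
  by (simp add: torus_char_def)

lemma torus_char_int: "fst x \<in> \<int> \<Longrightarrow> snd x \<in> \<int> \<Longrightarrow> torus_char k x = 1"
  unfolding torus_char_def by (intro cis_multiple_2pi) auto

lemma periodic_torus_char: "periodic (torus_char k)"
  by (auto simp: periodic_def torus_char_add_arg torus_char_int)

lemma continuous_torus_char [continuous_intros]: "continuous_on A (torus_char k)"
  unfolding torus_char_def by (intro continuous_intros)

lemma torus_char_vector_derivative1: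
  "((\<lambda>t. torus_char k (t, y)) has_vector_derivative 2 * pi * \<i> * of_int (fst k) * torus_char k (x, y)) (at x)"
proof -
  let ?a = "2 * pi * \<i> * of_int (fst k)" and ?b = "2 * pi * \<i> * of_int (snd k) * of_real y"
  have e: "exp (?a * of_real t + ?b) = torus_char k (t, y)" for t
    by (simp add: torus_char_def cis_conv_exp algebra_simps)
  have "((\<lambda>z. exp (?a * z + ?b)) has_field_derivative exp (?a * of_real x + ?b) * ?a)
      (at (of_real x :: complex))"
    by (auto intro!: derivative_eq_intros)
  from has_vector_derivative_real_field[OF this] show ?thesis
    unfolding e by (simp only: mult.commute)
qed

lemma torus_char_vector_derivative2:
  "((\<lambda>t. torus_char k (x, t)) has_vector_derivative 2 * pi * \<i> * of_int (snd k) * torus_char k (x, y)) (at y)"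
proof -
  let ?a = "2 * pi * \<i> * of_int (snd k)" and ?b = "2 * pi * \<i> * of_int (fst k) * of_real x"
  have e: "exp (?a * of_real t + ?b) = torus_char k (x, t)" for t
    by (simp add: torus_char_def cis_conv_exp algebra_simps)
  have "((\<lambda>z. exp (?a * z + ?b)) has_field_derivative exp (?a * of_real y + ?b) * ?a)
      (at (of_real y :: complex))"
    by (auto intro!: derivative_eq_intros)
  from has_vector_derivative_real_field[OF this] show ?thesis
    unfolding e by (simp only: mult.commute)
qed

text \<open>A nontrivial character is a multiple of its own derivative in some coordinate direction,
  with nonzero factor, so its integral vanishes by periodicity.\<close>

lemma integral_torus_char: "(\<integral>x. torus_char k x \<partial>torus) = (if k = 0 then 1 else 0)"
proof -
  consider "k = 0" | "fst k \<noteq> 0" | "snd k \<noteq> 0" by (metis prod_eqI fst_zero snd_zero)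
  then show ?thesis
  proof cases
    case 1 then show ?thesis by (simp add: measure_torus)
  next
    case 2
    have "(\<integral>x. 2 * pi * \<i> * of_int (fst k) * torus_char k x \<partial>torus) = 0"
      by (rule integral_partial1_periodic[OF periodic_torus_char[of k]])
         (rule continuous_intros torus_char_vector_derivative1)+
    then show ?thesis using 2 by auto
  next
    case 3
    have "(\<integral>x. 2 * pi * \<i> * of_int (snd k) * torus_char k x \<partial>torus) = 0"
      by (rule integral_partial2_periodic[OF periodic_torus_char[of k]])
         (rule continuous_intros torus_char_vector_derivative2)+
    then show ?thesis using 3 by auto
  qed
qed

section \<open>Fourier coefficients and Fejer means\<close>

definition fcoeff :: "(real \<times> real \<Rightarrow> real) \<Rightarrow> int \<times> int \<Rightarrow> complex" where
  "fcoeff f k = (\<integral>x. of_real (f x) * cnj (torus_char k x) \<partial>torus)"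

lemma measurable_torus_char [measurable]: "torus_char k \<in> borel_measurable borel"
  by (intro borel_measurable_continuous_onI continuous_torus_char)

lemma measurable_torus_char_torus [measurable]: "torus_char k \<in> borel_measurable torus"
  by (intro measurable_torus measurable_torus_char)

lemma integrable_mult_torus_char:
  assumes "integrable torus (f :: _ \<Rightarrow> real)"
  shows "integrable torus (\<lambda>x. complex_of_real (f x) * torus_char k x)"
    and "integrable torus (\<lambda>x. complex_of_real (f x) * cnj (torus_char k x))"
proof -
  have "integrable torus (\<lambda>x. complex_of_real (f x) * torus_char k x)" for k
    by (rule Bochner_Integration.integrable_bound[OF assms])
       (use assms in \<open>auto simp: norm_mult\<close>)
  then show "integrable torus (\<lambda>x. complex_of_real (f x) * torus_char k x)"
    and "integrable torus (\<lambda>x. complex_of_real (f x) * cnj (torus_char k x))"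
    by (simp_all add: cnj_torus_char)
qed

lemma norm_fc_le:
  assumes "integrable torus f"
  shows "norm (fcoeff f k) \<le> (\<integral>x. \<bar>f x\<bar> \<partial>torus)"
proof -
  have "norm (fcoeff f k) \<le> (\<integral>x. norm (complex_of_real (f x) * cnj (torus_char k x)) \<partial>torus)"
    unfolding fcoeff_def by (rule integral_norm_bound)
  then show ?thesis by (simp add: norm_mult)
qed

lemma fcoeff_diff:
  assumes "integrable torus f" "integrable torus g"
  shows "fcoeff (\<lambda>x. f x - g x) k = fcoeff f k - fcoeff g k"
  unfolding fcoeff_def
  by (simp add: left_diff_distrib integrable_mult_torus_char assms Bochner_Integration.integral_diff)

lemma fcoeff_cmult: "fcoeff (\<lambda>x. c * f x) k = of_real c * fcoeff f k"
  unfolding fcoeff_def by (simp add: mult.assoc)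

definition trig_poly :: "(int \<times> int) set \<Rightarrow> (int \<times> int \<Rightarrow> complex) \<Rightarrow> real \<times> real \<Rightarrow> complex" where
  "trig_poly S c x = (\<Sum>k\<in>S. c k * torus_char k x)"

lemma continuous_trig_poly [continuous_intros]: "continuous_on A (trig_poly S c)"
  unfolding trig_poly_def by (intro continuous_intros)

lemma integral_torus_char_cnj:
  "(\<integral>x. torus_char k x * cnj (torus_char l x) \<partial>torus) = (if k = l then 1 else 0)"
  using integral_torus_char[of "k - l"] by (simp add: torus_char_diff)

lemma trig_poly_coeff:
  assumes "finite S"
  shows "(\<integral>x. trig_poly S c x * cnj (torus_char l x) \<partial>torus) = (if l \<in> S then c l else 0)"
proof -
  have "(\<integral>x. trig_poly S c x * cnj (torus_char l x) \<partial>torus)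
      = (\<integral>x. (\<Sum>k\<in>S. c k * (torus_char k x * cnj (torus_char l x))) \<partial>torus)"
    by (simp add: trig_poly_def sum_distrib_right mult.assoc)
  also have "\<dots> = (\<Sum>k\<in>S. \<integral>x. c k * (torus_char k x * cnj (torus_char l x)) \<partial>torus)"
    by (rule Bochner_Integration.integral_sum)
       (intro integrable_torus_continuous continuous_intros)
  also have "\<dots> = (\<Sum>k\<in>S. c k * (if k = l then 1 else 0))"
    by (simp add: integral_torus_char_cnj)
  also have "\<dots> = (if l \<in> S then c l else 0)"
    using assms by (simp add: mult_delta_right)
  finally show ?thesis .
qed

lemma integral_mult_trig_poly:
  assumes "finite S" "integrable torus f"
  shows "(\<integral>x. of_real (f x) * cnj (trig_poly S c x) \<partial>torus) = (\<Sum>k\<in>S. cnj (c k) * fcoeff f k)"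
proof -
  have "(\<integral>x. of_real (f x) * cnj (trig_poly S c x) \<partial>torus)
      = (\<integral>x. (\<Sum>k\<in>S. cnj (c k) * (of_real (f x) * cnj (torus_char k x))) \<partial>torus)"
    by (simp add: trig_poly_def sum_distrib_left mult_ac)
  also have "\<dots> = (\<Sum>k\<in>S. \<integral>x. cnj (c k) * (of_real (f x) * cnj (torus_char k x)) \<partial>torus)"
    by (rule Bochner_Integration.integral_sum) (simp add: integrable_mult_torus_char assms)
  finally show ?thesis by (simp add: fcoeff_def)
qed

lemma parseval_trig_poly:
  assumes "finite S"
  shows "(\<integral>x. (norm (trig_poly S c x))\<^sup>2 \<partial>torus) = (\<Sum>k\<in>S. (norm (c k))\<^sup>2)"
proof -
  have "complex_of_real (\<integral>x. (norm (trig_poly S c x))\<^sup>2 \<partial>torus)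
      = (\<integral>x. trig_poly S c x * cnj (trig_poly S c x) \<partial>torus)"
    by (simp only: complex_norm_square flip: integral_complex_of_real)
  also have "\<dots> = (\<integral>x. (\<Sum>k\<in>S. cnj (c k) * (trig_poly S c x * cnj (torus_char k x))) \<partial>torus)"
    by (intro Bochner_Integration.integral_cong refl)
       (simp add: trig_poly_def[of S c] sum_distrib_left mult_ac)
  also have "\<dots> = (\<Sum>k\<in>S. \<integral>x. cnj (c k) * (trig_poly S c x * cnj (torus_char k x)) \<partial>torus)"
    by (rule Bochner_Integration.integral_sum)
       (intro integrable_torus_continuous continuous_intros)
  also have "\<dots> = (\<Sum>k\<in>S. cnj (c k) * c k)"
    by (simp add: trig_poly_coeff[OF assms])
  also have "\<dots> = complex_of_real (\<Sum>k\<in>S. (norm (c k))\<^sup>2)"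
    unfolding of_real_sum by (simp only: complex_norm_square mult.commute)
  finally show ?thesis by (simp only: of_real_eq_iff)
qed

text \<open>The squared L^2 distance between \<open>f\<close> and its partial Fourier sum is
  nonnegative. After expansion, the cross term and the norm of the partial sum are -2 and 1 times
  the same sum of squares.\<close>

lemma bessel:
  assumes "finite S" "f \<in> borel_measurable torus" "integrable torus (\<lambda>x. (f x)\<^sup>2)"
  shows "(\<Sum>k\<in>S. (norm (fcoeff f k))\<^sup>2) \<le> (\<integral>x. (f x)\<^sup>2 \<partial>torus)"
proof -
  let ?t = "trig_poly S (fcoeff f)"
  have f: "integrable torus f"
    using assms torus.square_integrable_imp_integrable by blast
  have i: "integrable torus (\<lambda>x. of_real (f x) * cnj (?t x))"
    unfolding trig_poly_def cnj_sum complex_cnj_mult sum_distrib_left mult.left_commute[of "of_real _"]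
    by (intro Bochner_Integration.integrable_sum integrable_mult_right integrable_mult_torus_char f)
  have t: "integrable torus (\<lambda>x. (norm (?t x))\<^sup>2)"
    by (intro integrable_torus_continuous continuous_intros)
  have eq: "(norm (of_real (f x) - ?t x))\<^sup>2
      = (f x)\<^sup>2 - 2 * Re (of_real (f x) * cnj (?t x)) + (norm (?t x))\<^sup>2" for x
    unfolding cmod_power2 by (simp add: power2_eq_square algebra_simps)
  have "0 \<le> (\<integral>x. (norm (of_real (f x) - ?t x))\<^sup>2 \<partial>torus)"
    by simp
  also have "\<dots> = (\<integral>x. (f x)\<^sup>2 \<partial>torus) - 2 * (\<integral>x. Re (of_real (f x) * cnj (?t x)) \<partial>torus)
      + (\<integral>x. (norm (?t x))\<^sup>2 \<partial>torus)"
    unfolding eq using i t assms(3) integrable_Re[OF i] by simp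
  also have "(\<integral>x. Re (of_real (f x) * cnj (?t x)) \<partial>torus) = (\<Sum>k\<in>S. (norm (fcoeff f k))\<^sup>2)"
    unfolding integral_Re[OF i] integral_mult_trig_poly[OF assms(1) f] cmod_power2
    by (simp add: power2_eq_square)
  finally show ?thesis
    by (simp add: parseval_trig_poly[OF assms(1)])
qed

section \<open>The Fejer kernel and its multipliers\<close>

definition fejer_box :: "nat \<Rightarrow> (int \<times> int) set" where
  "fejer_box N = {0..<int N} \<times> {0..<int N}"

text \<open>The product of two one-dimensional Fejer kernels. As the squared modulus of an
  exponential sum it is visibly nonnegative, and its Fourier coefficients become counts of
  differences. For \<open>N = 0\<close> it is the zero function, hence the condition
  \<open>N > 0\<close> wherever total mass one matters.\<close>

definition fejer_kernel :: "nat \<Rightarrow> real \<times> real \<Rightarrow> real" where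
  "fejer_kernel N x = (norm (\<Sum>k\<in>fejer_box N. torus_char k x))\<^sup>2 / (real N)\<^sup>2"

definition fejer_freqs :: "nat \<Rightarrow> (int \<times> int) set" where
  "fejer_freqs N = (\<lambda>(a, b). a - b) ` (fejer_box N \<times> fejer_box N)"

text \<open>For \<open>N > 0\<close> this is the product of the two triangles
  \<open>max 0 (1 - |k1| / N)\<close> and \<open>max 0 (1 - |k2| / N)\<close>. The counting form
  comes directly from multiplying out the squared modulus; explicit values are computed only at 0
  and at the two unit frequencies.\<close>

definition fejer_mult :: "nat \<Rightarrow> int \<times> int \<Rightarrow> real" where
  "fejer_mult N k = card {p \<in> fejer_box N \<times> fejer_box N. fst p - snd p = k} / (real N)\<^sup>2"

definition fejer :: "nat \<Rightarrow> (real \<times> real \<Rightarrow> real) \<Rightarrow> real \<times> real \<Rightarrow> real" where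
  "fejer N f x = (\<integral>y. fejer_kernel N (x - y) * f y \<partial>torus)"

lemma finite_fejer [simp]: "finite (fejer_box N)" "finite (fejer_freqs N)"
  by (auto simp: fejer_box_def fejer_freqs_def)

lemma card_fejer_box: "card (fejer_box N) = N\<^sup>2"
  by (simp add: fejer_box_def card_cartesian_product power2_eq_square)

lemma fejer_mult_outside: "k \<notin> fejer_freqs N \<Longrightarrow> fejer_mult N k = 0"
proof -
  assume "k \<notin> fejer_freqs N"
  then have "{p \<in> fejer_box N \<times> fejer_box N. fst p - snd p = k} = {}"
    by (force simp: fejer_freqs_def image_iff)
  then show ?thesis unfolding fejer_mult_def by (metis card.empty div_0 of_nat_0)
qed

lemma fejer_mult_nonneg: "0 \<le> fejer_mult N k"
  by (simp add: fejer_mult_def)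

text \<open>A pair with prescribed difference is determined by its second entry, so there are at
  most \<open>N\<^sup>2\<close> pairs. For \<open>N = 0\<close> the quotient is 0 by
  convention.\<close>

lemma fejer_mult_le_1: "fejer_mult N k \<le> 1"
proof -
  have "card {p \<in> fejer_box N \<times> fejer_box N. fst p - snd p = k} \<le> card (fejer_box N)"
    by (rule card_inj_on_le[where f = snd]) (auto intro!: inj_onI simp del: split_paired_All simp: diff_eq_eq prod_eq_iff)
  then have "real (card {p \<in> fejer_box N \<times> fejer_box N. fst p - snd p = k}) \<le> (real N)\<^sup>2"
    unfolding card_fejer_box by (simp only: of_nat_le_iff flip: of_nat_power)
  then show ?thesis
    unfolding fejer_mult_def by (intro divide_le_eq_1[THEN iffD2]) auto
qed

lemma fejer_kernel_nonneg: "0 \<le> fejer_kernel N x"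
  by (simp add: fejer_kernel_def)

lemma continuous_fejer_kernel [continuous_intros]: "continuous_on A (fejer_kernel N)"
  unfolding fejer_kernel_def divide_inverse by (intro continuous_intros)

lemma fejer_kernel_eq:
  "of_real (fejer_kernel N x) = (\<Sum>k\<in>fejer_freqs N. of_real (fejer_mult N k) * torus_char k x)"
proof -
  let ?B = "fejer_box N"
  have "of_real (fejer_kernel N x)
      = (\<Sum>a\<in>?B. torus_char a x) * cnj (\<Sum>b\<in>?B. torus_char b x) / of_real ((real N)\<^sup>2)"
    by (simp only: fejer_kernel_def of_real_divide complex_norm_square)
  also have "(\<Sum>a\<in>?B. torus_char a x) * cnj (\<Sum>b\<in>?B. torus_char b x)
      = (\<Sum>p\<in>?B \<times> ?B. torus_char (fst p - snd p) x)"
    by (simp add: sum_product sum.cartesian_product torus_char_diff case_prod_beta)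
  also have "\<dots> = (\<Sum>k\<in>fejer_freqs N. \<Sum>p\<in>{p \<in> ?B \<times> ?B. fst p - snd p = k}. torus_char (fst p - snd p) x)"
    unfolding fejer_freqs_def case_prod_beta by (rule sum.image_gen) simp
  also have "\<dots> = (\<Sum>k\<in>fejer_freqs N. \<Sum>p\<in>{p \<in> ?B \<times> ?B. fst p - snd p = k}. torus_char k x)"
    by (intro sum.cong refl) auto
  finally show ?thesis
    by (simp add: fejer_mult_def sum_divide_distrib)
qed

lemma fejer_kernel_torus_char:
  "(\<integral>y. of_real (fejer_kernel N (x - y)) * torus_char k y \<partial>torus) = of_real (fejer_mult N k) * torus_char k x"
proof -
  have "(\<integral>y. of_real (fejer_kernel N (x - y)) * torus_char k y \<partial>torus)
      = (\<integral>y. (\<Sum>l\<in>fejer_freqs N. of_real (fejer_mult N l) * torus_char l x * (torus_char k y * cnj (torus_char l y))) \<partial>torus)"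
    by (simp add: fejer_kernel_eq torus_char_diff_arg sum_distrib_left sum_distrib_right mult_ac)
  also have "\<dots> = (\<Sum>l\<in>fejer_freqs N.
      \<integral>y. of_real (fejer_mult N l) * torus_char l x * (torus_char k y * cnj (torus_char l y)) \<partial>torus)"
    by (rule Bochner_Integration.integral_sum)
       (intro integrable_torus_continuous continuous_intros)
  also have "\<dots> = (\<Sum>l\<in>fejer_freqs N. of_real (fejer_mult N l) * torus_char l x * (if k = l then 1 else 0))"
    by (simp add: integral_torus_char_cnj)
  also have "\<dots> = of_real (fejer_mult N k) * torus_char k x"
    using fejer_mult_outside[of k N] by (auto simp: mult_delta_right)
  finally show ?thesis .
qed

lemma fejer_mult_0: "N > 0 \<Longrightarrow> fejer_mult N 0 = 1"
proof -
  assume N: "N > 0"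
  have "{p \<in> fejer_box N \<times> fejer_box N. fst p - snd p = 0} = (\<lambda>a. (a, a)) ` fejer_box N"
    by auto
  then have "card {p \<in> fejer_box N \<times> fejer_box N. fst p - snd p = 0} = N\<^sup>2"
    by (simp add: card_image inj_on_def card_fejer_box)
  then show ?thesis using N by (simp add: fejer_mult_def)
qed

text \<open>A box shifted by one unit along an axis keeps \<open>(N - 1) * N\<close> of its points
  inside the original box. These two values measure how the kernel concentrates, see
  \<open>fejer_kernel_distance\<close>.\<close>

lemma fejer_mult_unit:
  assumes "N > 0" "k = (1, 0) \<or> k = (0, 1)"
  shows "fejer_mult N k = 1 - 1 / N"
proof -
  let ?I = "{0..<int N}"
  let ?J = "{1..<int N}"
  have "card {p \<in> fejer_box N \<times> fejer_box N. fst p - snd p = k} = (N - 1) * N"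
    using assms(2)
  proof
    assume k: "k = (1, 0)"
    have "{p \<in> fejer_box N \<times> fejer_box N. fst p - snd p = k} = (\<lambda>a. (a, a - k)) ` (?J \<times> ?I)"
      by (auto simp: fejer_box_def k image_iff)
    moreover have "inj_on (\<lambda>a. (a, a - k)) (?J \<times> ?I)" by (auto simp: inj_on_def)
    ultimately show ?thesis by (simp add: card_image card_cartesian_product nat_diff_distrib')
  next
    assume k: "k = (0, 1)"
    have "{p \<in> fejer_box N \<times> fejer_box N. fst p - snd p = k} = (\<lambda>a. (a, a - k)) ` (?I \<times> ?J)"
      by (auto simp: fejer_box_def k image_iff)
    moreover have "inj_on (\<lambda>a. (a, a - k)) (?I \<times> ?J)" by (auto simp: inj_on_def)
    ultimately show ?thesis by (simp add: card_image card_cartesian_product nat_diff_distrib')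
  qed
  then show ?thesis using assms(1)
    by (simp add: fejer_mult_def power2_eq_square field_simps of_nat_diff)
qed

lemma integrable_fejer_kernel:
  assumes "integrable torus f"
  shows "integrable torus (\<lambda>y. fejer_kernel N (x - y) * f y)"
proof (rule Bochner_Integration.integrable_bound)
  show "integrable torus (\<lambda>y. (real (card (fejer_box N)))\<^sup>2 / (real N)\<^sup>2 * f y)"
    using assms by simp
  have "(\<lambda>y. fejer_kernel N (x - y)) \<in> borel_measurable torus"
    by (intro measurable_torus borel_measurable_continuous_onI continuous_intros
      continuous_on_compose2[OF continuous_fejer_kernel[of UNIV]]) auto
  then show "(\<lambda>y. fejer_kernel N (x - y) * f y) \<in> borel_measurable torus"
    using assms by measurable
  have "fejer_kernel N z \<le> (real (card (fejer_box N)))\<^sup>2 / (real N)\<^sup>2" for z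
    unfolding fejer_kernel_def
    by (intro divide_right_mono power_mono order_trans[OF sum_norm_bound[of _ _ 1]]) auto
  then show "AE y in torus. norm (fejer_kernel N (x - y) * f y)
      \<le> norm ((real (card (fejer_box N)))\<^sup>2 / (real N)\<^sup>2 * f y)"
    using fejer_kernel_nonneg[of N "x - _"]
    by (intro AE_I2) (simp add: abs_mult abs_of_nonneg mult_right_mono del: times_divide_eq_left)
qed

lemma fejer_eq_trig_poly:
  assumes "integrable torus f"
  shows "of_real (fejer N f x) = trig_poly (fejer_freqs N) (\<lambda>k. of_real (fejer_mult N k) * fcoeff f k) x"
proof -
  have "of_real (fejer N f x) = (\<integral>y. complex_of_real (fejer_kernel N (x - y)) * of_real (f y) \<partial>torus)"
    unfolding fejer_def by (simp flip: integral_complex_of_real)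
  also have "\<dots> = (\<integral>y. (\<Sum>l\<in>fejer_freqs N. of_real (fejer_mult N l) * torus_char l x * (of_real (f y) * cnj (torus_char l y))) \<partial>torus)"
    by (simp add: fejer_kernel_eq torus_char_diff_arg sum_distrib_left sum_distrib_right mult_ac)
  also have "\<dots> = (\<Sum>l\<in>fejer_freqs N.
      \<integral>y. of_real (fejer_mult N l) * torus_char l x * (of_real (f y) * cnj (torus_char l y)) \<partial>torus)"
    by (rule Bochner_Integration.integral_sum) (simp add: integrable_mult_torus_char assms)
  finally show ?thesis
    by (simp only: fcoeff_def trig_poly_def integral_mult_right_zero) (simp add: mult_ac)
qed

lemma fejer_eq_Re_trig_poly:
  assumes "integrable torus f"
  shows "fejer N f = (\<lambda>x. Re (trig_poly (fejer_freqs N) (\<lambda>k. of_real (fejer_mult N k) * fcoeff f k) x))"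
  using fejer_eq_trig_poly[OF assms, of N] by (metis Re_complex_of_real)

lemma continuous_fejer:
  assumes "integrable torus f"
  shows "continuous_on A (fejer N f)"
  unfolding fejer_eq_Re_trig_poly[OF assms] by (intro continuous_intros)

lemma fcoeff_fejer:
  assumes "integrable torus f"
  shows "fcoeff (fejer N f) k = of_real (fejer_mult N k) * fcoeff f k"
  unfolding fcoeff_def[of "fejer N f"] fejer_eq_trig_poly[OF assms] trig_poly_coeff[OF finite_fejer(2)]
  using fejer_mult_outside[of k N] by auto

lemma fejer_kernel_integral:
  assumes "N > 0"
  shows "(\<integral>y. fejer_kernel N (x - y) \<partial>torus) = 1"
proof -
  have "complex_of_real (\<integral>y. fejer_kernel N (x - y) \<partial>torus) = of_real 1"
    using fejer_kernel_torus_char[of N x 0] fejer_mult_0[OF assms] by simp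
  then show ?thesis by (simp only: of_real_eq_iff)
qed

lemma abs_fejer_le:
  assumes "integrable torus f" "\<And>x. x \<in> space torus \<Longrightarrow> \<bar>f x\<bar> \<le> B" "N > 0"
  shows "\<bar>fejer N f x\<bar> \<le> B"
proof -
  have k: "integrable torus (\<lambda>y. fejer_kernel N (x - y))"
    using integrable_fejer_kernel[of "\<lambda>_. 1"] by simp
  have "\<bar>fejer N f x\<bar> \<le> (\<integral>y. \<bar>fejer_kernel N (x - y) * f y\<bar> \<partial>torus)"
    unfolding fejer_def by (rule integral_abs_bound)
  also have "\<dots> \<le> (\<integral>y. fejer_kernel N (x - y) * B \<partial>torus)"
    using assms fejer_kernel_nonneg k
    by (intro integral_mono integrable_abs integrable_fejer_kernel integrable_mult_left)
       (auto simp: abs_mult fejer_kernel_nonneg abs_of_nonneg intro!: mult_mono)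
  also have "\<dots> = B" by (simp add: fejer_kernel_integral[OF assms(3)])
  finally show ?thesis .
qed

text \<open>The multipliers are real, so the two sides have the same finite Fourier expansion up to
  conjugation. Passing through coefficients replaces Fubini's theorem for a double integral of
  merely integrable functions.\<close>

lemma fejer_adjoint:
  assumes f: "integrable torus f" and g: "integrable torus g"
  shows "(\<integral>x. g x * fejer N f x \<partial>torus) = (\<integral>x. f x * fejer N g x \<partial>torus)"
proof -
  have *: "complex_of_real (\<integral>x. g x * fejer N f x \<partial>torus)
      = (\<Sum>k\<in>fejer_freqs N. of_real (fejer_mult N k) * (fcoeff g k * cnj (fcoeff f k)))"
    if f: "integrable torus f" and g: "integrable torus g" for f g
  proof -
    have "complex_of_real (\<integral>x. g x * fejer N f x \<partial>torus)
        = (\<integral>x. of_real (g x) * cnj (of_real (fejer N f x)) \<partial>torus)"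
      by (simp flip: integral_complex_of_real)
    then show ?thesis
      unfolding fejer_eq_trig_poly[OF f] integral_mult_trig_poly[OF finite_fejer(2) g] by (simp add: mult_ac)
  qed
  have "complex_of_real (\<integral>x. g x * fejer N f x \<partial>torus)
      = cnj (complex_of_real (\<integral>x. f x * fejer N g x \<partial>torus))"
    unfolding *[OF f g] *[OF g f] by (simp add: mult_ac)
  then show ?thesis by (simp only: complex_cnj_complex_of_real of_real_eq_iff)
qed

lemma measurable_fejer: "integrable torus f \<Longrightarrow> fejer N f \<in> borel_measurable torus"
  by (rule measurable_torus) (rule borel_measurable_continuous_onI, rule continuous_fejer)

lemma integrable_fejer: "integrable torus f \<Longrightarrow> integrable torus (fejer N f)"
  by (rule integrable_torus_continuous) (rule continuous_fejer)

text \<open>By duality: testing with \<open>sgn (fejer N f)\<close> and moving the Fejer mean onto it.\<close>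

lemma fejer_L1_contraction:
  assumes f: "integrable torus f" and N: "N > 0"
  shows "(\<integral>x. \<bar>fejer N f x\<bar> \<partial>torus) \<le> (\<integral>x. \<bar>f x\<bar> \<partial>torus)"
proof -
  let ?s = "\<lambda>x. sgn (fejer N f x)"
  have s: "integrable torus ?s"
    using measurable_fejer[OF f] by (intro integrable_torus_bounded[where B = 1]) (auto simp: sgn_if)
  have b: "\<bar>fejer N ?s x\<bar> \<le> 1" for x
    by (rule abs_fejer_le[OF s _ N]) (auto simp: sgn_if)
  have "(\<integral>x. \<bar>fejer N f x\<bar> \<partial>torus) = (\<integral>x. ?s x * fejer N f x \<partial>torus)"
    by (simp add: abs_sgn mult.commute)
  also have "\<dots> = (\<integral>x. f x * fejer N ?s x \<partial>torus)"
    by (rule fejer_adjoint[OF f s])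
  also have "\<dots> \<le> (\<integral>x. \<bar>f x\<bar> \<partial>torus)"
  proof (rule integral_mono)
    show "integrable torus (\<lambda>x. f x * fejer N ?s x)"
      by (rule Bochner_Integration.integrable_bound[OF f])
         (use f measurable_fejer[OF s] b in \<open>auto simp: abs_mult mult_left_le\<close>)
    show "f x * fejer N ?s x \<le> \<bar>f x\<bar>" for x
    proof -
      have "f x * fejer N ?s x \<le> \<bar>f x\<bar> * \<bar>fejer N ?s x\<bar>"
        by (metis abs_ge_self abs_mult)
      also have "\<dots> \<le> \<bar>f x\<bar>" using b[of x] by (simp add: mult_left_le)
      finally show ?thesis .
    qed
  qed (use f in auto)
  finally show ?thesis .
qed

section \<open>Convergence of Fejer means\<close>

text \<open>The squared chord between two values of a character is 2 minus twice a real part, whose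
  average against the kernel is the multiplier \<open>1 - 1 / N\<close>. Chords of the two unit
  characters serve as distance on the torus: they are periodic by construction.\<close>

lemma fejer_kernel_distance:
  assumes "N > 0" "k = (1, 0) \<or> k = (0, 1)"
  shows "(\<integral>y. fejer_kernel N (x - y) * (norm (torus_char k x - torus_char k y))\<^sup>2 \<partial>torus) = 2 / N"
proof -
  let ?K = "\<lambda>y. fejer_kernel N (x - y)"
  have c: "continuous_on UNIV ?K"
    by (intro continuous_on_compose2[OF continuous_fejer_kernel[of UNIV]] continuous_intros) auto
  have i: "integrable torus (\<lambda>y. complex_of_real (?K y) * torus_char k y)"
    by (intro integrable_mult_torus_char integrable_torus_continuous c)
  have eq: "(norm (torus_char k x - torus_char k y))\<^sup>2 = 2 - 2 * Re (cnj (torus_char k x) * torus_char k y)" for y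
  proof -
    have "(norm (torus_char k x - torus_char k y))\<^sup>2
        = (norm (torus_char k x))\<^sup>2 + (norm (torus_char k y))\<^sup>2 - 2 * Re (cnj (torus_char k x) * torus_char k y)"
      unfolding cmod_power2 by (simp add: power2_eq_square algebra_simps)
    then show ?thesis by simp
  qed
  have "(\<integral>y. ?K y * (norm (torus_char k x - torus_char k y))\<^sup>2 \<partial>torus)
      = (\<integral>y. 2 * ?K y - 2 * Re (cnj (torus_char k x) * (complex_of_real (?K y) * torus_char k y)) \<partial>torus)"
    by (intro Bochner_Integration.integral_cong refl) (simp add: eq algebra_simps)
  also have "\<dots> = 2 * (\<integral>y. ?K y \<partial>torus)
      - 2 * Re (cnj (torus_char k x) * (\<integral>y. complex_of_real (?K y) * torus_char k y \<partial>torus))"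
    using integrable_torus_continuous[OF c] i
    by (subst Bochner_Integration.integral_diff)
       (auto simp only: integral_Re integrable_Re integrable_mult_right integral_mult_right_zero simp_thms)
  also have "cnj (torus_char k x) * (\<integral>y. complex_of_real (?K y) * torus_char k y \<partial>torus)
      = of_real (fejer_mult N k) * (cnj (torus_char k x) * torus_char k x)"
    by (simp add: fejer_kernel_torus_char)
  also have "cnj (torus_char k x) * torus_char k x = 1"
    by (metis cnj_torus_char torus_char_add add.left_inverse torus_char_0)
  finally show ?thesis
    using assms by (simp add: fejer_kernel_integral fejer_mult_unit)
qed

text \<open>The kernel has mass one and mean square distance \<open>4 / N\<close>, which controls functions that are
  Lipschitz with respect to the distance on the torus.\<close>

lemma fejer_Lipschitz:
  assumes f: "integrable torus f" and N: "N > 0" and L: "L \<ge> 0"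
    and lip: "\<And>y. \<bar>f y - f x\<bar> \<le> L * (norm (torus_char (1, 0) x - torus_char (1, 0) y) + norm (torus_char (0, 1) x - torus_char (0, 1) y))"
  shows "\<bar>fejer N f x - f x\<bar> \<le> 3 * L / sqrt N"
proof -
  let ?K = "\<lambda>y. fejer_kernel N (x - y)" and ?a = "\<lambda>y. norm (torus_char (1, 0) x - torus_char (1, 0) y)"
    and ?b = "\<lambda>y. norm (torus_char (0, 1) x - torus_char (0, 1) y)" and ?s = "sqrt N"
  have s: "?s > 0" "?s * ?s = N" using N by auto
  have c: "continuous_on UNIV ?K"
    by (intro continuous_on_compose2[OF continuous_fejer_kernel[of UNIV]] continuous_intros) auto
  have K: "integrable torus ?K" "integrable torus (\<lambda>y. ?K y * (?a y)\<^sup>2)" "integrable torus (\<lambda>y. ?K y * (?b y)\<^sup>2)"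
    by (intro integrable_torus_continuous continuous_intros c)+
  \<comment> \<open>Young's inequality with weight \<open>sqrt N\<close>, matched to the second
    moment \<open>2 / N\<close>: the constant part and the two quadratic parts each contribute
    \<open>L / sqrt N\<close>, whence the factor 3.\<close>
  have young: "t \<le> 1 / ?s / 2 + ?s / 2 * t\<^sup>2" for t
  proof -
    have "0 \<le> (?s * t - 1)\<^sup>2" by simp
    then have "2 * ?s * t \<le> 1 + (?s * ?s) * t\<^sup>2"
      by (simp add: power2_eq_square algebra_simps)
    then show ?thesis using s(1) by (simp add: field_simps power2_eq_square)
  qed
  have "fejer N f x - f x = (\<integral>y. ?K y * (f y - f x) \<partial>torus)"
    unfolding fejer_def right_diff_distrib
    using K f integrable_fejer_kernel[OF f] by (simp add: fejer_kernel_integral N)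
  also have "\<bar>\<dots>\<bar> \<le> (\<integral>y. \<bar>?K y * (f y - f x)\<bar> \<partial>torus)"
    by (rule integral_abs_bound)
  also have "\<dots> \<le> (\<integral>y. L / ?s * ?K y + L * ?s / 2 * (?K y * (?a y)\<^sup>2) + L * ?s / 2 * (?K y * (?b y)\<^sup>2) \<partial>torus)"
  proof (rule integral_mono)
    show "integrable torus (\<lambda>y. \<bar>?K y * (f y - f x)\<bar>)"
      using K integrable_fejer_kernel[OF f] by (auto simp: right_diff_distrib)
    show "integrable torus (\<lambda>y. L / ?s * ?K y + L * ?s / 2 * (?K y * (?a y)\<^sup>2) + L * ?s / 2 * (?K y * (?b y)\<^sup>2))"
      by (intro Bochner_Integration.integrable_add integrable_mult_right K)
    fix y
    have "\<bar>f y - f x\<bar> \<le> L * (?a y + ?b y)" by (rule lip)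
    also have "\<dots> \<le> L * ((1 / ?s / 2 + ?s / 2 * (?a y)\<^sup>2) + (1 / ?s / 2 + ?s / 2 * (?b y)\<^sup>2))"
      by (intro mult_left_mono add_mono young L)
    finally have "?K y * \<bar>f y - f x\<bar> \<le> ?K y * (L * ((1 / ?s / 2 + ?s / 2 * (?a y)\<^sup>2) + (1 / ?s / 2 + ?s / 2 * (?b y)\<^sup>2)))"
      by (rule mult_left_mono) (rule fejer_kernel_nonneg)
    then show "\<bar>?K y * (f y - f x)\<bar> \<le> L / ?s * ?K y + L * ?s / 2 * (?K y * (?a y)\<^sup>2) + L * ?s / 2 * (?K y * (?b y)\<^sup>2)"
      unfolding abs_mult abs_of_nonneg[OF fejer_kernel_nonneg] by (simp add: algebra_simps)
  qed
  also have "\<dots> = L / ?s + L * ?s / 2 * (2 / N) + L * ?s / 2 * (2 / N)"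
    using K by (simp add: fejer_kernel_integral fejer_kernel_distance N del: of_nat_eq_0_iff)
  also have "\<dots> = L / ?s + L / ?s + L / ?s"
    using s by (simp add: real_div_sqrt field_simps)
  finally show ?thesis by simp
qed

definition fejer_converges :: "(real \<times> real \<Rightarrow> real) \<Rightarrow> bool" where
  "fejer_converges f \<longleftrightarrow> (\<lambda>N. \<integral>x. \<bar>fejer N f x - f x\<bar> \<partial>torus) \<longlonglongrightarrow> 0"

lemma fejer_add: "integrable torus f \<Longrightarrow> integrable torus g \<Longrightarrow> fejer N (\<lambda>x. f x + g x) x = fejer N f x + fejer N g x"
  unfolding fejer_def by (simp add: distrib_left integrable_fejer_kernel)

lemma fejer_diff: "integrable torus f \<Longrightarrow> integrable torus g \<Longrightarrow> fejer N (\<lambda>x. f x - g x) x = fejer N f x - fejer N g x"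
  unfolding fejer_def by (simp add: right_diff_distrib integrable_fejer_kernel)

lemma fejer_cmult: "fejer N (\<lambda>x. c * f x) x = c * fejer N f x"
  unfolding fejer_def by (simp add: mult.left_commute)

text \<open>Since Fejer means contract L^1, the functions whose means converge form a closed set:
  the error splits into the mean of \<open>f - g\<close>, the error for \<open>g\<close>, and
  \<open>f - g\<close> itself.\<close>

lemma fejer_converges_approx:
  assumes f: "integrable torus f"
    and ap: "\<And>e. e > 0 \<Longrightarrow> \<exists>g. integrable torus g \<and> fejer_converges g \<and> (\<integral>x. \<bar>f x - g x\<bar> \<partial>torus) < e"
  shows "fejer_converges f"
  unfolding fejer_converges_def
proof (rule LIMSEQ_I)
  fix e :: real assume e: "e > 0"
  then obtain g where g: "integrable torus g" "fejer_converges g" "(\<integral>x. \<bar>f x - g x\<bar> \<partial>torus) < e / 3"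
    using ap[of "e / 3"] by auto
  from g(2) e have "\<forall>\<^sub>F N in sequentially. (\<integral>x. \<bar>fejer N g x - g x\<bar> \<partial>torus) < e / 3"
    unfolding fejer_converges_def by (intro order_tendstoD(2)) auto
  then have "\<forall>\<^sub>F N in sequentially. norm ((\<integral>x. \<bar>fejer N f x - f x\<bar> \<partial>torus) - 0) < e"
    using eventually_gt_at_top[of 0]
  proof eventually_elim
    case (elim N)
    note i = f g(1) integrable_fejer[OF f, of N] integrable_fejer[OF g(1), of N]
    have fg: "integrable torus (\<lambda>x. f x - g x)" using i by simp
    have "(\<integral>x. \<bar>fejer N f x - f x\<bar> \<partial>torus)
        \<le> (\<integral>x. \<bar>fejer N (\<lambda>x. f x - g x) x\<bar> + \<bar>fejer N g x - g x\<bar> + \<bar>f x - g x\<bar> \<partial>torus)"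
      using i by (intro integral_mono Bochner_Integration.integrable_add integrable_abs integrable_fejer fg)
        (auto simp: fejer_diff)
    also have "\<dots> = (\<integral>x. \<bar>fejer N (\<lambda>x. f x - g x) x\<bar> \<partial>torus) + (\<integral>x. \<bar>fejer N g x - g x\<bar> \<partial>torus)
        + (\<integral>x. \<bar>f x - g x\<bar> \<partial>torus)"
      using i integrable_fejer[OF fg, of N] by simp
    also have "\<dots> < e"
      using fejer_L1_contraction[OF fg \<open>0 < N\<close>] g(3) elim(1) by linarith
    finally show ?case by simp
  qed
  then show "\<exists>no. \<forall>N\<ge>no. norm ((\<integral>x. \<bar>fejer N f x - f x\<bar> \<partial>torus) - 0) < e"
    by (simp add: eventually_sequentially)
qed

lemma fejer_converges_add:
  assumes f: "integrable torus f" "fejer_converges f" and g: "integrable torus g" "fejer_converges g"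
  shows "fejer_converges (\<lambda>x. f x + g x)"
  unfolding fejer_converges_def
proof (rule tendsto_sandwich[OF _ _ tendsto_const])
  show "(\<lambda>N. (\<integral>x. \<bar>fejer N f x - f x\<bar> \<partial>torus) + (\<integral>x. \<bar>fejer N g x - g x\<bar> \<partial>torus)) \<longlonglongrightarrow> 0"
    using tendsto_add[OF f(2)[unfolded fejer_converges_def] g(2)[unfolded fejer_converges_def]] by simp
  have "(\<integral>x. \<bar>fejer N (\<lambda>x. f x + g x) x - (f x + g x)\<bar> \<partial>torus)
      \<le> (\<integral>x. \<bar>fejer N f x - f x\<bar> + \<bar>fejer N g x - g x\<bar> \<partial>torus)" for N
    using f g integrable_fejer[OF f(1), of N] integrable_fejer[OF g(1), of N]
      integrable_fejer[of "\<lambda>x. f x + g x" N]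
    by (intro integral_mono) (auto simp: fejer_add)
  then show "\<forall>\<^sub>F N in sequentially. (\<integral>x. \<bar>fejer N (\<lambda>x. f x + g x) x - (f x + g x)\<bar> \<partial>torus)
      \<le> (\<integral>x. \<bar>fejer N f x - f x\<bar> \<partial>torus) + (\<integral>x. \<bar>fejer N g x - g x\<bar> \<partial>torus)"
    using f g integrable_fejer[OF f(1)] integrable_fejer[OF g(1)] by simp
qed simp

lemma fejer_converges_cmult:
  assumes "fejer_converges f"
  shows "fejer_converges (\<lambda>x. c * f x)"
proof -
  have "(\<integral>x. \<bar>fejer N (\<lambda>x. c * f x) x - c * f x\<bar> \<partial>torus) = \<bar>c\<bar> * (\<integral>x. \<bar>fejer N f x - f x\<bar> \<partial>torus)" for N
    by (simp add: fejer_cmult abs_mult flip: right_diff_distrib)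
  then show ?thesis
    using tendsto_mult_right_zero[OF assms[unfolded fejer_converges_def]]
    by (simp add: fejer_converges_def)
qed

lemma fejer_converges_Lipschitz:
  assumes f: "integrable torus f" and L: "L \<ge> 0"
    and lip: "\<And>x y. \<bar>f y - f x\<bar> \<le> L * (norm (torus_char (1, 0) x - torus_char (1, 0) y) + norm (torus_char (0, 1) x - torus_char (0, 1) y))"
  shows "fejer_converges f"
  unfolding fejer_converges_def
proof (rule tendsto_sandwich[OF _ _ tendsto_const])
  show "(\<lambda>N. 3 * L / sqrt (real N)) \<longlonglongrightarrow> 0"
    by (rule real_tendsto_divide_at_top[OF tendsto_const]) 
       (rule filterlim_compose[OF sqrt_at_top filterlim_real_sequentially])
  have "(\<integral>x. \<bar>fejer N f x - f x\<bar> \<partial>torus) \<le> 3 * L / sqrt N" if "N > 0" for N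
    using f integrable_fejer[OF f, of N] fejer_Lipschitz[OF f that L lip]
    by (intro integral_torus_le_const) auto
  then show "\<forall>\<^sub>F N in sequentially. (\<integral>x. \<bar>fejer N f x - f x\<bar> \<partial>torus) \<le> 3 * L / sqrt (real N)"
    by (intro eventually_mono[OF eventually_gt_at_top[of 0]])
qed simp

text \<open>The two unit characters embed the torus into a product of two circles. On the half-open
  square no opposite sides are identified, so the embedding separates its points.\<close>

lemma torus_char_inj:
  assumes "x \<in> space torus" "y \<in> space torus"
    and "torus_char (1, 0) x = torus_char (1, 0) y" "torus_char (0, 1) x = torus_char (0, 1) y"
  shows "x = y"
proof -
  have *: "a = b" if "cis (2 * pi * a) = cis (2 * pi * b)" "a \<in> {0..<1}" "b \<in> {0..<1}" for a b
  proof -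
    have "cis (2 * pi * (a - b)) = 1"
      using that(1) by (simp add: right_diff_distrib flip: cis_divide)
    then have "cos (2 * pi * (a - b)) = 1"
      by (metis cis.simps(1) one_complex.simps(1))
    then obtain n :: int where "2 * pi * (a - b) = of_int n * 2 * pi"
      by (auto simp: cos_one_2pi_int)
    then have "a - b = of_int n" by simp
    moreover have "\<bar>a - b\<bar> < 1" using that(2,3) by auto
    ultimately have "n = 0" by linarith
    then show ?thesis using \<open>a - b = of_int n\<close> by simp
  qed
  show ?thesis
    using assms * by (auto simp: torus_char_def space_torus)
qed

lemma fejer_converges_compact:
  assumes C: "compact C" "C \<subseteq> space torus"
  shows "fejer_converges (indicator C)"
proof (cases "C = {}")
  case True
  then show ?thesis by (simp add: fejer_converges_def fejer_def)
next
  case False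
  define E where "E x = (torus_char (1, 0) x, torus_char (0, 1) x)" for x
  define G where "G n x = max 0 (1 - real n * infdist (E x) (E ` C))" for n x
  have cE: "continuous_on A E" for A
    unfolding E_def by (intro continuous_intros)
  have cl: "closed (E ` C)" "E ` C \<noteq> {}"
    using C(1) False by (auto intro!: compact_imp_closed compact_continuous_image cE)
  have G: "integrable torus (G n)" for n
    unfolding G_def by (intro integrable_torus_continuous continuous_intros cE)
  have ind: "integrable torus (indicator C :: _ \<Rightarrow> real)"
    using C by (intro integrable_torus_bounded[where B = 1] measurable_torus
      borel_measurable_indicator borel_compact) (auto simp: indicator_def)
  have conv: "fejer_converges (G n)" for n
  proof (rule fejer_converges_Lipschitz[where L = "real n", OF G])
    fix x y
    have "\<bar>G n y - G n x\<bar> \<le> \<bar>real n * infdist (E y) (E ` C) - real n * infdist (E x) (E ` C)\<bar>"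
      unfolding G_def by linarith
    also have "\<dots> = real n * \<bar>infdist (E y) (E ` C) - infdist (E x) (E ` C)\<bar>"
      by (simp add: abs_mult flip: right_diff_distrib)
    also have "\<dots> \<le> real n * dist (E x) (E y)"
      by (intro mult_left_mono) (auto intro: infdist_triangle_abs[THEN order_trans] simp: dist_commute)
    also have "dist (E x) (E y) \<le> norm (torus_char (1, 0) x - torus_char (1, 0) y) + norm (torus_char (0, 1) x - torus_char (0, 1) y)"
      unfolding E_def dist_norm diff_Pair by (rule norm_Pair_le)
    finally show "\<bar>G n y - G n x\<bar> \<le> real n * (norm (torus_char (1, 0) x - torus_char (1, 0) y) + norm (torus_char (0, 1) x - torus_char (0, 1) y))"
      by (simp add: mult_left_mono)
  qed auto
  have lim: "(\<lambda>n. G n x) \<longlonglongrightarrow> indicator C x" if x: "x \<in> space torus" for x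
  proof (cases "x \<in> C")
    case True
    then have "infdist (E x) (E ` C) = 0" by simp
    then show ?thesis using True by (simp add: G_def)
  next
    case F: False
    have "E x \<notin> E ` C"
    proof
      assume "E x \<in> E ` C"
      then obtain y where "y \<in> C" "E x = E y" by auto
      then have "x = y" using torus_char_inj[OF x, of y] C(2) by (auto simp: E_def)
      with F \<open>y \<in> C\<close> show False by simp
    qed
    then have d: "infdist (E x) (E ` C) > 0"
      using cl by (metis in_closed_iff_infdist_zero infdist_nonneg order_le_less)
    have "\<forall>\<^sub>F n in sequentially. real n > 1 / infdist (E x) (E ` C)"
      using filterlim_real_sequentially by (simp add: filterlim_at_top_dense)
    then have "\<forall>\<^sub>F n in sequentially. indicator C x = G n x"
      by eventually_elim (use F d in \<open>simp add: G_def field_simps\<close>)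
    then show ?thesis
      using tendsto_const by (rule Lim_transform_eventually[rotated])
  qed
  have "(\<lambda>n. \<integral>x. \<bar>indicator C x - G n x\<bar> \<partial>torus) \<longlonglongrightarrow> (\<integral>x. 0 \<partial>torus)"
  proof (rule integral_dominated_convergence[where w = "\<lambda>_. 1"])
    show "AE x in torus. (\<lambda>n. \<bar>indicator C x - G n x\<bar>) \<longlonglongrightarrow> 0"
    proof (rule AE_I2)
      fix x assume "x \<in> space torus"
      from tendsto_rabs[OF tendsto_diff[OF tendsto_const[of "indicator C x"] lim[OF this]]]
      show "(\<lambda>n. \<bar>indicator C x - G n x\<bar>) \<longlonglongrightarrow> 0" by simp
    qed
    show "AE x in torus. norm \<bar>indicator C x - G n x\<bar> \<le> 1" for n
      by (intro AE_I2) (auto simp: G_def indicator_def infdist_nonneg)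
    show "(\<lambda>x. \<bar>indicator C x - G n x\<bar>) \<in> borel_measurable torus" for n
      using borel_measurable_integrable[OF ind] borel_measurable_integrable[OF G[of n]] by measurable
  qed auto
  then have lim1: "(\<lambda>n. \<integral>x. \<bar>indicator C x - G n x\<bar> \<partial>torus) \<longlonglongrightarrow> 0" by simp
  show ?thesis
  proof (rule fejer_converges_approx[OF ind])
    fix e :: real assume "e > 0"
    from order_tendstoD(2)[OF lim1 this] obtain n where "(\<integral>x. \<bar>indicator C x - G n x\<bar> \<partial>torus) < e"
      by (auto simp: eventually_sequentially)
    then show "\<exists>g. integrable torus g \<and> fejer_converges g \<and> (\<integral>x. \<bar>indicator C x - g x\<bar> \<partial>torus) < e"
      using G conv by blast
  qed
qed

text \<open>Regularity of finite Borel measures is applied to the image of \<open>torus\<close>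
  under the inclusion into the plane, which agrees with \<open>torus\<close> on Borel subsets of
  \<open>A\<close>.\<close>

lemma torus_inner_regular:
  assumes A: "A \<in> sets torus" and e: "e > 0"
  shows "\<exists>K. compact K \<and> K \<subseteq> A \<and> measure torus A - measure torus K < e"
proof (cases "measure torus A = 0")
  case True
  then show ?thesis using e by (intro exI[of _ "{}"]) auto
next
  case False
  let ?M = "distr torus borel (\<lambda>x. x)"
  have id: "(\<lambda>x. x) \<in> measurable torus borel"
    by (rule measurable_torus) simp
  have Asp: "A \<subseteq> space torus" using A by (rule sets.sets_into_space)
  have Ab: "A \<in> sets borel"
    using A sets_unit_square by (auto simp: torus_def sets_restrict_space)
  have em: "emeasure ?M B = emeasure torus B" if "B \<in> sets borel" "B \<subseteq> A" for B
    using that Asp by (subst emeasure_distr[OF id]) (auto intro!: arg_cong[where f = "emeasure torus"])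
  have "emeasure ?M A = (SUP K\<in>{K. K \<subseteq> A \<and> compact K}. emeasure ?M K)"
  proof (rule inner_regular)
    have "emeasure ?M (space ?M) = emeasure torus (space torus)"
      by (subst emeasure_distr[OF id]) auto
    then show "emeasure ?M (space ?M) \<noteq> \<infinity>" by (simp add: emeasure_torus)
  qed (use Ab in auto)
  also have "\<dots> = (SUP K\<in>{K. K \<subseteq> A \<and> compact K}. emeasure torus K)"
    by (intro SUP_cong refl em) (auto intro: borel_compact)
  finally have sup: "emeasure torus A = (SUP K\<in>{K. K \<subseteq> A \<and> compact K}. emeasure torus K)"
    using em[OF Ab] by simp
  have pos: "measure torus A > 0" using False by (simp add: zero_less_measure_iff)
  \<comment> \<open>Truncation at 0 keeps the argument of \<open>ennreal\<close> in the range where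
    it is strictly monotone. The result stays below the measure of \<open>A\<close> only if that is
    positive, hence the separate null case.\<close>
  have "ennreal (max 0 (measure torus A - e)) < emeasure torus A"
    unfolding torus.emeasure_eq_measure using e pos by (subst ennreal_less_iff) auto
  then obtain K where K: "K \<subseteq> A" "compact K" "ennreal (max 0 (measure torus A - e)) < emeasure torus K"
    unfolding sup by (auto simp: less_SUP_iff)
  from K(3) have "max 0 (measure torus A - e) < measure torus K"
    unfolding torus.emeasure_eq_measure by (subst (asm) ennreal_less_iff) auto
  then show ?thesis using K by (intro exI[of _ K]) auto
qed

text \<open>Induction over integrable functions: indicators are approximated in L^1 from inside by
  compact sets, and the class is stable under scalar multiples, sums and dominated limits.\<close>

theorem fejer_converges_L1:
  assumes "integrable torus f"
  shows "fejer_converges f"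
  using assms
proof (induction rule: integrable_induct)
  case (base A c)
  have iA: "integrable torus (indicator B :: _ \<Rightarrow> real)" if "B \<in> sets torus" for B
    using that by (intro integrable_torus_bounded[where B = 1]) (auto simp: indicator_def)
  have "fejer_converges (indicator A)"
  proof (rule fejer_converges_approx[OF iA[OF base(1)]])
    fix e :: real assume "e > 0"
    from torus_inner_regular[OF base(1) this] obtain K where
      K: "compact K" "K \<subseteq> A" "measure torus A - measure torus K < e" by blast
    have Ks: "K \<in> sets torus"
      using K(1,2) sets.sets_into_space[OF base(1)] sets_unit_square borel_compact[OF K(1)]
      by (auto simp: torus_def sets_restrict_space space_restrict_space image_iff)
    have "(\<integral>x. \<bar>indicator A x - indicator K x :: real\<bar> \<partial>torus) = (\<integral>x. indicator A x - indicator K x \<partial>torus)"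
      using K(2) by (intro Bochner_Integration.integral_cong) (auto simp: indicator_def)
    also have "\<dots> = measure torus A - measure torus K"
      using iA[OF base(1)] iA[OF Ks] base(1) Ks sets.sets_into_space[OF base(1)] sets.sets_into_space[OF Ks]
      by (simp add: Int_absorb2)
    finally show "\<exists>g. integrable torus g \<and> fejer_converges g \<and> (\<integral>x. \<bar>indicator A x - g x\<bar> \<partial>torus) < e"
      using fejer_converges_compact[OF K(1)] K Ks iA sets.sets_into_space[OF Ks]
      by (intro exI[of _ "indicator K"]) auto
  qed
  from fejer_converges_cmult[OF this, of c] show ?case by (simp add: mult.commute)
next
  case (add f g)
  then show ?case by (intro fejer_converges_add)
next
  case (lim f s)
  have m: "f \<in> borel_measurable torus" "\<And>i. s i \<in> borel_measurable torus"
    using lim borel_measurable_integrable by auto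
  have "(\<lambda>n. \<integral>x. \<bar>f x - s n x\<bar> \<partial>torus) \<longlonglongrightarrow> (\<integral>x. 0 \<partial>torus)"
  proof (rule integral_dominated_convergence[where w = "\<lambda>x. 3 * \<bar>f x\<bar>"])
    show "AE x in torus. (\<lambda>n. \<bar>f x - s n x\<bar>) \<longlonglongrightarrow> 0"
    proof (rule AE_I2)
      fix x assume "x \<in> space torus"
      then have "(\<lambda>n. s n x) \<longlonglongrightarrow> f x" using lim by blast
      from tendsto_rabs[OF tendsto_diff[OF tendsto_const[of "f x"] this]]
      show "(\<lambda>n. \<bar>f x - s n x\<bar>) \<longlonglongrightarrow> 0" by simp
    qed
    show "AE x in torus. norm \<bar>f x - s n x\<bar> \<le> 3 * \<bar>f x\<bar>" for n
    proof (rule AE_I2)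
      fix x assume "x \<in> space torus"
      then have "norm (s n x) \<le> 2 * norm (f x)" using lim by blast
      then show "norm \<bar>f x - s n x\<bar> \<le> 3 * \<bar>f x\<bar>" by simp
    qed
    show "integrable torus (\<lambda>x. 3 * \<bar>f x\<bar>)" using lim by auto
  qed (use m in measurable)
  then have lim1: "(\<lambda>n. \<integral>x. \<bar>f x - s n x\<bar> \<partial>torus) \<longlonglongrightarrow> 0" by simp
  show ?case
  proof (rule fejer_converges_approx[OF \<open>integrable torus f\<close>])
    fix e :: real assume "e > 0"
    from order_tendstoD(2)[OF lim1 this] obtain n where "(\<integral>x. \<bar>f x - s n x\<bar> \<partial>torus) < e"
      by (auto simp: eventually_sequentially)
    then show "\<exists>g. integrable torus g \<and> fejer_converges g \<and> (\<integral>x. \<bar>f x - g x\<bar> \<partial>torus) < e"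
      using lim by blast
  qed
qed

text \<open>Coefficients are bounded by the L^1 norm, so L^1 convergence of the means gives the
  limit without a formula for the multiplier at \<open>k\<close>.\<close>

lemma fcoeff_fejer_tendsto:
  assumes f: "integrable torus f"
  shows "(\<lambda>N. fcoeff (fejer N f) k) \<longlonglongrightarrow> fcoeff f k"
proof (rule Lim_null[THEN iffD2], rule tendsto_norm_zero_cancel,
    rule tendsto_sandwich[OF _ _ tendsto_const])
  show "(\<lambda>N. \<integral>x. \<bar>fejer N f x - f x\<bar> \<partial>torus) \<longlonglongrightarrow> 0"
    using fejer_converges_L1[OF f] by (simp add: fejer_converges_def)
  show "\<forall>\<^sub>F N in sequentially. norm (fcoeff (fejer N f) k - fcoeff f k) \<le> (\<integral>x. \<bar>fejer N f x - f x\<bar> \<partial>torus)"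
    using f integrable_fejer[OF f] by (intro always_eventually allI) (simp add: norm_fc_le flip: fcoeff_diff)
qed simp

section \<open>Mean square convergence and Parseval's inequality\<close>

lemma square_add3_le: "(a + b + c)\<^sup>2 \<le> 3 * a\<^sup>2 + 3 * b\<^sup>2 + 3 * (c :: real)\<^sup>2"
proof -
  have "0 \<le> (a - b)\<^sup>2 + (b - c)\<^sup>2 + (a - c)\<^sup>2" by simp
  then show ?thesis by (simp add: power2_eq_square algebra_simps)
qed

lemma integrable_fejer_power2: "integrable torus f \<Longrightarrow> integrable torus (\<lambda>x. (fejer N f x)\<^sup>2)"
  by (rule integrable_torus_continuous) (intro continuous_intros continuous_fejer)

lemma integral_fejer_power2_le:
  assumes f: "integrable torus f"
  shows "(\<integral>x. (fejer N f x)\<^sup>2 \<partial>torus) \<le> (\<Sum>k\<in>fejer_freqs N. (norm (fcoeff f k))\<^sup>2)"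
proof -
  have "(fejer N f x)\<^sup>2 = (norm (trig_poly (fejer_freqs N) (\<lambda>k. of_real (fejer_mult N k) * fcoeff f k) x))\<^sup>2" for x
    by (simp flip: fejer_eq_trig_poly[OF f])
  then have "(\<integral>x. (fejer N f x)\<^sup>2 \<partial>torus) = (\<Sum>k\<in>fejer_freqs N. (norm (of_real (fejer_mult N k) * fcoeff f k))\<^sup>2)"
    by (simp add: parseval_trig_poly)
  also have "\<dots> \<le> (\<Sum>k\<in>fejer_freqs N. (norm (fcoeff f k))\<^sup>2)"
    by (intro sum_mono power_mono)
       (auto simp: norm_mult fejer_mult_nonneg fejer_mult_le_1 abs_of_nonneg mult_left_le_one_le)
  finally show ?thesis .
qed

lemma fejer_L2_contraction:
  assumes "f \<in> borel_measurable torus" "integrable torus (\<lambda>x. (f x)\<^sup>2)"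
  shows "(\<integral>x. (fejer N f x)\<^sup>2 \<partial>torus) \<le> (\<integral>x. (f x)\<^sup>2 \<partial>torus)"
  using integral_fejer_power2_le[OF torus.square_integrable_imp_integrable[OF assms]]
    bessel[OF finite_fejer(2) assms] by (rule order_trans)

text \<open>Truncate at height \<open>n\<close>. The truncation and its means are bounded by
  \<open>n\<close>, so their squared distance is at most \<open>2 * n\<close> times the L^1
  distance, which tends to zero; the remainder and its mean are small by the L^2 contraction. With
  the factor 3 from \<open>square_add3_le\<close> this gives the constants 6 and
  \<open>6 * n\<close>.\<close>

theorem fejer_converges_L2:
  assumes m: "f \<in> borel_measurable torus" and i2: "integrable torus (\<lambda>x. (f x)\<^sup>2)"
  shows "(\<lambda>N. \<integral>x. (fejer N f x - f x)\<^sup>2 \<partial>torus) \<longlonglongrightarrow> 0"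
proof (rule LIMSEQ_I)
  fix e :: real assume e: "e > 0"
  have f: "integrable torus f"
    using m i2 torus.square_integrable_imp_integrable by blast
  define T where "T n x = max (- real n) (min (real n) (f x))" for n x
  have Tm: "T n \<in> borel_measurable torus" for n
    unfolding T_def using m by measurable
  have Tb: "\<bar>T n x\<bar> \<le> real n" for n x
    by (auto simp: T_def)
  have Ti: "integrable torus (T n)" for n
    by (rule integrable_torus_bounded[OF Tm]) (use Tb in auto)
  have d_le: "(f x - T n x)\<^sup>2 \<le> (f x)\<^sup>2" for n x
    unfolding T_def by (rule abs_le_square_iff[THEN iffD1]) auto
  have di: "integrable torus (\<lambda>x. (f x - T n x)\<^sup>2)" for n
    by (rule Bochner_Integration.integrable_bound[OF i2]) (use d_le m Tm in auto)
  have "(\<lambda>n. \<integral>x. (f x - T n x)\<^sup>2 \<partial>torus) \<longlonglongrightarrow> (\<integral>x. 0 \<partial>torus)"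
  proof (rule integral_dominated_convergence[OF _ _ i2])
    show "AE x in torus. (\<lambda>n. (f x - T n x)\<^sup>2) \<longlonglongrightarrow> 0"
    proof (rule AE_I2)
      fix x
      have "\<forall>\<^sub>F n in sequentially. real n > \<bar>f x\<bar>"
        using filterlim_real_sequentially by (simp add: filterlim_at_top_dense)
      then have "\<forall>\<^sub>F n in sequentially. 0 = (f x - T n x)\<^sup>2"
        by eventually_elim (auto simp: T_def)
      then show "(\<lambda>n. (f x - T n x)\<^sup>2) \<longlonglongrightarrow> 0"
        using tendsto_const by (rule Lim_transform_eventually[rotated])
    qed
  qed (use d_le m Tm in auto)
  then have "(\<lambda>n. 6 * (\<integral>x. (f x - T n x)\<^sup>2 \<partial>torus)) \<longlonglongrightarrow> 6 * 0"
    by (intro tendsto_intros) simp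
  from order_tendstoD(2)[OF this, of "e / 2"] e
  obtain n where n: "6 * (\<integral>x. (f x - T n x)\<^sup>2 \<partial>torus) < e / 2"
    by (auto simp: eventually_sequentially)
  have "(\<lambda>N. 6 * real n * (\<integral>x. \<bar>fejer N (T n) x - T n x\<bar> \<partial>torus)) \<longlonglongrightarrow> 6 * real n * 0"
    using fejer_converges_L1[OF Ti[of n]] unfolding fejer_converges_def by (intro tendsto_intros)
  from order_tendstoD(2)[OF this, of "e / 2"] e
  have "\<forall>\<^sub>F N in sequentially. 6 * real n * (\<integral>x. \<bar>fejer N (T n) x - T n x\<bar> \<partial>torus) < e / 2" by simp
  then have "\<forall>\<^sub>F N in sequentially. norm ((\<integral>x. (fejer N f x - f x)\<^sup>2 \<partial>torus) - 0) < e"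
    using eventually_gt_at_top[of 0]
  proof eventually_elim
    case (elim N)
    let ?d = "\<lambda>x. f x - T n x"
    have dm: "?d \<in> borel_measurable torus" using m Tm by measurable
    have d1: "integrable torus ?d" using f Ti by auto
    have Nb: "\<bar>fejer N (T n) x\<bar> \<le> real n" for x
      by (rule abs_fejer_le[OF Ti Tb elim(2)])
    have Tl: "(fejer N (T n) x - T n x)\<^sup>2 \<le> 2 * real n * \<bar>fejer N (T n) x - T n x\<bar>" for x
    proof -
      have "\<bar>fejer N (T n) x - T n x\<bar> \<le> 2 * real n" using Nb[of x] Tb[of n x] by linarith
      then have "\<bar>fejer N (T n) x - T n x\<bar> * \<bar>fejer N (T n) x - T n x\<bar> \<le> 2 * real n * \<bar>fejer N (T n) x - T n x\<bar>"
        by (rule mult_right_mono) simp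
      then show ?thesis by (simp add: power2_eq_square)
    qed
    have i': "integrable torus (\<lambda>x. \<bar>fejer N (T n) x - T n x\<bar>)"
      using Ti integrable_fejer[OF Ti] by auto
    have Ri: "integrable torus (\<lambda>x. 3 * (fejer N ?d x)\<^sup>2 + 3 * (2 * real n * \<bar>fejer N (T n) x - T n x\<bar>) + 3 * (?d x)\<^sup>2)"
      using di i' integrable_fejer_power2[OF d1] by auto
    have ptw: "(fejer N f x - f x)\<^sup>2 \<le> 3 * (fejer N ?d x)\<^sup>2 + 3 * (2 * real n * \<bar>fejer N (T n) x - T n x\<bar>) + 3 * (?d x)\<^sup>2" for x
    proof -
      have "fejer N f x - f x = fejer N ?d x + (fejer N (T n) x - T n x) + (- ?d x)"
        by (simp add: fejer_diff[OF f Ti])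
      then have "(fejer N f x - f x)\<^sup>2 \<le> 3 * (fejer N ?d x)\<^sup>2 + 3 * (fejer N (T n) x - T n x)\<^sup>2 + 3 * (- ?d x)\<^sup>2"
        using square_add3_le by metis
      then show ?thesis using Tl[of x] by (simp add: power2_commute[of "T n x"])
    qed
    have "(\<integral>x. (fejer N f x - f x)\<^sup>2 \<partial>torus)
        \<le> (\<integral>x. 3 * (fejer N ?d x)\<^sup>2 + 3 * (2 * real n * \<bar>fejer N (T n) x - T n x\<bar>) + 3 * (?d x)\<^sup>2 \<partial>torus)"
    proof (rule integral_mono[OF _ Ri ptw])
      show "integrable torus (\<lambda>x. (fejer N f x - f x)\<^sup>2)"
        by (rule Bochner_Integration.integrable_bound[OF Ri])
           (use ptw order_trans[OF ptw abs_ge_self] m measurable_fejer[OF f] in auto)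
    qed
    also have "\<dots> = 3 * (\<integral>x. (fejer N ?d x)\<^sup>2 \<partial>torus) + 6 * real n * (\<integral>x. \<bar>fejer N (T n) x - T n x\<bar> \<partial>torus)
        + 3 * (\<integral>x. (?d x)\<^sup>2 \<partial>torus)"
      using di i' integrable_fejer_power2[OF d1] by simp
    also have "\<dots> < e"
      using fejer_L2_contraction[OF dm di, of N] n elim(1) by linarith
    finally show ?case by simp
  qed
  then show "\<exists>no. \<forall>N\<ge>no. norm ((\<integral>x. (fejer N f x - f x)\<^sup>2 \<partial>torus) - 0) < e"
    by (simp add: eventually_sequentially)
qed

text \<open>The bound passes to the L^2 limit without loss of a factor: Young's inequality carries a
  weight \<open>t\<close> so small that \<open>t * T \<le> e / 2\<close>. The summand 1 in the
  denominator of \<open>t\<close> covers \<open>T = 0\<close>.\<close>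

lemma fejer_L2_norm_tendsto:
  assumes m: "f \<in> borel_measurable torus" and i2: "integrable torus (\<lambda>x. (f x)\<^sup>2)"
    and le: "\<And>N. (\<integral>x. (fejer N f x)\<^sup>2 \<partial>torus) \<le> T"
  shows "(\<integral>x. (f x)\<^sup>2 \<partial>torus) \<le> T"
proof (rule field_le_epsilon)
  fix e :: real assume e: "e > 0"
  have f: "integrable torus f"
    using m i2 torus.square_integrable_imp_integrable by blast
  have T: "0 \<le> T" using le[of 0] by (rule order_trans[rotated]) simp
  define t where "t = e / (2 * (T + 1))"
  have t: "t > 0" "t * T \<le> e / 2" using e T by (auto simp: t_def field_simps)
  have "(\<lambda>N. (1 + 1 / t) * (\<integral>x. (fejer N f x - f x)\<^sup>2 \<partial>torus)) \<longlonglongrightarrow> (1 + 1 / t) * 0"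
    by (intro tendsto_intros fejer_converges_L2 m i2)
  from order_tendstoD(2)[OF this, of "e / 2"] e
  obtain N where N: "(1 + 1 / t) * (\<integral>x. (fejer N f x - f x)\<^sup>2 \<partial>torus) < e / 2"
    by (auto simp: eventually_sequentially)
  have young: "a\<^sup>2 \<le> (1 + t) * b\<^sup>2 + (1 + 1 / t) * (b - a)\<^sup>2" for a b :: real
  proof -
    have "0 \<le> (t * b + (b - a))\<^sup>2 / t" using t by simp
    also have "\<dots> = (1 + t) * b\<^sup>2 + (1 + 1 / t) * (b - a)\<^sup>2 - a\<^sup>2"
      using t by (simp add: power2_eq_square field_simps)
    finally show ?thesis by simp
  qed
  have i3: "integrable torus (\<lambda>x. (fejer N f x - f x)\<^sup>2)"
  proof (rule Bochner_Integration.integrable_bound)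
    show "integrable torus (\<lambda>x. 3 * (fejer N f x)\<^sup>2 + 3 * (f x)\<^sup>2)"
      using i2 integrable_fejer_power2[OF f] by auto
    have "(fejer N f x - f x)\<^sup>2 \<le> 3 * (fejer N f x)\<^sup>2 + 3 * (f x)\<^sup>2" for x
      using square_add3_le[of "fejer N f x" 0 "- f x"] by simp
    then show "AE x in torus. norm ((fejer N f x - f x)\<^sup>2) \<le> norm (3 * (fejer N f x)\<^sup>2 + 3 * (f x)\<^sup>2)"
      by simp
  qed (use m measurable_fejer[OF f] in measurable)
  have "(\<integral>x. (f x)\<^sup>2 \<partial>torus) \<le> (\<integral>x. (1 + t) * (fejer N f x)\<^sup>2 + (1 + 1 / t) * (fejer N f x - f x)\<^sup>2 \<partial>torus)"
    using i2 i3 integrable_fejer_power2[OF f] young by (intro integral_mono) auto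
  also have "\<dots> = (1 + t) * (\<integral>x. (fejer N f x)\<^sup>2 \<partial>torus) + (1 + 1 / t) * (\<integral>x. (fejer N f x - f x)\<^sup>2 \<partial>torus)"
    using i2 i3 integrable_fejer_power2[OF f] by simp
  also have "\<dots> \<le> (1 + t) * T + e / 2"
    using N t le[of N] by (intro add_mono mult_left_mono) auto
  finally show "(\<integral>x. (f x)\<^sup>2 \<partial>torus) \<le> T + e" using t by (simp add: algebra_simps)
qed

text \<open>The half of Parseval's identity opposite to Bessel's inequality. Completeness of the
  characters enters through the L^2 convergence of Fejer means.\<close>

theorem parseval_le:
  assumes m: "f \<in> borel_measurable torus" and i2: "integrable torus (\<lambda>x. (f x)\<^sup>2)"
    and le: "\<And>S. finite S \<Longrightarrow> (\<Sum>k\<in>S. (norm (fcoeff f k))\<^sup>2) \<le> T"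
  shows "(\<integral>x. (f x)\<^sup>2 \<partial>torus) \<le> T"
proof (rule fejer_L2_norm_tendsto[OF m i2])
  fix N
  show "(\<integral>x. (fejer N f x)\<^sup>2 \<partial>torus) \<le> T"
    using integral_fejer_power2_le[OF torus.square_integrable_imp_integrable[OF m i2]] le[OF finite_fejer(2)]
    by (rule order_trans)
qed

section \<open>The balance law for increments\<close>

text \<open>The increments \<open>D\<close> of a solution of Burgers' equation are tested with \<open>flux_weight M D\<close>, a
  bounded substitute for the classical weight \<open>\<bar>D\<bar>\<close>: the commutator of the product with the Fejer
  means tends to zero in \<open>L\<^sup>1\<close> only, so the weight has to be bounded. The resulting \<open>growth M\<close>
  satisfies \<open>growth'' a = a * flux_weight' a\<close>; it replaces \<open>\<bar>D\<bar>\<^sup>3 / 6\<close> and still dominates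
  \<open>a\<^sup>4 / (1 + a\<^sup>2)\<close> for \<open>\<bar>a\<bar> \<le> M\<close>, uniformly in \<open>M\<close>.\<close>

definition flux_weight :: "real \<Rightarrow> real \<Rightarrow> real" where
  "flux_weight M a = (ln (1 + a\<^sup>2) - ln (M\<^sup>2 + a\<^sup>2)) / 2"

definition flux_weight' :: "real \<Rightarrow> real \<Rightarrow> real" where
  "flux_weight' M a = a / (1 + a\<^sup>2) - a / (M\<^sup>2 + a\<^sup>2)"

definition growth' :: "real \<Rightarrow> real \<Rightarrow> real" where
  "growth' M a = M * arctan (a / M) - arctan a"

definition growth :: "real \<Rightarrow> real \<Rightarrow> real" where
  "growth M a = a * (M * arctan (a / M)) - M\<^sup>2 / 2 * (ln (M\<^sup>2 + a\<^sup>2) - ln (M\<^sup>2))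
     - a * arctan a + ln (1 + a\<^sup>2) / 2"

text \<open>An antiderivative of \<open>flux_weight M\<close>, obtained by parts: what remains to be
  integrated is \<open>a * flux_weight' M a\<close>, the derivative of
  \<open>growth' M\<close>.\<close>

definition flux_pot :: "real \<Rightarrow> real \<Rightarrow> real" where
  "flux_pot M a = flux_weight M a * a - growth' M a"

lemma sum_pos_square: "0 < 1 + (a :: real)\<^sup>2" "M \<noteq> 0 \<Longrightarrow> 0 < M\<^sup>2 + (a :: real)\<^sup>2"
  by (simp_all add: add_pos_nonneg)

lemma DERIV_ln_plus_square:
  assumes "c > 0"
  shows "((\<lambda>a. ln (c + a\<^sup>2)) has_real_derivative 2 * a / (c + a\<^sup>2)) (at a)"
proof -
  have "0 < c + a\<^sup>2" using assms by (simp add: add_pos_nonneg)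
  then show ?thesis by (auto intro!: derivative_eq_intros)
qed

lemma DERIV_arctan_div:
  assumes "M > 0"
  shows "((\<lambda>a. arctan (a / M)) has_real_derivative M / (M\<^sup>2 + a\<^sup>2)) (at a)"
proof -
  have "((\<lambda>a. arctan (a / M)) has_real_derivative inverse (1 + (a / M)\<^sup>2) * (1 / M)) (at a)"
    using assms by (auto intro!: derivative_eq_intros)
  moreover have "inverse (1 + (a / M)\<^sup>2) * (1 / M) = M / (M\<^sup>2 + a\<^sup>2)"
  proof -
    have "1 + (a / M)\<^sup>2 = (M\<^sup>2 + a\<^sup>2) / M\<^sup>2"
      using assms by (simp add: power_divide add_divide_distrib)
    then show ?thesis using assms by (simp add: power2_eq_square)
  qed
  ultimately show ?thesis by simp
qed

lemma DERIV_flux_weight: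
  assumes "M > 0"
  shows "(flux_weight M has_real_derivative flux_weight' M a) (at a)"
proof -
  have "(flux_weight M has_real_derivative (2 * a / (1 + a\<^sup>2) - 2 * a / (M\<^sup>2 + a\<^sup>2)) / 2) (at a)"
    unfolding flux_weight_def
    by (intro DERIV_cdivide DERIV_diff DERIV_ln_plus_square) (use assms in auto)
  moreover have "(2 * a / c - 2 * a / d) / 2 = a / c - a / d" for c d
    by (simp add: diff_divide_distrib)
  ultimately show ?thesis by (simp only: flux_weight'_def)
qed

lemma DERIV_growth':
  assumes "M > 0"
  shows "(growth' M has_real_derivative a * flux_weight' M a) (at a)"
proof -
  have "(growth' M has_real_derivative M * (M / (M\<^sup>2 + a\<^sup>2)) - 1 / (1 + a\<^sup>2)) (at a)"
    unfolding growth'_def using DERIV_arctan_div[of 1 a]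
    by (intro DERIV_diff DERIV_cmult DERIV_arctan_div assms) simp
  moreover have "M * (M / (M\<^sup>2 + a\<^sup>2)) - 1 / (1 + a\<^sup>2) = a * flux_weight' M a"
  proof -
    have "M * (M / (M\<^sup>2 + a\<^sup>2)) = 1 - a * (a / (M\<^sup>2 + a\<^sup>2))" "1 / (1 + a\<^sup>2) = 1 - a * (a / (1 + a\<^sup>2))"
      using assms sum_pos_square(1)[of a] sum_pos_square(2)[of M a]
      by (simp_all add: divide_simps) (simp_all add: power2_eq_square)
    then show ?thesis by (simp add: flux_weight'_def right_diff_distrib)
  qed
  ultimately show ?thesis by simp
qed

lemma DERIV_growth:
  assumes "M > 0"
  shows "(growth M has_real_derivative growth' M a) (at a)"
proof -
  have "(growth M has_real_derivative (1 * (M * arctan (a / M)) + M * (M / (M\<^sup>2 + a\<^sup>2)) * a)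
      - M\<^sup>2 / 2 * (2 * a / (M\<^sup>2 + a\<^sup>2)  - 0) - (1 * arctan a + 1 / (1 + a\<^sup>2) * a)
      + 2 * a / (1 + a\<^sup>2) / 2) (at a)"
    unfolding growth_def using DERIV_arctan_div[of 1 a] assms
    by (intro DERIV_add DERIV_diff DERIV_mult DERIV_cmult DERIV_cdivide DERIV_const DERIV_ident
        DERIV_arctan_div DERIV_ln_plus_square) auto
  moreover have "(1 * t + M * (M / c) * a) - M\<^sup>2 / 2 * (2 * a / c - 0) - (1 * u + 1 / d * a)
      + 2 * a / d / 2 = t - u" for t u c d
    by (simp add: power2_eq_square)
  ultimately show ?thesis
    by (simp only: growth'_def)
qed

lemma DERIV_flux_pot:
  assumes "M > 0"
  shows "(flux_pot M has_real_derivative flux_weight M a) (at a)"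
  unfolding flux_pot_def
  by (rule derivative_eq_intros DERIV_flux_weight DERIV_growth' assms refl)+ simp

lemma abs_flux_weight_le:
  assumes "M \<ge> 1"
  shows "\<bar>flux_weight M a\<bar> \<le> ln M"
proof -
  have p: "0 < 1 + a\<^sup>2" "0 < M\<^sup>2 + a\<^sup>2" using sum_pos_square[of a] sum_pos_square(2)[of M a] assms by auto
  have M2: "1 \<le> M\<^sup>2" using assms by simp
  have "M\<^sup>2 + a\<^sup>2 \<le> M\<^sup>2 * (1 + a\<^sup>2)" 
    using mult_right_mono[OF M2, of "a\<^sup>2"] by (simp add: algebra_simps)
  then have "ln (M\<^sup>2 + a\<^sup>2) \<le> ln (M\<^sup>2 * (1 + a\<^sup>2))" using p by simp
  also have "\<dots> = 2 * ln M + ln (1 + a\<^sup>2)"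
    using assms p by (simp add: ln_mult ln_realpow)
  finally have "ln (M\<^sup>2 + a\<^sup>2) \<le> 2 * ln M + ln (1 + a\<^sup>2)" .
  moreover have "ln (1 + a\<^sup>2) \<le> ln (M\<^sup>2 + a\<^sup>2)" using p M2 by simp
  ultimately show ?thesis by (simp add: flux_weight_def)
qed

text \<open>Over the common denominator the second derivative of \<open>growth M\<close> is seen to
  be nonnegative for \<open>M \<ge> 1\<close>. For \<open>M \<ge> 2\<close> it is comparable to
  \<open>a\<^sup>2\<close> near 0 and to 1 for |a| between 1 and \<open>M\<close>, so
  \<open>growth M\<close> starts quartic and continues quadratic.\<close>

lemma a_flux_weight':
  assumes "M > 0"
  shows "a * flux_weight' M a = (M\<^sup>2 - 1) * (a\<^sup>2 / ((1 + a\<^sup>2) * (M\<^sup>2 + a\<^sup>2)))"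
proof -
  have "a / p - a / q = (q - p) * (a / (p * q))" if "p \<noteq> 0" "q \<noteq> 0" for p q :: real
    using that by (simp add: field_simps)
  from this[of "1 + a\<^sup>2" "M\<^sup>2 + a\<^sup>2"] show ?thesis
    using assms sum_pos_square(1)[of a] sum_pos_square(2)[of M a]
    by (simp add: flux_weight'_def power2_eq_square)
qed

text \<open>A difference of two numbers in [0, 1]. In the balance this factor multiplies the main
  term, so its independence of \<open>M\<close> is essential; the bound \<open>ln M\<close> on the
  weight itself multiplies only the commutator.\<close>

lemma abs_flux_weight'_le:
  assumes "M \<ge> 1"
  shows "\<bar>flux_weight' M a\<bar> \<le> 1"
proof -
  have b: "0 \<le> \<bar>a\<bar> / (c + a\<^sup>2)" "\<bar>a\<bar> / (c + a\<^sup>2) \<le> 1" if "c \<ge> 1" for c :: real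
  proof -
    have "0 \<le> (\<bar>a\<bar> - 1)\<^sup>2" by simp
    then have "\<bar>a\<bar> \<le> 1 + a\<^sup>2" by (simp add: power2_diff)
    then show "0 \<le> \<bar>a\<bar> / (c + a\<^sup>2)" "\<bar>a\<bar> / (c + a\<^sup>2) \<le> 1"
      using that by (auto simp: divide_le_eq_1 add_pos_nonneg)
  qed
  have "\<bar>flux_weight' M a\<bar> = \<bar>\<bar>a\<bar> / (1 + a\<^sup>2) - \<bar>a\<bar> / (M\<^sup>2 + a\<^sup>2)\<bar>"
    by (cases "a \<ge> 0") (auto simp: flux_weight'_def)
  moreover have "1 \<le> M\<^sup>2" using assms by simp
  ultimately show ?thesis using b[of 1] b[of "M\<^sup>2"] by linarith
qed

lemma growth'_0 [simp]: "growth' M 0 = 0" and growth_0 [simp]: "growth M 0 = 0"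
  by (simp_all add: growth_def growth'_def)

lemma growth_minus: "growth M (- a) = growth M a"
  by (simp add: growth_def arctan_minus)

lemma abs_growth'_le:
  assumes "M \<ge> 1"
  shows "\<bar>growth' M a\<bar> \<le> \<bar>a\<bar>"
proof -
  have M: "M > 0" using assms by simp
  have b: "a * flux_weight' M a \<le> 1" "0 \<le> a * flux_weight' M a" for a
  proof -
    have "0 \<le> M\<^sup>2 - 1" using assms by simp
    then show "0 \<le> a * flux_weight' M a"
      unfolding a_flux_weight'[OF M] by simp
    have "a * flux_weight' M a = a\<^sup>2 / (1 + a\<^sup>2) - a\<^sup>2 / (M\<^sup>2 + a\<^sup>2)"
      by (simp add: flux_weight'_def power2_eq_square algebra_simps)
    also have "\<dots> \<le> a\<^sup>2 / (1 + a\<^sup>2)" by simp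
    also have "\<dots> \<le> 1" by (simp add: divide_le_eq_1 add_pos_nonneg)
    finally show "a * flux_weight' M a \<le> 1" .
  qed
  have "norm (growth' M a - growth' M 0) \<le> 1 * norm (a - 0)"
  proof (intro field_differentiable_bound[OF convex_UNIV])
    show "(growth' M has_field_derivative z * flux_weight' M z) (at z within UNIV)" for z
      by (rule DERIV_growth'[OF M])
    show "norm (z * flux_weight' M z) \<le> 1" for z
      using b[of z] by (simp only: real_norm_def abs_of_nonneg)
  qed simp_all
  then show ?thesis by simp
qed

text \<open>Mean value inequality with \<open>abs_growth'_le\<close> on the segment. Being quadratic
  and uniform in \<open>M\<close>, the bound makes the integral of \<open>growth M\<close>
  continuous under L^2 convergence, which is how increments of different Fejer means are
  compared.\<close>

lemma growth_diff_le:
  assumes "M \<ge> 1"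
  shows "\<bar>growth M a - growth M b\<bar> \<le> (\<bar>a\<bar> + \<bar>b\<bar>) * \<bar>a - b\<bar>"
proof -
  have M: "M > 0" using assms by simp
  have "norm (growth M a - growth M b) \<le> (\<bar>a\<bar> + \<bar>b\<bar>) * norm (a - b)"
  proof (rule field_differentiable_bound[of "closed_segment a b" _ "growth' M"])
    fix z assume "z \<in> closed_segment a b"
    then have "\<bar>z\<bar> \<le> \<bar>a\<bar> + \<bar>b\<bar>"
      by (auto simp: closed_segment_eq_real_ivl split: if_splits)
    then show "norm (growth' M z) \<le> \<bar>a\<bar> + \<bar>b\<bar>"
      using abs_growth'_le[OF assms, of z] by simp
  qed (auto intro!: has_field_derivative_at_within DERIV_growth M)
  then show ?thesis by simp
qed

text \<open>By evenness only [0, M] matters, and both sides vanish at 0 together with their first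
  derivatives, so second derivatives are compared. Written as
  \<open>a\<^sup>2 - 1 + 1 / (1 + a\<^sup>2)\<close>, the quotient has second derivative at most
  \<open>12 * x\<^sup>2 / (1 + x\<^sup>2)\<close>, while that of \<open>growth M\<close> is at least
  \<open>1 / 4\<close> of \<open>x\<^sup>2 / (1 + x\<^sup>2)\<close>; hence 48.\<close>

lemma growth_lower:
  assumes M: "M \<ge> 2" and a: "\<bar>a\<bar> \<le> M"
  shows "a ^ 4 / (1 + a\<^sup>2) \<le> 48 * growth M a"
proof -
  have *: "a ^ 4 / (1 + a\<^sup>2) \<le> 48 * growth M a" if a: "0 \<le> a" "a \<le> M" for a
  proof -
    define F where "F = (\<lambda>a. 48 * growth M a - (a\<^sup>2 - 1 + 1 / (1 + a\<^sup>2)))"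
    define F' where "F' = (\<lambda>a. 48 * growth' M a - (2 * a - 2 * a / (1 + a\<^sup>2)\<^sup>2))"
    define F'' where "F'' = (\<lambda>a. 48 * (a * flux_weight' M a) - (2 + (6 * a\<^sup>2 - 2) / (1 + a\<^sup>2) ^ 3))"
    have M0: "M > 0" using M by simp
    note p = sum_pos_square(1)
    have d1: "(F has_real_derivative F' x) (at x)" for x
    proof -
      have "(F has_real_derivative 48 * growth' M x - (2 * x - 0 + - (2 * x / (1 + x\<^sup>2)\<^sup>2))) (at x)"
        unfolding F_def using p[of x]
        by (intro DERIV_diff DERIV_add DERIV_cmult DERIV_growth M0 DERIV_const)
           (auto intro!: derivative_eq_intros simp: power2_eq_square)
      then show ?thesis by (simp add: F'_def)
    qed
    have d2: "(F' has_real_derivative F'' x) (at x)" for x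
    proof -
      have "(F' has_real_derivative 48 * (x * flux_weight' M x)
          - (2 - (2 * (1 + x\<^sup>2)\<^sup>2 - 2 * x * (2 * (1 + x\<^sup>2) * (2 * x))) / ((1 + x\<^sup>2)\<^sup>2 * (1 + x\<^sup>2)\<^sup>2))) (at x)"
        unfolding F'_def using p[of x]
        by (intro DERIV_diff DERIV_cmult DERIV_growth' M0)
           (auto intro!: derivative_eq_intros)
      moreover have "(2 * (1 + x\<^sup>2)\<^sup>2 - 2 * x * (2 * (1 + x\<^sup>2) * (2 * x))) / ((1 + x\<^sup>2)\<^sup>2 * (1 + x\<^sup>2)\<^sup>2)
          = - ((6 * x\<^sup>2 - 2) / (1 + x\<^sup>2) ^ 3)"
      proof -
        have "(2 * q\<^sup>2 - 2 * x * (2 * q * (2 * x))) / (q\<^sup>2 * q\<^sup>2) = - ((8 * x\<^sup>2 - 2 * q) / q ^ 3)" if "q \<noteq> 0" for q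
          using that by (simp add: field_simps power2_eq_square power3_eq_cube)
        from this[of "1 + x\<^sup>2"] p[of x] show ?thesis by (simp add: algebra_simps)
      qed
      ultimately show ?thesis by (simp add: F''_def)
    qed
    have pos: "F'' x \<ge> 0" if "0 \<le> x" "x \<le> M" for x
    proof -
      let ?q = "1 + x\<^sup>2"
      have x2: "x\<^sup>2 \<le> M\<^sup>2" using that by (simp add: power_mono)
      have M2: "4 \<le> M\<^sup>2" using power_mono[OF M, of 2] by simp
      \<comment> \<open>Both \<open>x \<le> M\<close> and \<open>M \<ge> 2\<close> enter here: the
        quotient is at least \<open>(M\<^sup>2 - 1) / (2 * M\<^sup>2)\<close>, hence at least
        \<open>3 / 8\<close>.\<close>
      have "(1 / 4) * (x\<^sup>2 / ?q) \<le> (M\<^sup>2 - 1) / (M\<^sup>2 + x\<^sup>2) * (x\<^sup>2 / ?q)"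
        by (rule mult_right_mono) (use x2 M2 p[of x] in \<open>auto simp: field_simps\<close>)
      also have "\<dots> = x * flux_weight' M x"
        unfolding a_flux_weight'[OF M0] by simp
      finally have "12 * (x\<^sup>2 / ?q) \<le> 48 * (x * flux_weight' M x)" by linarith
      moreover have "2 + (6 * x\<^sup>2 - 2) / ?q ^ 3 \<le> 12 * (x\<^sup>2 / ?q)"
      proof -
        have "2 + (6 * x\<^sup>2 - 2) / ?q ^ 3 = (2 * ?q ^ 3 + (6 * x\<^sup>2 - 2)) / ?q ^ 3"
          by (rule add_divide_eq_iff) (use p[of x] in simp)
        also have "\<dots> \<le> (12 * x\<^sup>2 * ?q\<^sup>2) / ?q ^ 3"
        proof (rule divide_right_mono)
          have "12 * x\<^sup>2 * ?q\<^sup>2 - (2 * ?q ^ 3 + (6 * x\<^sup>2 - 2)) = 18 * (x\<^sup>2)\<^sup>2 + 10 * (x\<^sup>2) ^ 3"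
          proof -
            have "12 * y * (1 + y)\<^sup>2 - (2 * (1 + y) ^ 3 + (6 * y - 2)) = 18 * y\<^sup>2 + 10 * y ^ 3" for y :: real
              by (simp add: algebra_simps power2_eq_square power3_eq_cube)
            from this[of "x\<^sup>2"] show ?thesis .
          qed
          also have "\<dots> \<ge> 0" by simp
          finally show "2 * ?q ^ 3 + (6 * x\<^sup>2 - 2) \<le> 12 * x\<^sup>2 * ?q\<^sup>2" by simp
        qed (use p[of x] in simp)
        also have "\<dots> = 12 * (x\<^sup>2 / ?q)"
        proof -
          have "(12 * y * q\<^sup>2) / q ^ 3 = 12 * (y / q)" if "q \<noteq> 0" for y q :: real
            using that by (simp add: power2_eq_square power3_eq_cube)
          then show ?thesis using p[of x] by (metis less_irrefl)
        qed
        finally show ?thesis .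
      qed
      ultimately show ?thesis by (simp add: F''_def)
    qed
    have F'pos: "F' x \<ge> 0" if "0 \<le> x" "x \<le> M" for x
    proof -
      have "F' 0 \<le> F' x"
        using that by (intro DERIV_nonneg_imp_nondecreasing[of 0 x F']) (auto intro!: exI d2 pos)
      then show ?thesis by (simp add: F'_def)
    qed
    have "F 0 \<le> F a"
      using a by (intro DERIV_nonneg_imp_nondecreasing[of 0 a F]) (auto intro!: exI d1 F'pos)
    moreover have "a\<^sup>2 - 1 + 1 / (1 + a\<^sup>2) = a ^ 4 / (1 + a\<^sup>2)"
    proof -
      have "(q - 1) - 1 + 1 / q = (q - 1)\<^sup>2 / q" if "q \<noteq> 0" for q :: real
        using that by (simp add: field_simps power2_eq_square)
      from this[of "1 + a\<^sup>2"] p[of a] show ?thesis by simp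
    qed
    ultimately show ?thesis by (simp add: F_def)
  qed
  show ?thesis
  proof (cases "a \<ge> 0")
    case True then show ?thesis using * a by simp
  next
    case False then show ?thesis using *[of "- a"] a by (simp add: growth_minus)
  qed
qed

text \<open>Because \<open>growth M\<close> is only quartic near 0, it cannot dominate a square
  there. Values up to the threshold \<open>s\<close> are paid for by \<open>s\<^sup>2\<close>;
  beyond it, \<open>a\<^sup>2\<close> equals \<open>1 + 1 / a\<^sup>2\<close> times the quotient of
  \<open>growth_lower\<close>, and \<open>1 / a\<^sup>2\<close> is below
  \<open>1 / s\<^sup>2\<close>.\<close>

lemma square_le_growth:
  assumes "M \<ge> 2" "\<bar>a\<bar> \<le> M" "s > 0"
  shows "a\<^sup>2 \<le> s\<^sup>2 + 48 * (1 + 1 / s\<^sup>2) * growth M a"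
proof -
  have p: "0 < 1 + a\<^sup>2" by (rule sum_pos_square)
  have g: "0 \<le> a ^ 4 / (1 + a\<^sup>2)" using p by simp
  have "a\<^sup>2 \<le> s\<^sup>2 + (1 + 1 / s\<^sup>2) * (a ^ 4 / (1 + a\<^sup>2))"
  proof (cases "a\<^sup>2 \<le> s\<^sup>2")
    case True
    then show ?thesis using g by (simp add: add_increasing2)
  next
    case False
    then have "(1 + 1 / a\<^sup>2) * (a ^ 4 / (1 + a\<^sup>2)) \<le> (1 + 1 / s\<^sup>2) * (a ^ 4 / (1 + a\<^sup>2))"
      using assms(3) by (intro mult_right_mono add_left_mono divide_left_mono g mult_pos_pos) auto
    moreover have "(1 + 1 / a\<^sup>2) * (a ^ 4 / (1 + a\<^sup>2)) = a\<^sup>2"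
    proof -
      have "a \<noteq> 0" using False by auto
      have "(1 + 1 / q) * (q\<^sup>2 / (1 + q)) = q" if "q > 0" for q :: real
      proof -
        have "1 + 1 / q = (1 + q) / q" using that by (simp add: field_simps)
        then show ?thesis using that by (simp add: power2_eq_square)
      qed
      from this[of "a\<^sup>2"] \<open>a \<noteq> 0\<close> show ?thesis by simp
    qed
    ultimately show ?thesis by (simp add: add_increasing)
  qed
  also have "\<dots> \<le> s\<^sup>2 + (1 + 1 / s\<^sup>2) * (48 * growth M a)"
    using growth_lower[OF assms(1,2)] by (intro add_left_mono mult_left_mono) auto
  finally show ?thesis by (simp add: mult_ac)
qed

section \<open>Translations and Cauchy-Schwarz on the torus\<close>

lemma integral_torus_shift1:
  fixes f :: "real \<times> real \<Rightarrow> real"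
  assumes c: "continuous_on UNIV f" and p: "periodic f" and h: "0 \<le> h" "h \<le> 1"
  shows "(\<integral>x. f (x + (h, 0)) \<partial>torus) = (\<integral>x. f x \<partial>torus)"
proof -
  have ch: "continuous_on UNIV (\<lambda>x. f (x + (h, 0)))"
    by (intro continuous_on_compose2[OF c] continuous_intros) auto
  have "integral {0..1} (\<lambda>x. f ((x, y) + (h, 0))) = integral {0..1} (\<lambda>x. f (x, y))" for y
  proof -
    let ?g = "\<lambda>x. f (x, y)"
    have cg: "continuous_on A ?g" for A
      by (intro continuous_on_compose2[OF c] continuous_intros) auto
    have i: "?g integrable_on {a..b}" for a b
      by (intro integrable_continuous_interval cg)
    have per: "?g (x + 1) = ?g x" for x
      using p[unfolded periodic_def, rule_format, of "(x, y)"] by simp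
    have "integral {0..1} (\<lambda>x. ?g (x + h)) = integral {h..1 + h} ?g"
      using integral_shift_Icc_real[of 0 1 ?g h] by (simp add: o_def add.commute)
    also have "\<dots> = integral {h..1} ?g + integral {1..1 + h} ?g"
      using h by (intro Henstock_Kurzweil_Integration.integral_combine[symmetric] i) auto
    also have "integral {1..1 + h} ?g = integral {0..h} (\<lambda>x. ?g (x + 1))"
      using integral_shift_Icc_real[of 0 h ?g 1] by (simp add: o_def add.commute)
    also have "\<dots> = integral {0..h} ?g"
      by (simp only: per)
    also have "integral {h..1} ?g + integral {0..h} ?g = integral {0..1} ?g"
      using Henstock_Kurzweil_Integration.integral_combine[of 0 h 1 ?g] h i by simp
    finally show ?thesis by simp
  qed
  then show ?thesis
    unfolding integral_torus_iterated(2)[OF c] integral_torus_iterated(2)[OF ch] by simp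
qed

text \<open>Cauchy-Schwarz through Young's inequality scaled by \<open>a > A\<close> and
  \<open>b > B\<close>. The strict inequalities keep the divisors positive even if a norm is zero; a
  limit then removes them.\<close>

lemma abs_integral_mult_le:
  fixes f g :: "real \<times> real \<Rightarrow> real"
  assumes f: "integrable torus (\<lambda>x. (f x)\<^sup>2)" and g: "integrable torus (\<lambda>x. (g x)\<^sup>2)"
    and m: "f \<in> borel_measurable torus" "g \<in> borel_measurable torus"
    and fA: "(\<integral>x. (f x)\<^sup>2 \<partial>torus) \<le> A\<^sup>2" and gB: "(\<integral>x. (g x)\<^sup>2 \<partial>torus) \<le> B\<^sup>2"
    and AB: "A \<ge> 0" "B \<ge> 0"
  shows "integrable torus (\<lambda>x. f x * g x)" "(\<integral>x. \<bar>f x * g x\<bar> \<partial>torus) \<le> A * B"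
proof -
  show i: "integrable torus (\<lambda>x. f x * g x)"
  proof (rule Bochner_Integration.integrable_bound)
    show "integrable torus (\<lambda>x. (f x)\<^sup>2 + (g x)\<^sup>2)" using f g by simp
    have "\<bar>f x * g x\<bar> \<le> (f x)\<^sup>2 + (g x)\<^sup>2" for x
    proof -
      have "2 * \<bar>f x\<bar> * \<bar>g x\<bar> \<le> (f x)\<^sup>2 + (g x)\<^sup>2"
        using sum_squares_bound[of "\<bar>f x\<bar>" "\<bar>g x\<bar>"] by simp
      moreover have "0 \<le> \<bar>f x\<bar> * \<bar>g x\<bar>" by simp
      ultimately show ?thesis unfolding abs_mult by linarith
    qed
    then show "AE x in torus. norm (f x * g x) \<le> norm ((f x)\<^sup>2 + (g x)\<^sup>2)" by simp
  qed (use m in measurable)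
  have young: "(\<integral>x. \<bar>f x * g x\<bar> \<partial>torus) \<le> a * b" if ab: "a > A" "b > B" for a b
  proof -
    have pos: "a > 0" "b > 0" using ab AB by auto
    let ?c = "a * b / 2"
    have "(\<integral>x. \<bar>f x * g x\<bar> \<partial>torus) \<le> (\<integral>x. ?c * ((f x)\<^sup>2 / a\<^sup>2) + ?c * ((g x)\<^sup>2 / b\<^sup>2) \<partial>torus)"
    proof (rule integral_mono)
      fix x
      have "2 * (\<bar>f x\<bar> / a) * (\<bar>g x\<bar> / b) \<le> (f x)\<^sup>2 / a\<^sup>2 + (g x)\<^sup>2 / b\<^sup>2"
        using sum_squares_bound[of "\<bar>f x\<bar> / a" "\<bar>g x\<bar> / b"] by (simp add: power_divide)
      then have "?c * (2 * (\<bar>f x\<bar> / a) * (\<bar>g x\<bar> / b)) \<le> ?c * ((f x)\<^sup>2 / a\<^sup>2 + (g x)\<^sup>2 / b\<^sup>2)"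
        using pos by (intro mult_left_mono) auto
      then show "\<bar>f x * g x\<bar> \<le> ?c * ((f x)\<^sup>2 / a\<^sup>2) + ?c * ((g x)\<^sup>2 / b\<^sup>2)"
        using pos by (simp add: abs_mult distrib_left)
    qed (use i f g in auto)
    also have "\<dots> = ?c * ((\<integral>x. (f x)\<^sup>2 \<partial>torus) / a\<^sup>2) + ?c * ((\<integral>x. (g x)\<^sup>2 \<partial>torus) / b\<^sup>2)"
      using f g by simp
    also have "\<dots> \<le> ?c * 1 + ?c * 1"
    proof -
      have "A\<^sup>2 \<le> a\<^sup>2" "B\<^sup>2 \<le> b\<^sup>2" using ab AB by (auto intro!: power_mono)
      then have "(\<integral>x. (f x)\<^sup>2 \<partial>torus) \<le> a\<^sup>2" "(\<integral>x. (g x)\<^sup>2 \<partial>torus) \<le> b\<^sup>2" using fA gB by linarith+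
      then show ?thesis using pos by (intro add_mono mult_left_mono) (auto simp: divide_le_eq_1)
    qed
    also have "\<dots> = a * b" by simp
    finally show ?thesis .
  qed
  have "((\<lambda>t. (A + t) * (B + t)) \<longlongrightarrow> (A + 0) * (B + 0)) (at_right 0)"
    by (intro tendsto_intros)
  moreover have "\<forall>\<^sub>F t in at_right 0. (\<integral>x. \<bar>f x * g x\<bar> \<partial>torus) \<le> (A + t) * (B + t)"
    using young by (auto simp: eventually_at_right_field intro!: exI[of _ 1])
  ultimately show "(\<integral>x. \<bar>f x * g x\<bar> \<partial>torus) \<le> A * B"
    using tendsto_lowerbound[of _ _ "at_right (0 :: real)"] by fastforce
qed

lemma integral_diff_power2_le:
  fixes f g :: "real \<times> real \<Rightarrow> real"
  assumes "integrable torus (\<lambda>x. (f x)\<^sup>2)" "integrable torus (\<lambda>x. (g x)\<^sup>2)"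
    and "f \<in> borel_measurable torus" "g \<in> borel_measurable torus"
  shows "integrable torus (\<lambda>x. (f x - g x)\<^sup>2)"
    and "(\<integral>x. (f x - g x)\<^sup>2 \<partial>torus) \<le> 2 * (\<integral>x. (f x)\<^sup>2 \<partial>torus) + 2 * (\<integral>x. (g x)\<^sup>2 \<partial>torus)"
proof -
  have le: "(f x - g x)\<^sup>2 \<le> 2 * (f x)\<^sup>2 + 2 * (g x)\<^sup>2" for x
  proof -
    have "0 \<le> (f x + g x)\<^sup>2" by simp
    then show ?thesis by (simp add: power2_eq_square algebra_simps)
  qed
  have i: "integrable torus (\<lambda>x. 2 * (f x)\<^sup>2 + 2 * (g x)\<^sup>2)" using assms by simp
  show i2: "integrable torus (\<lambda>x. (f x - g x)\<^sup>2)"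
    by (rule Bochner_Integration.integrable_bound[OF i])
       (use assms le in auto)
  have "(\<integral>x. (f x - g x)\<^sup>2 \<partial>torus) \<le> (\<integral>x. 2 * (f x)\<^sup>2 + 2 * (g x)\<^sup>2 \<partial>torus)"
    by (rule integral_mono[OF i2 i le])
  then show "(\<integral>x. (f x - g x)\<^sup>2 \<partial>torus) \<le> 2 * (\<integral>x. (f x)\<^sup>2 \<partial>torus) + 2 * (\<integral>x. (g x)\<^sup>2 \<partial>torus)"
    using assms by simp
qed

section \<open>Differentiating the growth functional in the shift\<close>

lemma continuous_flux:
  assumes "M > 0" "continuous_on A f"
  shows "continuous_on A (\<lambda>x. flux_weight M (f x))" "continuous_on A (\<lambda>x. flux_weight' M (f x))"
    "continuous_on A (\<lambda>x. growth M (f x))" "continuous_on A (\<lambda>x. growth' M (f x))"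
    "continuous_on A (\<lambda>x. flux_pot M (f x))"
proof -
  have *: "continuous_on UNIV (flux_weight M)" "continuous_on UNIV (growth M)" "continuous_on UNIV (growth' M)"
    "continuous_on UNIV (flux_pot M)"
    using DERIV_flux_weight DERIV_growth DERIV_growth' DERIV_flux_pot assms(1)
    by (meson DERIV_continuous_on has_field_derivative_at_within)+
  have "continuous_on UNIV (flux_weight' M)"
    unfolding flux_weight'_def
    using sum_pos_square(1) sum_pos_square(2)[of M] assms(1)
    by (intro continuous_intros) (auto simp: less_le)
  with * show "continuous_on A (\<lambda>x. flux_weight M (f x))" "continuous_on A (\<lambda>x. flux_weight' M (f x))"
    "continuous_on A (\<lambda>x. growth M (f x))" "continuous_on A (\<lambda>x. growth' M (f x))"
    "continuous_on A (\<lambda>x. flux_pot M (f x))"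
    using assms(2) continuous_on_compose2[OF _ assms(2) subset_UNIV] by simp_all
qed

lemma DERIV_shift1:
  fixes f :: "real \<times> real \<Rightarrow> real"
  assumes "\<And>x y. ((\<lambda>t. f (t, y)) has_real_derivative f1 (x, y)) (at x)"
  shows "((\<lambda>t. f ((t, y) + (h, 0))) has_real_derivative f1 ((x, y) + (h, 0))) (at x)"
  using DERIV_shift[of "\<lambda>t. f (t, y)" "f1 (x + h, y)" x h] assms[of y "x + h"]
  by (simp add: add.commute)

text \<open>With \<open>D = w (x + (h, 0)) - w x\<close>, both sides differ by the integral of the total derivatives
  \<open>\<partial>\<^sub>2 (flux_pot M D)\<close> and \<open>\<partial>\<^sub>1\<close> of \<open>(w (x + (h, 0)) + w x) / 2 * flux_pot M D\<close>, \<open>growth M D / 2\<close> and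
  \<open>flux_weight M D * (g (x + (h, 0)) - g x)\<close>. The left-hand side is the \<open>h\<close>-derivative of the integral of
  \<open>growth M D\<close>.\<close>

lemma growth_rate_identity:
  fixes w w1 w2 g g1 r :: "real \<times> real \<Rightarrow> real"
  assumes M: "M > 0"
    and cont: "continuous_on UNIV w" "continuous_on UNIV w1" "continuous_on UNIV w2"
      "continuous_on UNIV g" "continuous_on UNIV g1" "continuous_on UNIV r"
    and per: "periodic w" "periodic g"
    and dw1: "\<And>x y. ((\<lambda>t. w (t, y)) has_real_derivative w1 (x, y)) (at x)"
    and dw2: "\<And>x y. ((\<lambda>t. w (x, t)) has_real_derivative w2 (x, y)) (at y)"
    and dg1: "\<And>x y. ((\<lambda>t. g (t, y)) has_real_derivative g1 (x, y)) (at x)"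
    and eq: "\<And>x. w2 x = w x * w1 x + r x + g1 x"
  shows "(\<integral>x. growth' M (w (x + (h, 0)) - w x) * w1 (x + (h, 0)) \<partial>torus)
    = (\<integral>x. flux_weight' M (w (x + (h, 0)) - w x) * (w1 (x + (h, 0)) - w1 x) * (g (x + (h, 0)) - g x)
         - flux_weight M (w (x + (h, 0)) - w x) * (r (x + (h, 0)) - r x) \<partial>torus)"
proof -
  let ?s = "\<lambda>f x. f (x + (h, 0 :: real)) :: real"
  define D where "D = (\<lambda>x. ?s w x - w x)"
  define D1 where "D1 = (\<lambda>x. ?s w1 x - w1 x)"
  define D2 where "D2 = (\<lambda>x. ?s w2 x - w2 x)"
  define m where "m = (\<lambda>x. (?s w x + w x) / 2)"
  define m1 where "m1 = (\<lambda>x. (?s w1 x + w1 x) / 2)"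
  define G where "G = (\<lambda>x. ?s g x - g x)"
  define G1 where "G1 = (\<lambda>x. ?s g1 x - g1 x)"
  define R where "R = (\<lambda>x. ?s r x - r x)"
  note defs = D_def D1_def D2_def m_def m1_def G_def G1_def R_def
  have cs: "continuous_on A (?s f)" if "continuous_on UNIV f" for A f
    by (intro continuous_on_compose2[OF that] continuous_intros) auto
  have cu: "continuous_on A f" if "continuous_on UNIV f" for A and f :: "real \<times> real \<Rightarrow> real"
    using that continuous_on_subset by blast
  have c: "continuous_on A D" "continuous_on A D1" "continuous_on A D2" "continuous_on A m"
    "continuous_on A m1" "continuous_on A G" "continuous_on A G1" "continuous_on A R"
    "continuous_on A (?s w1)" for A
    unfolding defs using cont
    by (auto intro!: continuous_intros cs intro: cu)
  note ci = continuous_on_add continuous_on_diff continuous_on_mult continuous_on_const c continuous_flux[OF M]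
  have per': "D (x + (1, 0)) = D x" "D (x + (0, 1)) = D x" "m (x + (1, 0)) = m x" "m (x + (0, 1)) = m x"
    "G (x + (1, 0)) = G x" "G (x + (0, 1)) = G x" for x
  proof -
    have P: "f (x + (1, 0) + (h, 0)) = f (x + (h, 0))" "f (x + (0, 1) + (h, 0)) = f (x + (h, 0))"
      "f (x + (1, 0)) = f x" "f (x + (0, 1)) = f x"
      if "periodic f" for f :: "real \<times> real \<Rightarrow> real"
      using that[unfolded periodic_def, rule_format, of "x + (h, 0)"]
        that[unfolded periodic_def, rule_format, of x] by (simp_all add: add_ac)
    show "D (x + (1, 0)) = D x" "D (x + (0, 1)) = D x" "m (x + (1, 0)) = m x" "m (x + (0, 1)) = m x"
      "G (x + (1, 0)) = G x" "G (x + (0, 1)) = G x"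
      unfolding defs by (simp_all only: P[OF per(1)] P[OF per(2)])
  qed
  have dD: "((\<lambda>t. D (t, y)) has_real_derivative D1 (x, y)) (at x)"
    "((\<lambda>t. m (t, y)) has_real_derivative m1 (x, y)) (at x)"
    "((\<lambda>t. G (t, y)) has_real_derivative G1 (x, y)) (at x)" for x y
    unfolding defs by (intro DERIV_diff DERIV_add DERIV_cdivide DERIV_shift1 dw1 dg1)+
  have dD2: "((\<lambda>t. D (x, t)) has_real_derivative D2 (x, y)) (at y)" for x y
    unfolding D_def D2_def using dw2[of "x + h" y] dw2[of x y] by (auto intro!: DERIV_diff)
  have chain: "((\<lambda>t. F (f t)) has_real_derivative F' (f x) * f') (at x)"
    if "\<And>a. (F has_real_derivative F' a) (at a)" "(f has_real_derivative f') (at x)" for F F' f f' x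
    using DERIV_chain2[OF that] .
  have Z1: "(\<integral>x. flux_weight M (D x) * D2 x \<partial>torus) = 0"
    by (rule integral_partial2_periodic[where F = "\<lambda>x. flux_pot M (D x)"])
       (auto simp del: split_paired_All simp: periodic_def per' intro!: ci chain DERIV_flux_pot M dD2
         simp flip: has_real_derivative_iff_has_vector_derivative)
  have Z2: "(\<integral>x. m1 x * flux_pot M (D x) + flux_weight M (D x) * D1 x * m x \<partial>torus) = 0"
    by (rule integral_partial1_periodic[where F = "\<lambda>x. m x * flux_pot M (D x)"])
       (auto simp del: split_paired_All simp: periodic_def per' intro!: ci chain DERIV_mult DERIV_flux_pot M dD
         simp flip: has_real_derivative_iff_has_vector_derivative)
  have Z3: "(\<integral>x. growth' M (D x) * D1 x \<partial>torus) = 0"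
    by (rule integral_partial1_periodic[where F = "\<lambda>x. growth M (D x)"])
       (auto simp del: split_paired_All simp: periodic_def per' intro!: ci chain DERIV_growth M dD
         simp flip: has_real_derivative_iff_has_vector_derivative)
  have Z4: "(\<integral>x. flux_weight' M (D x) * D1 x * G x + G1 x * flux_weight M (D x) \<partial>torus) = 0"
    by (rule integral_partial1_periodic[where F = "\<lambda>x. flux_weight M (D x) * G x"])
       (auto simp del: split_paired_All simp: periodic_def per' intro!: ci chain DERIV_mult DERIV_flux_weight M dD
         simp flip: has_real_derivative_iff_has_vector_derivative)
  have int: "integrable torus (\<lambda>x. flux_weight M (D x) * D2 x)"
    "integrable torus (\<lambda>x. m1 x * flux_pot M (D x) + flux_weight M (D x) * D1 x * m x)"
    "integrable torus (\<lambda>x. growth' M (D x) * D1 x)"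
    "integrable torus (\<lambda>x. flux_weight' M (D x) * D1 x * G x + G1 x * flux_weight M (D x))"
    by (intro integrable_torus_continuous ci)+
  have int2: "integrable torus (\<lambda>x. growth' M (D x) * ?s w1 x)"
    "integrable torus (\<lambda>x. flux_weight' M (D x) * D1 x * G x - flux_weight M (D x) * R x)"
    by (intro integrable_torus_continuous ci)+
  have pt: "growth' M (D x) * ?s w1 x - (flux_weight' M (D x) * D1 x * G x - flux_weight M (D x) * R x)
      = flux_weight M (D x) * D2 x - (m1 x * flux_pot M (D x) + flux_weight M (D x) * D1 x * m x)
        + growth' M (D x) * D1 x / 2 - (flux_weight' M (D x) * D1 x * G x + G1 x * flux_weight M (D x))" for x
  proof -
    \<comment> \<open>Discrete product rule: with \<open>m\<close> the average of the two values,
      the increment of \<open>w * w1\<close> is \<open>m * D1 + D * m1\<close>. The symmetric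
      splitting in \<open>e2\<close> fits it.\<close>
    have e1: "D2 x = m x * D1 x + D x * m1 x + R x + G1 x"
      unfolding D2_def eq by (simp add: defs field_simps)
    have e2: "?s w1 x = m1 x + D1 x / 2" by (simp add: m1_def D1_def field_simps)
    have e3: "flux_pot M (D x) = flux_weight M (D x) * D x - growth' M (D x)" by (simp add: flux_pot_def)
    show ?thesis unfolding e1 e2 e3 by (simp add: algebra_simps)
  qed
  have "(\<integral>x. growth' M (D x) * ?s w1 x \<partial>torus)
      - (\<integral>x. flux_weight' M (D x) * D1 x * G x - flux_weight M (D x) * R x \<partial>torus)
      = (\<integral>x. growth' M (D x) * ?s w1 x
          - (flux_weight' M (D x) * D1 x * G x - flux_weight M (D x) * R x) \<partial>torus)"
    by (rule Bochner_Integration.integral_diff[symmetric, OF int2])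
  also have "\<dots> = (\<integral>x. flux_weight M (D x) * D2 x \<partial>torus)
      - (\<integral>x. m1 x * flux_pot M (D x) + flux_weight M (D x) * D1 x * m x \<partial>torus)
      + (\<integral>x. growth' M (D x) * D1 x \<partial>torus) / 2
      - (\<integral>x. flux_weight' M (D x) * D1 x * G x + G1 x * flux_weight M (D x) \<partial>torus)"
    unfolding pt using int
    by (simp only: Bochner_Integration.integral_diff Bochner_Integration.integral_add
      Bochner_Integration.integrable_diff Bochner_Integration.integrable_add
      integrable_divide_zero integral_divide_zero)
  also have "\<dots> = 0" by (simp add: Z1 Z2 Z3 Z4)
  finally show ?thesis by (simp add: D_def D1_def G_def R_def)
qed

lemma integral_increment_power2_le:
  fixes f :: "real \<times> real \<Rightarrow> real"
  assumes c: "continuous_on UNIV f" and p: "periodic f" and h: "0 \<le> h" "h \<le> 1"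
    and fC: "(\<integral>x. (f x)\<^sup>2 \<partial>torus) \<le> C\<^sup>2"
  shows "(\<integral>x. (f (x + (h, 0)) - f x)\<^sup>2 \<partial>torus) \<le> (2 * C)\<^sup>2"
proof -
  have cs: "continuous_on UNIV (\<lambda>x. f (x + (h, 0)))"
    by (intro continuous_on_compose2[OF c] continuous_intros) auto
  have "(\<integral>x. (f (x + (h, 0)))\<^sup>2 \<partial>torus) = (\<integral>x. (f x)\<^sup>2 \<partial>torus)"
    by (rule integral_torus_shift1[of "\<lambda>x. (f x)\<^sup>2"])
       (use h p in \<open>auto simp: periodic_def intro!: continuous_on_power c\<close>)
  moreover have "(\<integral>x. (f (x + (h, 0)) - f x)\<^sup>2 \<partial>torus)
      \<le> 2 * (\<integral>x. (f (x + (h, 0)))\<^sup>2 \<partial>torus) + 2 * (\<integral>x. (f x)\<^sup>2 \<partial>torus)"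
    by (rule integral_diff_power2_le)
       (intro integrable_torus_continuous measurable_torus borel_measurable_continuous_onI
         continuous_on_power cs c)+
  ultimately show ?thesis using fC by (simp add: power_mult_distrib)
qed

text \<open>The integral vanishes at \<open>h = 0\<close>, and its derivative in \<open>h\<close> is
  the left-hand side of \<open>growth_rate_identity\<close>. Each increment has at most twice the
  norm of its function, so Cauchy-Schwarz gives \<open>4 * A * B\<close>; the error
  \<open>r\<close>, met at two points, costs \<open>2 * ln M\<close> times its L^1 norm.\<close>

theorem growth_increment_le:
  fixes w w1 w2 g g1 r :: "real \<times> real \<Rightarrow> real"
  assumes M: "M \<ge> 1" and h: "0 \<le> h" "h \<le> 1" and AB: "A \<ge> 0" "B \<ge> 0"
    and cont: "continuous_on UNIV w" "continuous_on UNIV w1" "continuous_on UNIV w2"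
      "continuous_on UNIV g" "continuous_on UNIV g1" "continuous_on UNIV r"
    and per: "periodic w" "periodic w1" "periodic g" "periodic r"
    and dw1: "\<And>x y. ((\<lambda>t. w (t, y)) has_real_derivative w1 (x, y)) (at x)"
    and dw2: "\<And>x y. ((\<lambda>t. w (x, t)) has_real_derivative w2 (x, y)) (at y)"
    and dg1: "\<And>x y. ((\<lambda>t. g (t, y)) has_real_derivative g1 (x, y)) (at x)"
    and eq: "\<And>x. w2 x = w x * w1 x + r x + g1 x"
    and le: "(\<integral>x. (w1 x)\<^sup>2 \<partial>torus) \<le> B\<^sup>2" "(\<integral>x. (g x)\<^sup>2 \<partial>torus) \<le> A\<^sup>2"
  shows "(\<integral>x. growth M (w (x + (h, 0)) - w x) \<partial>torus)
    \<le> h * (4 * A * B + 2 * ln M * (\<integral>x. \<bar>r x\<bar> \<partial>torus))"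
proof -
  define K where "K = 4 * A * B + 2 * ln M * (\<integral>x. \<bar>r x\<bar> \<partial>torus)"
  have M0: "M > 0" using M by simp
  have cs: "continuous_on S (\<lambda>x. f (x + (h, 0)))" if "continuous_on UNIV f"
    for S h and f :: "real \<times> real \<Rightarrow> real"
    by (intro continuous_on_compose2[OF that] continuous_intros) auto
  have cc: "continuous_on UNIV (\<lambda>x. growth M (w (x + (h, 0)) - w x))" for h
    by (intro continuous_flux[OF M0] continuous_on_diff cs cont)
  have cd: "continuous_on UNIV (\<lambda>x. growth' M (w (x + (h, 0)) - w x) * w1 (x + (h, 0)))" for h
    by (intro continuous_flux[OF M0] continuous_on_mult continuous_on_diff cs cont)
  define F where "F h = (\<integral>x. growth M (w (x + (h, 0)) - w x) \<partial>torus)" for h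
  define F' where "F' h = (\<integral>x. growth' M (w (x + (h, 0)) - w x) * w1 (x + (h, 0)) \<partial>torus)" for h
  have dF: "(F has_real_derivative F' h) (at h)" for h
  proof -
    have "((\<lambda>h. integral (cbox (0, 0) (1, 1)) (\<lambda>x. growth M (w (x + (h, 0)) - w x)))
      has_real_derivative integral (cbox (0, 0) (1, 1)) (\<lambda>x. growth' M (w (x + (h, 0)) - w x) * w1 (x + (h, 0))))
      (at h within UNIV)"
    proof (rule leibniz_rule_field_derivative)
      fix h :: real and x :: "real \<times> real"
      obtain a b where x: "x = (a, b)" by (cases x)
      have "((\<lambda>t. w (t + a, b)) has_real_derivative w1 (h + a, b)) (at h)"
        using DERIV_shift[of "\<lambda>t. w (t, b)" "w1 (h + a, b)" h a] dw1[of b "h + a"] by simp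
      then have "((\<lambda>t. w (x + (t, 0)) - w x) has_real_derivative w1 (x + (h, 0)) - 0) (at h)"
        by (intro DERIV_diff DERIV_const) (simp add: x add.commute)
      from DERIV_chain2[OF DERIV_growth[OF M0] this]
      show "((\<lambda>h. growth M (w (x + (h, 0)) - w x)) has_real_derivative
          growth' M (w (x + (h, 0)) - w x) * w1 (x + (h, 0))) (at h within UNIV)" by simp
    next
      fix h
      show "(\<lambda>x. growth M (w (x + (h, 0)) - w x)) integrable_on cbox (0, 0) (1, 1)"
        using cc continuous_on_subset by (intro integrable_continuous) blast
    next
      have cp: "continuous_on (UNIV \<times> cbox (0, 0) (1, 1)) (\<lambda>p. f (snd p + (fst p, 0)))"
        "continuous_on (UNIV \<times> cbox (0, 0) (1, 1)) (\<lambda>p. f (snd p))"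
        if "continuous_on UNIV f" for f :: "real \<times> real \<Rightarrow> real"
        by (intro continuous_on_compose2[OF that] continuous_intros; simp)+
      show "continuous_on (UNIV \<times> cbox (0, 0) (1, 1))
          (\<lambda>(h, x). growth' M (w (x + (h, 0)) - w x) * w1 (x + (h, 0)))"
        unfolding case_prod_beta
        by (intro continuous_flux[OF M0] continuous_on_mult continuous_on_diff cp cont)
    qed auto
    then show ?thesis
      by (simp add: F_def[abs_def] F'_def integral_torus_eq[OF cc] integral_torus_eq[OF cd])
  qed
  have F'_le: "\<bar>F' h\<bar> \<le> K" if h: "0 \<le> h" "h \<le> 1" for h
  proof -
    let ?D = "\<lambda>x. w (x + (h, 0)) - w x" and ?D1 = "\<lambda>x. w1 (x + (h, 0)) - w1 x"
      and ?G = "\<lambda>x. g (x + (h, 0)) - g x" and ?R = "\<lambda>x. r (x + (h, 0)) - r x"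
    note ci = continuous_on_add continuous_on_diff continuous_on_mult continuous_on_const
      continuous_on_power continuous_on_rabs cs[OF cont(1)] cs[OF cont(2)] cs[OF cont(4)]
      cs[OF cont(6)] cont continuous_flux[OF M0]
    note sq = integral_increment_power2_le[OF _ _ h]
    have DG: "(\<integral>x. \<bar>?D1 x * ?G x\<bar> \<partial>torus) \<le> (2 * B) * (2 * A)"
      by (rule abs_integral_mult_le)
         ((intro integrable_torus_continuous measurable_torus borel_measurable_continuous_onI ci sq per le)+,
          use AB in auto)
    have Rsh: "(\<integral>x. \<bar>r (x + (h, 0))\<bar> \<partial>torus) = (\<integral>x. \<bar>r x\<bar> \<partial>torus)"
      by (rule integral_torus_shift1[of "\<lambda>x. \<bar>r x\<bar>"])
         (use h per(4) in \<open>auto simp: periodic_def intro!: ci\<close>)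
    have ir: "integrable torus (\<lambda>x. \<bar>?D1 x * ?G x\<bar>)" "integrable torus (\<lambda>x. \<bar>r (x + (h, 0))\<bar>)"
      "integrable torus (\<lambda>x. \<bar>r x\<bar>)"
      by (intro integrable_torus_continuous ci)+
    have cD: "continuous_on UNIV ?D" and cD1: "continuous_on UNIV ?D1" and cG: "continuous_on UNIV ?G"
      and cR: "continuous_on UNIV ?R"
      by (intro continuous_on_diff cs cont)+
    have F'_eq: "F' h = (\<integral>x. flux_weight' M (?D x) * ?D1 x * ?G x - flux_weight M (?D x) * ?R x \<partial>torus)"
      unfolding F'_def by (rule growth_rate_identity[OF M0 cont per(1,3) dw1 dw2 dg1 eq])
    have "\<bar>F' h\<bar> \<le> (\<integral>x. \<bar>flux_weight' M (?D x) * ?D1 x * ?G x - flux_weight M (?D x) * ?R x\<bar> \<partial>torus)"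
      unfolding F'_eq by (rule integral_abs_bound)
    also have "\<dots> \<le> (\<integral>x. \<bar>?D1 x * ?G x\<bar> + ln M * (\<bar>r (x + (h, 0))\<bar> + \<bar>r x\<bar>) \<partial>torus)"
    proof (rule integral_mono)
      have c1: "continuous_on UNIV (\<lambda>x. flux_weight' M (?D x))" by (rule continuous_flux(2)[OF M0 cD])
      have c2: "continuous_on UNIV (\<lambda>x. flux_weight M (?D x))" by (rule continuous_flux(1)[OF M0 cD])
      have c3: "continuous_on UNIV (\<lambda>x. \<bar>flux_weight' M (?D x) * ?D1 x * ?G x - flux_weight M (?D x) * ?R x\<bar>)"
        by (rule continuous_on_rabs[OF continuous_on_diff[OF continuous_on_mult[OF continuous_on_mult[OF c1 cD1] cG] continuous_on_mult[OF c2 cR]]])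
      show "integrable torus (\<lambda>x. \<bar>flux_weight' M (?D x) * ?D1 x * ?G x - flux_weight M (?D x) * ?R x\<bar>)"
        by (rule integrable_torus_continuous[OF c3])
      show "integrable torus (\<lambda>x. \<bar>?D1 x * ?G x\<bar> + ln M * (\<bar>r (x + (h, 0))\<bar> + \<bar>r x\<bar>))"
        using ir by auto
      fix x
      have "\<bar>flux_weight' M (?D x) * (?D1 x * ?G x)\<bar> \<le> 1 * \<bar>?D1 x * ?G x\<bar>"
        unfolding abs_mult by (intro mult_right_mono abs_flux_weight'_le M mult_nonneg_nonneg) auto
      moreover have "\<bar>flux_weight M (?D x) * ?R x\<bar> \<le> ln M * \<bar>?R x\<bar>"
        unfolding abs_mult[of "flux_weight M _"] by (intro mult_right_mono abs_flux_weight_le M) auto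
      moreover have "ln M * \<bar>?R x\<bar> \<le> ln M * (\<bar>r (x + (h, 0))\<bar> + \<bar>r x\<bar>)"
        using M by (intro mult_left_mono) auto
      ultimately show "\<bar>flux_weight' M (?D x) * ?D1 x * ?G x - flux_weight M (?D x) * ?R x\<bar>
          \<le> \<bar>?D1 x * ?G x\<bar> + ln M * (\<bar>r (x + (h, 0))\<bar> + \<bar>r x\<bar>)"
        unfolding mult.assoc by linarith
    qed
    also have "\<dots> = (\<integral>x. \<bar>?D1 x * ?G x\<bar> \<partial>torus) + ln M * ((\<integral>x. \<bar>r (x + (h, 0))\<bar> \<partial>torus) + (\<integral>x. \<bar>r x\<bar> \<partial>torus))"
      using ir by simp
    also have "\<dots> \<le> K"
      using DG unfolding Rsh K_def by (simp add: algebra_simps)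
    finally show ?thesis .
  qed
  have "norm (F h - F 0) \<le> K * norm (h - 0)"
  proof (rule field_differentiable_bound[of "{0..h}" _ F'])
    show "(F has_field_derivative F' z) (at z within {0..h})" for z
      by (rule has_field_derivative_at_within[OF dF])
    show "norm (F' z) \<le> K" if "z \<in> {0..h}" for z
      using F'_le[of z] that h by simp
  qed (use h in auto)
  moreover have "F 0 = 0"
  proof -
    have z: "(0 :: real, 0 :: real) = 0" by (simp add: zero_prod_def)
    show ?thesis unfolding F_def z by simp
  qed
  ultimately have "F h \<le> K * h" using h by simp
  then show ?thesis by (simp add: F_def K_def mult.commute)
qed

section \<open>Increments of weak solutions\<close>

lemma trig_poly_real_derivative:
  "((\<lambda>t. Re (trig_poly S c (t, y))) has_real_derivative Re (trig_poly S (\<lambda>k. 2 * pi * \<i> * of_int (fst k) * c k) (x, y))) (at x)"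
  "((\<lambda>t. Re (trig_poly S c (x, t))) has_real_derivative Re (trig_poly S (\<lambda>k. 2 * pi * \<i> * of_int (snd k) * c k) (x, y))) (at y)"
proof -
  have "((\<lambda>t. trig_poly S c (t, y)) has_vector_derivative (\<Sum>k\<in>S. c k * (2 * pi * \<i> * of_int (fst k) * torus_char k (x, y)))) (at x)"
    unfolding trig_poly_def
    by (intro has_vector_derivative_sum has_vector_derivative_mult_right torus_char_vector_derivative1)
  then show "((\<lambda>t. Re (trig_poly S c (t, y))) has_real_derivative Re (trig_poly S (\<lambda>k. 2 * pi * \<i> * of_int (fst k) * c k) (x, y))) (at x)"
    unfolding has_real_derivative_iff_has_vector_derivative trig_poly_def
    using bounded_linear.has_vector_derivative[OF bounded_linear_Re] by (fastforce simp: mult_ac)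
  have "((\<lambda>t. trig_poly S c (x, t)) has_vector_derivative (\<Sum>k\<in>S. c k * (2 * pi * \<i> * of_int (snd k) * torus_char k (x, y)))) (at y)"
    unfolding trig_poly_def
    by (intro has_vector_derivative_sum has_vector_derivative_mult_right torus_char_vector_derivative2)
  then show "((\<lambda>t. Re (trig_poly S c (x, t))) has_real_derivative Re (trig_poly S (\<lambda>k. 2 * pi * \<i> * of_int (snd k) * c k) (x, y))) (at y)"
    unfolding has_real_derivative_iff_has_vector_derivative trig_poly_def
    using bounded_linear.has_vector_derivative[OF bounded_linear_Re] by (fastforce simp: mult_ac)
qed

lemma periodic_Re_trig_poly: "periodic (\<lambda>x. Re (trig_poly S c x))"
  using periodic_torus_char by (simp add: periodic_def trig_poly_def)

lemma trig_poly_add: "trig_poly S c x + trig_poly S d x = trig_poly S (\<lambda>k. c k + d k) x"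
  by (simp add: trig_poly_def sum.distrib distrib_right)

lemma fcoeff_increment:
  assumes f: "integrable torus f"
  shows "fcoeff (\<lambda>x. fejer N f (x + (h, 0)) - fejer N f x) k = (torus_char k (h, 0) - 1) * fcoeff (fejer N f) k"
proof -
  let ?c = "\<lambda>k. of_real (fejer_mult N k) * fcoeff f k"
  have "of_real (fejer N f (x + (h, 0)) - fejer N f x) = trig_poly (fejer_freqs N) (\<lambda>k. (torus_char k (h, 0) - 1) * ?c k) x" for x
    unfolding of_real_diff fejer_eq_trig_poly[OF f]
    by (simp add: trig_poly_def torus_char_add_arg algebra_simps flip: sum_subtractf)
  then have "fcoeff (\<lambda>x. fejer N f (x + (h, 0)) - fejer N f x) k
      = (if k \<in> fejer_freqs N then (torus_char k (h, 0) - 1) * ?c k else 0)"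
    unfolding fcoeff_def by (simp only: trig_poly_coeff[OF finite_fejer(2)])
  also have "\<dots> = (torus_char k (h, 0) - 1) * ?c k"
    using fejer_mult_outside[of k N] by auto
  finally show ?thesis by (simp add: fcoeff_fejer[OF f])
qed

text \<open>The difference of the products splits as \<open>(f x - fejer N f x) * g x + fejer N f x
  * (g x - fejer N g x)\<close>. Cauchy-Schwarz and the L^2 convergence of both means handle each
  part.\<close>

lemma fejer_product_L1:
  assumes f: "f \<in> borel_measurable torus" "integrable torus (\<lambda>x. (f x)\<^sup>2)"
    and g: "g \<in> borel_measurable torus" "integrable torus (\<lambda>x. (g x)\<^sup>2)"
  shows "integrable torus (\<lambda>x. f x * g x)"
    and "(\<lambda>N. \<integral>x. \<bar>f x * g x - fejer N f x * fejer N g x\<bar> \<partial>torus) \<longlonglongrightarrow> 0"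
proof -
  let ?n = "\<lambda>f. sqrt (\<integral>x. (f x)\<^sup>2 \<partial>torus)"
  have int: "integrable torus f" "integrable torus g"
    using f g torus.square_integrable_imp_integrable by blast+
  note fm = measurable_fejer[OF int(1)] measurable_fejer[OF int(2)]
  note f2 = integrable_fejer_power2[OF int(1)] integrable_fejer_power2[OF int(2)]
  have CS: "integrable torus (\<lambda>x. a x * b x)" "(\<integral>x. \<bar>a x * b x\<bar> \<partial>torus) \<le> ?n a * ?n b"
    if "integrable torus (\<lambda>x. (a x)\<^sup>2)" "integrable torus (\<lambda>x. (b x)\<^sup>2)"
      "a \<in> borel_measurable torus" "b \<in> borel_measurable torus" for a b
    using abs_integral_mult_le[OF that, of "?n a" "?n b"] by simp_all
  show fg: "integrable torus (\<lambda>x. f x * g x)"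
    by (rule CS(1)) (use f g in auto)
  have fd: "(\<lambda>x. f x - fejer N f x) \<in> borel_measurable torus" "integrable torus (\<lambda>x. (f x - fejer N f x)\<^sup>2)" for N
    using f fm f2 by (auto intro!: integral_diff_power2_le(1))
  have gd: "(\<lambda>x. g x - fejer N g x) \<in> borel_measurable torus" "integrable torus (\<lambda>x. (g x - fejer N g x)\<^sup>2)" for N
    using g fm f2 by (auto intro!: integral_diff_power2_le(1))
  have le: "(\<integral>x. \<bar>f x * g x - fejer N f x * fejer N g x\<bar> \<partial>torus)
      \<le> ?n (\<lambda>x. f x - fejer N f x) * ?n g + ?n f * ?n (\<lambda>x. g x - fejer N g x)" for N
  proof -
    note i1 = CS[OF fd(2) g(2) fd(1) g(1), of N] and i2 = CS[OF f2(1) gd(2) fm(1) gd(1), of N N]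
    have i3: "integrable torus (\<lambda>x. fejer N f x * fejer N g x)"
      by (rule CS(1)[OF f2 fm])
    have "(\<integral>x. \<bar>f x * g x - fejer N f x * fejer N g x\<bar> \<partial>torus)
        \<le> (\<integral>x. \<bar>(f x - fejer N f x) * g x\<bar> + \<bar>fejer N f x * (g x - fejer N g x)\<bar> \<partial>torus)"
    proof (rule integral_mono)
      fix x
      have "f x * g x - fejer N f x * fejer N g x = (f x - fejer N f x) * g x + fejer N f x * (g x - fejer N g x)"
        by (simp add: algebra_simps)
      then show "\<bar>f x * g x - fejer N f x * fejer N g x\<bar> \<le> \<bar>(f x - fejer N f x) * g x\<bar> + \<bar>fejer N f x * (g x - fejer N g x)\<bar>"
        by linarith
    qed (use i1(1) i2(1) i3 fg in auto)
    also have "\<dots> = (\<integral>x. \<bar>(f x - fejer N f x) * g x\<bar> \<partial>torus) + (\<integral>x. \<bar>fejer N f x * (g x - fejer N g x)\<bar> \<partial>torus)"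
      using i1(1) i2(1) by (intro Bochner_Integration.integral_add integrable_abs)
    also have "\<dots> \<le> ?n (\<lambda>x. f x - fejer N f x) * ?n g + ?n (fejer N f) * ?n (\<lambda>x. g x - fejer N g x)"
      by (intro add_mono i1(2) i2(2))
    also have "\<dots> \<le> ?n (\<lambda>x. f x - fejer N f x) * ?n g + ?n f * ?n (\<lambda>x. g x - fejer N g x)"
      by (intro add_left_mono mult_right_mono real_sqrt_le_mono fejer_L2_contraction f) simp
    finally show ?thesis .
  qed
  have lim: "(\<lambda>N. ?n (\<lambda>x. f x - fejer N f x)) \<longlonglongrightarrow> 0"
    if "f \<in> borel_measurable torus" "integrable torus (\<lambda>x. (f x)\<^sup>2)" for f
    using tendsto_real_sqrt[OF fejer_converges_L2[OF that]] by (simp add: power2_commute)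
  have "(\<lambda>N. ?n (\<lambda>x. f x - fejer N f x) * ?n g + ?n f * ?n (\<lambda>x. g x - fejer N g x)) \<longlonglongrightarrow> 0 * ?n g + ?n f * 0"
    by (intro tendsto_intros lim f g)
  then have lim0: "(\<lambda>N. ?n (\<lambda>x. f x - fejer N f x) * ?n g + ?n f * ?n (\<lambda>x. g x - fejer N g x)) \<longlonglongrightarrow> 0"
    by simp
  show "(\<lambda>N. \<integral>x. \<bar>f x * g x - fejer N f x * fejer N g x\<bar> \<partial>torus) \<longlonglongrightarrow> 0"
    by (rule tendsto_sandwich[OF _ _ tendsto_const lim0]) (use le in auto)
qed

lemma fcoeff_tendsto_L1:
  assumes "\<And>N. integrable torus (F N)" "integrable torus f"
    and "(\<lambda>N. \<integral>x. \<bar>f x - F N x\<bar> \<partial>torus) \<longlonglongrightarrow> 0"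
  shows "(\<lambda>N. fcoeff (F N) k) \<longlonglongrightarrow> fcoeff f k"
proof (rule Lim_null[THEN iffD2], rule tendsto_norm_zero_cancel,
    rule tendsto_sandwich[OF _ _ tendsto_const assms(3)])
  have "norm (fcoeff (F N) k - fcoeff f k) \<le> (\<integral>x. \<bar>f x - F N x\<bar> \<partial>torus)" for N
    using norm_fc_le[of "\<lambda>x. F N x - f x" k] assms(1,2)
    by (simp add: fcoeff_diff abs_minus_commute)
  then show "\<forall>\<^sub>F N in sequentially. norm (fcoeff (F N) k - fcoeff f k) \<le> (\<integral>x. \<bar>f x - F N x\<bar> \<partial>torus)"
    by simp
qed simp

text \<open>The relation between the coefficients says that \<open>v\<close> is the weak derivative
  of \<open>w\<close> in x_1. Multipliers commute with differentiation, so for the smooth means the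
  relation is classical.\<close>

lemma fejer_partial1:
  assumes w: "integrable torus w" and v: "integrable torus v"
    and vw: "\<And>k. fcoeff v k = 2 * pi * \<i> * of_int (fst k) * fcoeff w k"
  shows "((\<lambda>t. fejer N w (t, y)) has_real_derivative fejer N v (x, y)) (at x)"
  using trig_poly_real_derivative(1)[of "fejer_freqs N" "\<lambda>k. of_real (fejer_mult N k) * fcoeff w k" y x]
  unfolding fejer_eq_Re_trig_poly[OF w] fejer_eq_Re_trig_poly[OF v] vw by (simp add: mult_ac)

text \<open>The weak chain rule d_1 (w^2 / 2) = w d_1 w. It holds classically for Fejer means, is
  tested with one character by integration by parts, and survives the limit because both products
  converge in L^1.\<close>

lemma fcoeff_square_derivative:
  assumes w: "w \<in> borel_measurable torus" "integrable torus (\<lambda>x. (w x)\<^sup>2)"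
    and v: "v \<in> borel_measurable torus" "integrable torus (\<lambda>x. (v x)\<^sup>2)"
    and vw: "\<And>k. fcoeff v k = 2 * pi * \<i> * of_int (fst k) * fcoeff w k"
  shows "fcoeff (\<lambda>x. w x * v x) k = 2 * pi * \<i> * of_int (fst k) * fcoeff (\<lambda>x. 1 / 2 * (w x)\<^sup>2) k"
proof -
  have int: "integrable torus w" "integrable torus v"
    using w v torus.square_integrable_imp_integrable by blast+
  have "fcoeff (\<lambda>x. fejer N w x * fejer N v x) k = 2 * pi * \<i> * of_int (fst k) * (1 / 2 * fcoeff (\<lambda>x. fejer N w x * fejer N w x) k)" for N
  proof -
    let ?w = "fejer N w" and ?v = "fejer N v" and ?m = "2 * pi * \<i> * of_int (fst k)"
    have c: "continuous_on UNIV ?w" "continuous_on UNIV ?v"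
      by (rule continuous_fejer[OF int(1)], rule continuous_fejer[OF int(2)])
    have p: "periodic (\<lambda>x. of_real (?w x * ?w x / 2) * torus_char (- k) x)"
      using periodic_Re_trig_poly periodic_torus_char unfolding fejer_eq_Re_trig_poly[OF int(1)] by (simp add: periodic_def)
    have "((\<lambda>t. of_real (?w (t, y) * ?w (t, y) / 2) * torus_char (- k) (t, y)) has_vector_derivative
        of_real (?w (x, y) * ?w (x, y) / 2) * (- ?m * torus_char (- k) (x, y))
        + of_real (?w (x, y) * ?v (x, y)) * torus_char (- k) (x, y)) (at x)" for x y
    proof (rule has_vector_derivative_mult)
      have "((\<lambda>t. ?w (t, y) * ?w (t, y) / 2) has_real_derivative
          (?v (x, y) * ?w (x, y) + ?v (x, y) * ?w (x, y)) / 2) (at x)"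
        by (intro DERIV_cdivide DERIV_mult fejer_partial1 int vw)
      then have "((\<lambda>t. ?w (t, y) * ?w (t, y) / 2) has_real_derivative ?w (x, y) * ?v (x, y)) (at x)"
        by (simp add: mult.commute)
      then show "((\<lambda>t. complex_of_real (?w (t, y) * ?w (t, y) / 2)) has_vector_derivative
          of_real (?w (x, y) * ?v (x, y))) (at x)"
        unfolding has_real_derivative_iff_has_vector_derivative
        by (rule bounded_linear.has_vector_derivative[OF bounded_linear_of_real])
      show "((\<lambda>t. torus_char (- k) (t, y)) has_vector_derivative - ?m * torus_char (- k) (x, y)) (at x)"
        using torus_char_vector_derivative1[of "- k" y x] by simp
    qed
    then have "(\<integral>x. of_real (?w x * ?w x / 2) * (- ?m * torus_char (- k) x) + of_real (?w x * ?v x) * torus_char (- k) x \<partial>torus) = 0"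
      by (intro integral_partial1_periodic[OF p] continuous_intros c) simp_all
    also have "(\<integral>x. of_real (?w x * ?w x / 2) * (- ?m * torus_char (- k) x) + of_real (?w x * ?v x) * torus_char (- k) x \<partial>torus)
        = (\<integral>x. - (?m / 2) * (of_real (?w x * ?w x) * cnj (torus_char k x)) + of_real (?w x * ?v x) * cnj (torus_char k x) \<partial>torus)"
      by (intro Bochner_Integration.integral_cong refl) (simp add: cnj_torus_char)
    also have "\<dots> = (\<integral>x. - (?m / 2) * (of_real (?w x * ?w x) * cnj (torus_char k x)) \<partial>torus)
        + (\<integral>x. of_real (?w x * ?v x) * cnj (torus_char k x) \<partial>torus)"
      by (intro Bochner_Integration.integral_add integrable_mult_right integrable_mult_torus_char
        integrable_torus_continuous continuous_on_mult c)
    also have "\<dots> = - (?m / 2) * fcoeff (\<lambda>x. ?w x * ?w x) k + fcoeff (\<lambda>x. ?w x * ?v x) k"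
      unfolding fcoeff_def integral_mult_right_zero ..
    finally show ?thesis by (simp add: algebra_simps)
  qed
  moreover have "(\<lambda>N. fcoeff (\<lambda>x. fejer N w x * fejer N v x) k) \<longlonglongrightarrow> fcoeff (\<lambda>x. w x * v x) k"
    by (intro fcoeff_tendsto_L1 fejer_product_L1 w v integrable_torus_continuous continuous_on_mult continuous_fejer int)
  moreover have "(\<lambda>N. 2 * pi * \<i> * of_int (fst k) * (1 / 2 * fcoeff (\<lambda>x. fejer N w x * fejer N w x) k))
      \<longlonglongrightarrow> 2 * pi * \<i> * of_int (fst k) * (1 / 2 * fcoeff (\<lambda>x. w x * w x) k)"
    by (intro tendsto_intros fcoeff_tendsto_L1 fejer_product_L1 w integrable_torus_continuous continuous_on_mult continuous_fejer int)
  ultimately have "fcoeff (\<lambda>x. w x * v x) k = 2 * pi * \<i> * of_int (fst k) * (1 / 2 * fcoeff (\<lambda>x. w x * w x) k)"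
    by (simp only: LIMSEQ_unique)
  then show ?thesis
    by (simp only: power2_eq_square fcoeff_cmult) simp
qed

text \<open>Here \<open>q\<close> and \<open>v\<close> stand for |d_1|^-1 eta_w and d_1 w, given
  through their coefficients. \<open>growth_increment_le\<close> applies to each Fejer mean with the
  commutator as error. In \<open>main\<close>, \<open>M\<close> is adapted to the mean of index
  \<open>N\<close>, while the balance is taken at \<open>N'\<close>; letting \<open>N'\<close> tend
  to infinity with \<open>M\<close> fixed removes the commutator despite the factor
  \<open>ln M\<close>, and \<open>N\<close> follows at the end.\<close>

theorem increment_coeff_bound:
  assumes w: "w \<in> borel_measurable torus" "integrable torus (\<lambda>x. (w x)\<^sup>2)"
    and v: "v \<in> borel_measurable torus" "integrable torus (\<lambda>x. (v x)\<^sup>2)"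
    and q: "q \<in> borel_measurable torus" "integrable torus (\<lambda>x. (q x)\<^sup>2)"
    and vw: "\<And>k. fcoeff v k = 2 * pi * \<i> * of_int (fst k) * fcoeff w k"
    and qw: "\<And>k. 2 * pi * of_int \<bar>fst k\<bar> * fcoeff q k
      = 2 * pi * \<i> * of_int (snd k) * fcoeff w k - 2 * pi * \<i> * of_int (fst k) * fcoeff (\<lambda>x. 1 / 2 * (w x)\<^sup>2) k"
    and AB: "A \<ge> 0" "B \<ge> 0" "(\<integral>x. (q x)\<^sup>2 \<partial>torus) \<le> A\<^sup>2" "(\<integral>x. (v x)\<^sup>2 \<partial>torus) \<le> B\<^sup>2"
    and S: "finite S" and h: "0 \<le> h" "h \<le> 1" and s: "s > 0"
  shows "(\<Sum>k\<in>S. (norm ((torus_char k (h, 0) - 1) * fcoeff w k))\<^sup>2) \<le> s\<^sup>2 + 48 * (1 + 1 / s\<^sup>2) * (4 * A * B * h)"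
proof -
  have int: "integrable torus w" "integrable torus v" "integrable torus q"
    using w v q torus.square_integrable_imp_integrable by blast+
  define W where "W = sqrt (\<integral>x. (w x)\<^sup>2 \<partial>torus)"
  have W: "W \<ge> 0" "(\<integral>x. (w x)\<^sup>2 \<partial>torus) = W\<^sup>2" by (simp_all add: W_def)
  define D where "D N x = fejer N w (x + (h, 0)) - fejer N w x" for N x
  define a where "a N = (\<integral>x. (fejer N w x - w x)\<^sup>2 \<partial>torus)" for N
  define \<rho> where "\<rho> N = (\<integral>x. \<bar>fejer N (\<lambda>x. w x * v x) x - fejer N w x * fejer N v x\<bar> \<partial>torus)" for N
  have cw: "continuous_on X (fejer N w)" for X N by (rule continuous_fejer[OF int(1)])
  have pw: "periodic (fejer N w)" for N
    using periodic_Re_trig_poly unfolding fejer_eq_Re_trig_poly[OF int(1)] .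
  have pv: "periodic (fejer N v)" for N
    using periodic_Re_trig_poly unfolding fejer_eq_Re_trig_poly[OF int(2)] .
  have cD: "continuous_on X (D N)" for X N
    unfolding D_def[abs_def] by (intro continuous_on_diff cw continuous_on_compose2[OF cw[of UNIV]] continuous_intros) auto
  have mD: "D N \<in> borel_measurable torus" for N
    by (intro measurable_torus borel_measurable_continuous_onI cD)
  have wv: "integrable torus (\<lambda>x. w x * v x)"
    by (rule fejer_product_L1(1)[OF w v])
  have \<rho>: "\<rho> \<longlonglongrightarrow> 0"
  proof (rule tendsto_sandwich[OF _ _ tendsto_const])
    show "(\<lambda>N. (\<integral>x. \<bar>fejer N (\<lambda>x. w x * v x) x - w x * v x\<bar> \<partial>torus)
        + (\<integral>x. \<bar>w x * v x - fejer N w x * fejer N v x\<bar> \<partial>torus)) \<longlonglongrightarrow> 0"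
      using tendsto_add[OF fejer_converges_L1[OF wv, unfolded fejer_converges_def] fejer_product_L1(2)[OF w v]]
      by simp
    have "\<rho> N \<le> (\<integral>x. \<bar>fejer N (\<lambda>x. w x * v x) x - w x * v x\<bar> \<partial>torus)
        + (\<integral>x. \<bar>w x * v x - fejer N w x * fejer N v x\<bar> \<partial>torus)" for N
    proof -
      have i: "integrable torus (fejer N (\<lambda>x. w x * v x))" by (rule integrable_fejer[OF wv])
      have j: "integrable torus (\<lambda>x. fejer N w x * fejer N v x)"
        by (intro integrable_torus_continuous continuous_on_mult continuous_fejer int)
      have "\<rho> N \<le> (\<integral>x. \<bar>fejer N (\<lambda>x. w x * v x) x - w x * v x\<bar> + \<bar>w x * v x - fejer N w x * fejer N v x\<bar> \<partial>torus)"
        unfolding \<rho>_def using i j wv by (intro integral_mono) auto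
      then show ?thesis using i j wv by simp
    qed
    then show "\<forall>\<^sub>F N in sequentially. \<rho> N \<le> (\<integral>x. \<bar>fejer N (\<lambda>x. w x * v x) x - w x * v x\<bar> \<partial>torus)
        + (\<integral>x. \<bar>w x * v x - fejer N w x * fejer N v x\<bar> \<partial>torus)" by simp
  qed (simp add: \<rho>_def)
  have a: "a \<longlonglongrightarrow> 0"
    unfolding a_def by (rule fejer_converges_L2[OF w])
  have growth_le: "(\<integral>x. growth M (D N x) \<partial>torus) \<le> h * (4 * A * B + 2 * ln M * \<rho> N)" if M: "M \<ge> 1" for M N
  proof -
    let ?F = "fejer_freqs N" and ?\<sigma> = "\<lambda>k. complex_of_real (fejer_mult N k)"
    \<comment> \<open>The multiplier \<open>- \<i> * sgn k1\<close> of the Hilbert transform: its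
      product with \<open>?m k\<close> is 2 pi |k1|, so \<open>?g1\<close> is the mean of eta_w. Its
      modulus is at most 1, so the L^2 bound of \<open>q\<close> carries over to
      \<open>?g\<close>.\<close>
    define cg where "cg k = ?\<sigma> k * (- \<i> * of_int (sgn (fst k)) * fcoeff q k)" for k
    let ?m = "\<lambda>k. 2 * pi * \<i> * of_int (fst k)"
    let ?w2 = "\<lambda>x. Re (trig_poly ?F (\<lambda>k. 2 * pi * \<i> * of_int (snd k) * (?\<sigma> k * fcoeff w k)) x)"
    let ?g = "\<lambda>x. Re (trig_poly ?F cg x)" and ?g1 = "\<lambda>x. Re (trig_poly ?F (\<lambda>k. ?m k * cg k) x)"
    let ?P = "fejer N (\<lambda>x. w x * v x)"
    \<comment> \<open>The commutator: the mean of the product minus the product of the means. Adding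
      it back turns the averaged equation into the form with
      \<open>fejer N w x * fejer N v x\<close>.\<close>
    let ?r = "\<lambda>x. ?P x - fejer N w x * fejer N v x"
    have "(\<integral>x. growth M (D N x) \<partial>torus) \<le> h * (4 * A * B + 2 * ln M * (\<integral>x. \<bar>?r x\<bar> \<partial>torus))"
      unfolding D_def
    proof (rule growth_increment_le[OF M h AB(1,2)])
      show "continuous_on UNIV (fejer N w)" "continuous_on UNIV (fejer N v)" by (intro continuous_fejer int)+
      show "continuous_on UNIV ?w2" "continuous_on UNIV ?g" "continuous_on UNIV ?g1" by (intro continuous_intros)+
      show "continuous_on UNIV ?r" by (intro continuous_on_diff continuous_on_mult continuous_fejer int wv)
      show "periodic (fejer N w)" "periodic (fejer N v)" by (rule pw, rule pv)
      show "periodic ?g" by (rule periodic_Re_trig_poly)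
      have "periodic ?P" using periodic_Re_trig_poly unfolding fejer_eq_Re_trig_poly[OF wv] .
      then show "periodic ?r" using pw[of N] pv[of N] by (simp add: periodic_def)
      show "((\<lambda>t. fejer N w (t, y)) has_real_derivative fejer N v (x, y)) (at x)" for x y
        by (rule fejer_partial1[OF int(1,2) vw])
      show "((\<lambda>t. fejer N w (x, t)) has_real_derivative ?w2 (x, y)) (at y)" for x y
        unfolding fejer_eq_Re_trig_poly[OF int(1)] by (rule trig_poly_real_derivative(2))
      show "((\<lambda>t. ?g (t, y)) has_real_derivative ?g1 (x, y)) (at x)" for x y
        by (rule trig_poly_real_derivative(1))
      show "?w2 x = fejer N w x * fejer N v x + ?r x + ?g1 x" for x
      proof -
        have "2 * pi * \<i> * of_int (snd k) * (?\<sigma> k * fcoeff w k) = ?\<sigma> k * fcoeff (\<lambda>x. w x * v x) k + ?m k * cg k" for k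
        proof -
          have "of_int (fst k) * of_int (sgn (fst k)) = (of_int \<bar>fst k\<bar> :: complex)"
            by (metis abs_sgn of_int_mult)
          then have "?m k * cg k = ?\<sigma> k * (2 * pi * of_int \<bar>fst k\<bar> * fcoeff q k)"
            by (simp add: cg_def mult.assoc mult.left_commute)
               (metis of_int_abs of_real_of_int_eq)
          then show ?thesis
            unfolding qw fcoeff_square_derivative[OF w v vw] by (simp add: algebra_simps)
        qed
        then have "?w2 x = ?P x + ?g1 x"
          unfolding fejer_eq_Re_trig_poly[OF wv] by (simp only: trig_poly_add flip: plus_complex.simps(1))
        then show ?thesis by simp
      qed
      show "(\<integral>x. (fejer N v x)\<^sup>2 \<partial>torus) \<le> B\<^sup>2"
        using fejer_L2_contraction[OF v] AB(4) by (rule order_trans)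
      show "(\<integral>x. (?g x)\<^sup>2 \<partial>torus) \<le> A\<^sup>2"
      proof -
        have "(\<integral>x. (?g x)\<^sup>2 \<partial>torus) \<le> (\<integral>x. (norm (trig_poly ?F cg x))\<^sup>2 \<partial>torus)"
          by (intro integral_mono integrable_torus_continuous continuous_intros)
             (simp add: cmod_power2)
        also have "\<dots> = (\<Sum>k\<in>?F. (norm (cg k))\<^sup>2)" by (rule parseval_trig_poly) simp
        also have "\<dots> \<le> (\<Sum>k\<in>?F. (norm (fcoeff q k))\<^sup>2)"
        proof (intro sum_mono power_mono)
          fix k :: "int \<times> int"
          have "norm (of_int (sgn (fst k)) :: complex) \<le> 1"
            by (simp add: sgn_if)
          then show "norm (cg k) \<le> norm (fcoeff q k)"
          proof -
            assume "norm (of_int (sgn (fst k)) :: complex) \<le> 1"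
            then have "fejer_mult N k * (norm (of_int (sgn (fst k)) :: complex) * norm (fcoeff q k)) \<le> 1 * (1 * norm (fcoeff q k))"
              by (intro mult_mono fejer_mult_le_1) (auto simp: fejer_mult_nonneg)
            then show ?thesis
              by (simp add: cg_def norm_mult abs_of_nonneg fejer_mult_nonneg)
          qed
        qed simp
        also have "\<dots> \<le> A\<^sup>2" using bessel[OF finite_fejer(2) q] AB(3) by (rule order_trans)
        finally show ?thesis .
      qed
    qed
    then show ?thesis by (simp add: \<rho>_def)
  qed
  have w2: "(\<integral>x. (fejer N w x)\<^sup>2 \<partial>torus) \<le> W\<^sup>2" for N
    using fejer_L2_contraction[OF w] W(2) by simp
  have D2: "(\<integral>x. (D N x)\<^sup>2 \<partial>torus) \<le> (2 * W)\<^sup>2" for N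
    unfolding D_def by (rule integral_increment_power2_le[OF cw pw h w2])
  have wN2: "integrable torus (\<lambda>x. (fejer N w x - w x)\<^sup>2)" for N
    by (rule integral_diff_power2_le(1)) (use w int integrable_fejer_power2 measurable_fejer in auto)
  have diff2: "(\<integral>x. (D N x - D N' x)\<^sup>2 \<partial>torus) \<le> (2 * sqrt (2 * a N + 2 * a N'))\<^sup>2" for N N'
  proof -
    let ?u = "\<lambda>x. fejer N w x - fejer N' w x"
    have "(\<integral>x. (?u x)\<^sup>2 \<partial>torus) = (\<integral>x. ((fejer N w x - w x) - (fejer N' w x - w x))\<^sup>2 \<partial>torus)"
      by simp
    also have "\<dots> \<le> 2 * a N + 2 * a N'"
      unfolding a_def by (rule integral_diff_power2_le(2)) (use wN2 w measurable_fejer[OF int(1)] in auto)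
    also have "\<dots> = (sqrt (2 * a N + 2 * a N'))\<^sup>2"
      by (simp add: a_def)
    finally have "(\<integral>x. (?u x)\<^sup>2 \<partial>torus) \<le> (sqrt (2 * a N + 2 * a N'))\<^sup>2" .
    then have "(\<integral>x. (?u (x + (h, 0)) - ?u x)\<^sup>2 \<partial>torus) \<le> (2 * sqrt (2 * a N + 2 * a N'))\<^sup>2"
      using pw by (intro integral_increment_power2_le h continuous_on_diff cw) (auto simp: periodic_def)
    then show ?thesis by (simp add: D_def algebra_simps)
  qed
  have main: "(\<integral>x. (D N x)\<^sup>2 \<partial>torus) \<le> s\<^sup>2 + 48 * (1 + 1 / s\<^sup>2) * (4 * A * B * h + 8 * W * sqrt (2 * a N))" for N
  proof -
    obtain R where R: "\<And>x. \<bar>D N x\<bar> \<le> R"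
    proof
      fix x
      let ?c = "\<lambda>k. of_real (fejer_mult N k) * fcoeff w k"
      have "\<bar>fejer N w x\<bar> \<le> (\<Sum>k\<in>fejer_freqs N. norm (?c k))" for x
      proof -
        have "\<bar>fejer N w x\<bar> = norm (trig_poly (fejer_freqs N) ?c x)"
          by (simp flip: fejer_eq_trig_poly[OF int(1)])
        also have "\<dots> \<le> (\<Sum>k\<in>fejer_freqs N. norm (?c k * torus_char k x))"
          unfolding trig_poly_def by (rule norm_sum)
        finally show ?thesis by (simp add: norm_mult)
      qed
      from this[of x] this[of "x + (h, 0)"]
      show "\<bar>D N x\<bar> \<le> 2 * (\<Sum>k\<in>fejer_freqs N. norm (?c k))"
        unfolding D_def by linarith
    qed
    \<comment> \<open>Two demands of \<open>square_le_growth\<close>: \<open>M\<close> is at least 2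
      and dominates the increment everywhere. The bound \<open>R\<close> sums the moduli of the
      coefficients of the \<open>N\<close>-th mean and hence depends on \<open>N\<close>.\<close>
    define M where "M = max 2 R"
    have M: "M \<ge> 2" "M \<ge> 1" "M > 0" "\<And>x. \<bar>D N x\<bar> \<le> M" using R by (auto simp: M_def le_max_iff_disj)
    have cG: "continuous_on UNIV (\<lambda>x. growth M (D N' x))" for N'
      by (rule continuous_flux(3)[OF M(3) cD])
    \<comment> \<open>The functional at \<open>N\<close> is compared with that at \<open>N'\<close>
      by \<open>growth_diff_le\<close>. Two Cauchy-Schwarz terms arise, each at most
      \<open>2 * W\<close> times \<open>2 * sqrt (2 * a N + 2 * a N')\<close>, which explains
      \<open>8 * W\<close>.\<close>
    have "(\<integral>x. growth M (D N x) \<partial>torus) \<le> h * (4 * A * B + 2 * ln M * \<rho> N') + 8 * W * sqrt (2 * a N + 2 * a N')" for N'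
    proof -
      let ?d = "2 * sqrt (2 * a N + 2 * a N')"
      let ?E = "\<lambda>x. D N x - D N' x"
      have cE: "continuous_on UNIV ?E" by (intro continuous_on_diff cD)
      have mE: "?E \<in> borel_measurable torus" by (intro measurable_torus borel_measurable_continuous_onI cE)
      have d0: "?d \<ge> 0" by (simp add: a_def)
      have CS: "(\<integral>x. \<bar>D n x * ?E x\<bar> \<partial>torus) \<le> (2 * W) * ?d" for n
        using W(1) d0 by (intro abs_integral_mult_le(2) integrable_torus_continuous continuous_on_power cD cE mD mE D2 diff2) auto
      have "(\<integral>x. growth M (D N x) \<partial>torus)
          \<le> (\<integral>x. growth M (D N' x) + (\<bar>D N x * ?E x\<bar> + \<bar>D N' x * ?E x\<bar>) \<partial>torus)"
      proof (rule integral_mono)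
        show "integrable torus (\<lambda>x. growth M (D N x))" by (rule integrable_torus_continuous[OF cG])
        show "integrable torus (\<lambda>x. growth M (D N' x) + (\<bar>D N x * ?E x\<bar> + \<bar>D N' x * ?E x\<bar>))"
          by (intro integrable_torus_continuous continuous_on_add continuous_on_rabs continuous_on_mult cG cD cE)
        show "growth M (D N x) \<le> growth M (D N' x) + (\<bar>D N x * ?E x\<bar> + \<bar>D N' x * ?E x\<bar>)" for x
          using growth_diff_le[OF M(2), of "D N x" "D N' x"]
          unfolding abs_mult distrib_right by linarith
      qed
      also have "\<dots> = (\<integral>x. growth M (D N' x) \<partial>torus) + ((\<integral>x. \<bar>D N x * ?E x\<bar> \<partial>torus) + (\<integral>x. \<bar>D N' x * ?E x\<bar> \<partial>torus))"
      proof -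
        have "integrable torus (\<lambda>x. growth M (D N' x))" by (rule integrable_torus_continuous[OF cG])
        moreover have "integrable torus (\<lambda>x. \<bar>D n x * ?E x\<bar>)" for n
          by (intro integrable_torus_continuous continuous_on_rabs continuous_on_mult cD cE)
        ultimately show ?thesis by (simp add: Bochner_Integration.integral_add Bochner_Integration.integrable_add)
      qed
      also have "\<dots> \<le> h * (4 * A * B + 2 * ln M * \<rho> N') + ((2 * W) * ?d + (2 * W) * ?d)"
        by (intro add_mono growth_le M(2) CS)
      finally show ?thesis by simp
    qed
    moreover have "(\<lambda>N'. h * (4 * A * B + 2 * ln M * \<rho> N') + 8 * W * sqrt (2 * a N + 2 * a N'))
        \<longlonglongrightarrow> h * (4 * A * B + 2 * ln M * 0) + 8 * W * sqrt (2 * a N + 2 * 0)"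
      by (intro tendsto_intros \<rho> a)
    ultimately have gN: "(\<integral>x. growth M (D N x) \<partial>torus) \<le> 4 * A * B * h + 8 * W * sqrt (2 * a N)"
      using LIMSEQ_le_const by (fastforce simp: mult_ac)
    have ig: "integrable torus (\<lambda>x. growth M (D N x))" by (rule integrable_torus_continuous[OF cG])
    have "(\<integral>x. (D N x)\<^sup>2 \<partial>torus) \<le> (\<integral>x. s\<^sup>2 + 48 * (1 + 1 / s\<^sup>2) * growth M (D N x) \<partial>torus)"
      using ig by (intro integral_mono integrable_torus_continuous[of "\<lambda>x. (D N x)\<^sup>2"] continuous_on_power cD
        square_le_growth M s) auto
    also have "\<dots> = s\<^sup>2 + 48 * (1 + 1 / s\<^sup>2) * (\<integral>x. growth M (D N x) \<partial>torus)"
      using ig by (simp add: measure_torus)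
    also have "\<dots> \<le> s\<^sup>2 + 48 * (1 + 1 / s\<^sup>2) * (4 * A * B * h + 8 * W * sqrt (2 * a N))"
      by (intro add_left_mono mult_left_mono gN) auto
    finally show ?thesis .
  qed
  \<comment> \<open>Bessel's inequality comes before the limit in \<open>N\<close>, so that only
    finitely many coefficients have to converge and no translate of the rough \<open>w\<close> is
    formed.\<close>
  have "(\<Sum>k\<in>S. (norm ((torus_char k (h, 0) - 1) * fcoeff (fejer N w) k))\<^sup>2)
      \<le> s\<^sup>2 + 48 * (1 + 1 / s\<^sup>2) * (4 * A * B * h + 8 * W * sqrt (2 * a N))" for N
  proof -
    have "(\<Sum>k\<in>S. (norm (fcoeff (D N) k))\<^sup>2) \<le> (\<integral>x. (D N x)\<^sup>2 \<partial>torus)"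
      by (rule bessel[OF S mD]) (intro integrable_torus_continuous continuous_on_power cD)
    also note main[of N]
    finally show ?thesis unfolding D_def[abs_def] fcoeff_increment[OF int(1)] .
  qed
  moreover have "(\<lambda>N. \<Sum>k\<in>S. (norm ((torus_char k (h, 0) - 1) * fcoeff (fejer N w) k))\<^sup>2)
      \<longlonglongrightarrow> (\<Sum>k\<in>S. (norm ((torus_char k (h, 0) - 1) * fcoeff w k))\<^sup>2)"
    by (intro tendsto_intros fcoeff_fejer_tendsto int)
  moreover have "(\<lambda>N. s\<^sup>2 + 48 * (1 + 1 / s\<^sup>2) * (4 * A * B * h + 8 * W * sqrt (2 * a N)))
      \<longlonglongrightarrow> s\<^sup>2 + 48 * (1 + 1 / s\<^sup>2) * (4 * A * B * h + 8 * W * sqrt (2 * 0))"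
    by (intro tendsto_intros a)
  ultimately have "(\<Sum>k\<in>S. (norm ((torus_char k (h, 0) - 1) * fcoeff w k))\<^sup>2)
      \<le> s\<^sup>2 + 48 * (1 + 1 / s\<^sup>2) * (4 * A * B * h + 8 * W * sqrt (2 * 0))"
    by (intro LIMSEQ_le[of "\<lambda>N. \<Sum>k\<in>S. (norm ((torus_char k (h, 0) - 1) * fcoeff (fejer N w) k))\<^sup>2"]) auto
  then show ?thesis by simp
qed

section \<open>Compactness from Fourier tails\<close>

lemma L2_torusD:
  assumes "f \<in> L2_torus"
  shows "f \<in> borel_measurable torus" "integrable torus (\<lambda>x. (f x)\<^sup>2)" "integrable torus f"
  using assms measurable_torus torus.square_integrable_imp_integrable by (auto simp: L2_torus_def)

lemma diagonal_convergent_subseq: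
  fixes c :: "nat \<Rightarrow> 'a::countable \<Rightarrow> complex"
  assumes "\<And>n k. norm (c n k) \<le> T"
  obtains s where "strict_mono (s :: nat \<Rightarrow> nat)" "\<And>k. convergent (\<lambda>n. c (s n) k)"
proof -
  define P where "P n s = convergent (\<lambda>i. c (s i) (from_nat n))" for n and s :: "nat \<Rightarrow> nat"
  interpret subseqs P
  proof
    fix n and s :: "nat \<Rightarrow> nat" assume "strict_mono s"
    have "bounded (range (\<lambda>i. c (s i) (from_nat n)))"
      using assms by (auto simp: bounded_iff)
    from bounded_imp_convergent_subsequence[OF this]
    obtain l r where "strict_mono r" "((\<lambda>i. c (s i) (from_nat n)) \<circ> r) \<longlonglongrightarrow> l" by blast
    then show "\<exists>r'. strict_mono r' \<and> P n (s \<circ> r')"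
      by (auto simp: P_def o_def convergent_def)
  qed
  \<comment> \<open>The diagonal sequence refines the \<open>n\<close>-th extraction only from index
    \<open>Suc n\<close> on. The shift is removed afterwards, as convergence ignores initial
    segments.\<close>
  have "P n (diagseq \<circ> ((+) (Suc n)))" for n
  proof (rule diagseq_holds)
    fix r s n assume "strict_mono (r :: nat \<Rightarrow> nat)" "P n s"
    then show "P n (s \<circ> r)"
      using LIMSEQ_subseq_LIMSEQ[of "\<lambda>i. c (s i) (from_nat n)" _ r]
      by (auto simp: P_def o_def convergent_def)
  qed
  then have "convergent (\<lambda>i. c (diagseq (Suc n + i)) (from_nat n))" for n
    unfolding P_def o_def .
  then have "convergent (\<lambda>i. c (diagseq (i + Suc n)) (from_nat n))" for n
    by (subst add.commute)
  then have "convergent (\<lambda>i. c (diagseq i) (from_nat n))" for n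
    using convergent_ignore_initial_segment[of "\<lambda>i. c (diagseq i) (from_nat n)" "Suc n"] by simp
  then have "convergent (\<lambda>i. c (diagseq i) k)" for k
    by (metis from_nat_to_nat)
  then show ?thesis using that subseq_diagseq by blast
qed

text \<open>On a finite measure space an L^2 Cauchy sequence is Cauchy in L^1 and so has an almost
  everywhere convergent subsequence. Fatou's lemma along it bounds the L^2 distance of every late
  \<open>x i\<close> to the limit.\<close>

lemma L2_complete:
  assumes x: "\<And>i. x i \<in> L2_torus"
    and cau: "\<And>e. e > 0 \<Longrightarrow> \<exists>N. \<forall>i\<ge>N. \<forall>j\<ge>N. (\<integral>y. (x i y - x j y)\<^sup>2 \<partial>torus) \<le> e"
  obtains t f where "strict_mono (t :: nat \<Rightarrow> nat)" "f \<in> L2_torus"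
    "(\<lambda>i. L2_norm (\<lambda>y. x (t i) y - f y)) \<longlonglongrightarrow> 0"
proof -
  note x2 = L2_torusD[OF x]
  have d2: "integrable torus (\<lambda>y. (x i y - x j y)\<^sup>2)" for i j
    by (rule integral_diff_power2_le(1)) (use x2 in auto)
  have "\<exists>N. \<forall>i\<ge>N. \<forall>j\<ge>N. (LINT y|torus. norm (x i y - x j y)) < e" if e: "e > 0" for e
  proof -
    obtain N where N: "\<And>i j. i \<ge> N \<Longrightarrow> j \<ge> N \<Longrightarrow> (\<integral>y. (x i y - x j y)\<^sup>2 \<partial>torus) \<le> (e / 2)\<^sup>2"
      using cau[of "(e / 2)\<^sup>2"] e by auto
    have "(LINT y|torus. norm (x i y - x j y)) < e" if "i \<ge> N" "j \<ge> N" for i j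
    proof -
      have "(\<integral>y. \<bar>(x i y - x j y) * 1\<bar> \<partial>torus) \<le> (e / 2) * 1"
        by (rule abs_integral_mult_le(2)[OF d2 _ _ _ N[OF that]])
           (use x2 e in \<open>auto simp: measure_torus\<close>)
      then show ?thesis using e by simp
    qed
    then show ?thesis by blast
  qed
  from cauchy_L1_AE_cauchy_subseq[OF x2(3) this] obtain t where
    t: "strict_mono t" "AE y in torus. Cauchy (\<lambda>i. x (t i) y)" by blast
  \<comment> \<open>The limit is taken by \<open>lim\<close> at every point, also where the sequence
    diverges. Thus \<open>f\<close> is Borel on the whole plane and exactly periodic: the sequences
    at a point and at its translates coincide.\<close>
  define f where "f y = lim (\<lambda>i. x (t i) y)" for y
  have fb: "f \<in> borel_measurable borel"
    unfolding f_def using x by (intro borel_measurable_lim_metric) (auto simp: L2_torus_def)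
  then have fm: "f \<in> borel_measurable torus" by (rule measurable_torus)
  have per: "periodic f"
    using x unfolding f_def periodic_def L2_torus_def by simp
  have lim: "AE y in torus. (\<lambda>j. x (t j) y) \<longlonglongrightarrow> f y"
    using t(2) by eventually_elim (simp add: f_def Cauchy_convergent_iff convergent_LIMSEQ_iff)
  have fatou: "(\<integral>\<^sup>+ y. ennreal ((x i y - f y)\<^sup>2) \<partial>torus) \<le> ennreal e"
    if N: "\<And>i j. i \<ge> N \<Longrightarrow> j \<ge> N \<Longrightarrow> (\<integral>y. (x i y - x j y)\<^sup>2 \<partial>torus) \<le> e" and i: "i \<ge> N" for i N e
  proof -
    have "(\<integral>\<^sup>+ y. ennreal ((x i y - f y)\<^sup>2) \<partial>torus)
        = (\<integral>\<^sup>+ y. liminf (\<lambda>j. ennreal ((x i y - x (t j) y)\<^sup>2)) \<partial>torus)"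
    proof (rule nn_integral_cong_AE)
      show "AE y in torus. ennreal ((x i y - f y)\<^sup>2) = liminf (\<lambda>j. ennreal ((x i y - x (t j) y)\<^sup>2))"
        using lim
      proof eventually_elim
        case (elim y)
        then have "(\<lambda>j. ennreal ((x i y - x (t j) y)\<^sup>2)) \<longlonglongrightarrow> ennreal ((x i y - f y)\<^sup>2)"
          by (intro tendsto_intros)
        then show ?case by (rule lim_imp_Liminf[OF sequentially_bot, symmetric])
      qed
    qed
    also have "\<dots> \<le> liminf (\<lambda>j. \<integral>\<^sup>+ y. ennreal ((x i y - x (t j) y)\<^sup>2) \<partial>torus)"
      using x2(1) by (intro nn_integral_liminf) measurable
    also have "\<dots> \<le> ennreal e"
    proof (rule Liminf_le)
      have "(\<integral>\<^sup>+ y. ennreal ((x i y - x (t j) y)\<^sup>2) \<partial>torus) \<le> ennreal e" if "j \<ge> N" for j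
      proof -
        have "t j \<ge> N" using that seq_suble[OF t(1), of j] by simp
        then show ?thesis
          using N[OF i] by (subst nn_integral_eq_integral[OF d2]) (auto intro: ennreal_leI)
      qed
      then show "\<forall>\<^sub>F j in sequentially. (\<integral>\<^sup>+ y. ennreal ((x i y - x (t j) y)\<^sup>2) \<partial>torus) \<le> ennreal e"
        by (auto simp: eventually_sequentially)
    qed simp
    finally show ?thesis .
  qed
  have xf: "integrable torus (\<lambda>y. (x i y - f y)\<^sup>2)" "(\<integral>y. (x i y - f y)\<^sup>2 \<partial>torus) \<le> e"
    if N: "\<And>i j. i \<ge> N \<Longrightarrow> j \<ge> N \<Longrightarrow> (\<integral>y. (x i y - x j y)\<^sup>2 \<partial>torus) \<le> e" and i: "i \<ge> N" for i N e
  proof -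
    have F: "(\<integral>\<^sup>+ y. ennreal ((x i y - f y)\<^sup>2) \<partial>torus) \<le> ennreal e"
      by (rule fatou[of N e i]) (use N i in auto)
    have e: "0 \<le> e" using N[OF i i] by simp
    show int: "integrable torus (\<lambda>y. (x i y - f y)\<^sup>2)"
    proof (rule integrableI_bounded)
      show "(\<integral>\<^sup>+ y. ennreal (norm ((x i y - f y)\<^sup>2)) \<partial>torus) < \<infinity>"
        using le_less_trans[OF F ennreal_less_top] by simp
    qed (use x2 fm in measurable)
    show "(\<integral>y. (x i y - f y)\<^sup>2 \<partial>torus) \<le> e"
      using F e nn_integral_eq_integral[OF int] by (simp add: ennreal_le_iff)
  qed
  have "integrable torus (\<lambda>y. (f y)\<^sup>2)"
  proof -
    obtain N where "\<And>i j. i \<ge> N \<Longrightarrow> j \<ge> N \<Longrightarrow> (\<integral>y. (x i y - x j y)\<^sup>2 \<partial>torus) \<le> 1"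
      using cau[of 1] by auto
    from xf(1)[OF this order_refl] have "integrable torus (\<lambda>y. (x N y - f y)\<^sup>2)" by blast
    from integral_diff_power2_le(1)[OF x2(2)[of N] this x2(1)[of N]] x2(1)[of N] fm
    show ?thesis by simp
  qed
  then have f: "f \<in> L2_torus" using fb per by (simp add: L2_torus_def)
  have "(\<lambda>i. L2_norm (\<lambda>y. x i y - f y)) \<longlonglongrightarrow> 0"
  proof (rule LIMSEQ_I)
    fix e :: real assume e: "e > 0"
    obtain N where N: "\<And>i j. i \<ge> N \<Longrightarrow> j \<ge> N \<Longrightarrow> (\<integral>y. (x i y - x j y)\<^sup>2 \<partial>torus) \<le> (e / 2)\<^sup>2"
      using cau[of "(e / 2)\<^sup>2"] e by auto
    have "norm (L2_norm (\<lambda>y. x i y - f y) - 0) < e" if "i \<ge> N" for i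
    proof -
      have "L2_norm (\<lambda>y. x i y - f y) \<le> e / 2"
        unfolding L2_norm_def using xf(2)[OF N that] e by (intro real_le_lsqrt) auto
      moreover have "0 \<le> L2_norm (\<lambda>y. x i y - f y)" by (simp add: L2_norm_def)
      ultimately show ?thesis using e by simp
    qed
    then show "\<exists>no. \<forall>i\<ge>no. norm (L2_norm (\<lambda>y. x i y - f y) - 0) < e" by blast
  qed
  from LIMSEQ_subseq_LIMSEQ[OF this t(1)] show ?thesis
    using that[OF t(1) f] by (simp add: o_def)
qed

text \<open>Along a diagonal subsequence all coefficients converge. They are uniformly Cauchy on the
  finite set \<open>K\<close> and uniformly small off it, so \<open>parseval_le\<close> makes the
  subsequence Cauchy in L^2.\<close>

theorem precompact_L2_fourier:
  assumes w: "\<And>n. w n \<in> L2_torus"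
    and bd: "\<And>n k. norm (fcoeff (w n) k) \<le> T"
    and tail: "\<And>e. e > 0 \<Longrightarrow> \<exists>K. finite K \<and> (\<forall>n S. finite S \<and> S \<inter> K = {} \<longrightarrow> (\<Sum>k\<in>S. (norm (fcoeff (w n) k))\<^sup>2) \<le> e)"
  shows "precompact_L2 w"
  unfolding precompact_L2_def
proof (intro allI impI)
  fix r :: "nat \<Rightarrow> nat" assume "strict_mono r"
  obtain s where s: "strict_mono s" "\<And>k. convergent (\<lambda>n. fcoeff (w (r (s n))) k)"
    using diagonal_convergent_subseq[of "\<lambda>n. fcoeff (w (r n))" T] bd by blast
  define x where "x n = w (r (s n))" for n
  have x: "x n \<in> L2_torus" for n by (simp add: x_def w)
  note x2 = L2_torusD[OF x]
  have "\<exists>N. \<forall>i\<ge>N. \<forall>j\<ge>N. (\<integral>y. (x i y - x j y)\<^sup>2 \<partial>torus) \<le> e" if e: "e > 0" for e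
  proof -
    obtain K where K: "finite K" "\<And>n S. finite S \<Longrightarrow> S \<inter> K = {} \<Longrightarrow> (\<Sum>k\<in>S. (norm (fcoeff (x n) k))\<^sup>2) \<le> e / 8"
      using tail[of "e / 8"] e unfolding x_def by auto
    \<comment> \<open>The frequencies in \<open>K\<close> contribute at most
      \<open>card K * d\<^sup>2 \<le> e / 2\<close>, the tails of the two terms
      \<open>4 * (e / 8)\<close>. The added 1 covers an empty \<open>K\<close>.\<close>
    define d where "d = sqrt (e / (2 * (card K + 1)))"
    have d: "d > 0" "card K * d\<^sup>2 \<le> e / 2"
      using e by (auto simp: d_def field_simps)
    have "\<forall>k. \<exists>N. \<forall>i\<ge>N. \<forall>j\<ge>N. norm (fcoeff (x i) k - fcoeff (x j) k) < d"
      using s(2) d(1) unfolding x_def Cauchy_convergent_iff[symmetric] Cauchy_def dist_norm by blast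
    then obtain N where N: "\<And>k i j. i \<ge> N k \<Longrightarrow> j \<ge> N k \<Longrightarrow> norm (fcoeff (x i) k - fcoeff (x j) k) < d"
      by metis
    define N0 where "N0 = Max (insert 0 (N ` K))"
    have N0: "N k \<le> N0" if "k \<in> K" for k
      using that K(1) by (auto simp: N0_def)
    have "(\<integral>y. (x i y - x j y)\<^sup>2 \<partial>torus) \<le> e" if ij: "i \<ge> N0" "j \<ge> N0" for i j
    proof (rule parseval_le)
      show "(\<lambda>y. x i y - x j y) \<in> borel_measurable torus" using x2(1) by measurable
      show "integrable torus (\<lambda>y. (x i y - x j y)\<^sup>2)"
        by (rule integral_diff_power2_le(1)) (use x2 in auto)
      fix S :: "(int \<times> int) set" assume S: "finite S"
      have "(\<Sum>k\<in>S. (norm (fcoeff (\<lambda>y. x i y - x j y) k))\<^sup>2)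
          = (\<Sum>k\<in>S \<inter> K. (norm (fcoeff (x i) k - fcoeff (x j) k))\<^sup>2) + (\<Sum>k\<in>S - K. (norm (fcoeff (x i) k - fcoeff (x j) k))\<^sup>2)"
        using S by (simp add: fcoeff_diff[OF x2(3) x2(3)] sum.Int_Diff)
      also have "(\<Sum>k\<in>S \<inter> K. (norm (fcoeff (x i) k - fcoeff (x j) k))\<^sup>2) \<le> (\<Sum>k\<in>S \<inter> K. d\<^sup>2)"
      proof (intro sum_mono power_mono)
        fix k assume "k \<in> S \<inter> K"
        then have "N k \<le> i" "N k \<le> j" using N0[of k] ij by auto
        then show "norm (fcoeff (x i) k - fcoeff (x j) k) \<le> d" using N less_imp_le by blast
      qed simp
      also have "\<dots> \<le> card K * d\<^sup>2"
        using K(1) by (simp add: card_mono mult_right_mono)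
      also have "(\<Sum>k\<in>S - K. (norm (fcoeff (x i) k - fcoeff (x j) k))\<^sup>2)
          \<le> (\<Sum>k\<in>S - K. 2 * (norm (fcoeff (x i) k))\<^sup>2 + 2 * (norm (fcoeff (x j) k))\<^sup>2)"
      proof (rule sum_mono)
        fix k
        have "(norm (fcoeff (x i) k - fcoeff (x j) k))\<^sup>2 \<le> (norm (fcoeff (x i) k) + norm (fcoeff (x j) k))\<^sup>2"
          by (intro power_mono norm_triangle_ineq4) simp
        also have "\<dots> \<le> 2 * (norm (fcoeff (x i) k))\<^sup>2 + 2 * (norm (fcoeff (x j) k))\<^sup>2"
          using sum_squares_bound[of "norm (fcoeff (x i) k)" "norm (fcoeff (x j) k)"] by (simp add: power2_sum)
        finally show "(norm (fcoeff (x i) k - fcoeff (x j) k))\<^sup>2 \<le> 2 * (norm (fcoeff (x i) k))\<^sup>2 + 2 * (norm (fcoeff (x j) k))\<^sup>2" .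
      qed
      also have "\<dots> = 2 * (\<Sum>k\<in>S - K. (norm (fcoeff (x i) k))\<^sup>2) + 2 * (\<Sum>k\<in>S - K. (norm (fcoeff (x j) k))\<^sup>2)"
        by (simp add: sum.distrib sum_distrib_left)
      also have "\<dots> \<le> 2 * (e / 8) + 2 * (e / 8)"
        using S by (intro add_mono mult_left_mono K(2)) auto
      finally show "(\<Sum>k\<in>S. (norm (fcoeff (\<lambda>y. x i y - x j y) k))\<^sup>2) \<le> e"
        using d(2) by simp
    qed
    then show ?thesis by blast
  qed
  from L2_complete[OF x this] obtain t f where
    t: "strict_mono t" "f \<in> L2_torus" "(\<lambda>i. L2_norm (\<lambda>y. x (t i) y - f y)) \<longlonglongrightarrow> 0" by blast
  then show "\<exists>s f. strict_mono s \<and> f \<in> L2_torus \<and> (\<lambda>n. L2_norm (\<lambda>x. w (r (s n)) x - f x)) \<longlonglongrightarrow> 0"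
    using strict_mono_o[OF s(1) t(1)] by (intro exI[of _ "s \<circ> t"] exI[of _ f]) (simp add: x_def)
qed

section \<open>Fourier coefficients of the distributions\<close>

lemma fourier_char_eq_torus_char: "fourier_char (2 * pi * of_int a, 2 * pi * of_int b) = torus_char (a, b)"
  by (rule ext) (simp add: fourier_char_def torus_char_def inner_prod_def algebra_simps)

lemma fourier_coeff_eq: "fourier_coeff T (2 * pi * of_int a, 2 * pi * of_int b) = T (torus_char (- (a, b)))"
  using fourier_char_eq_torus_char[of "- a" "- b"] by (simp add: fourier_coeff_def)

lemma torus_char_has_derivative:
  "((\<lambda>x. c * torus_char k x) has_derivative
     (\<lambda>v. c * (2 * pi * \<i> * (of_int (fst k) * of_real (fst v) + of_int (snd k) * of_real (snd v)) * torus_char k x))) (at x)"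
proof -
  let ?L = "\<lambda>x :: real \<times> real. 2 * pi * \<i> * (of_int (fst k) * of_real (fst x) + of_int (snd k) * of_real (snd x))"
  have "(?L has_derivative ?L) (at x)"
    by (auto intro!: derivative_eq_intros)
  moreover have "(exp has_derivative (*) (exp (?L x))) (at (?L x))"
    using DERIV_exp[of "?L x"] by (simp add: has_field_derivative_def)
  ultimately have "((\<lambda>x. exp (?L x)) has_derivative (\<lambda>v. exp (?L x) * ?L v)) (at x)"
    by (rule has_derivative_compose)
  then have "((\<lambda>x. c * exp (?L x)) has_derivative (\<lambda>v. c * (exp (?L x) * ?L v))) (at x)"
    by (rule has_derivative_mult_right)
  moreover have "exp (?L x) = torus_char k x" for x
    by (simp add: torus_char_def cis_conv_exp algebra_simps)
  ultimately show ?thesis by (simp add: mult.commute)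
qed

lemma partial_torus_char:
  "partial1 (\<lambda>x. c * torus_char k x) = (\<lambda>x. (c * (2 * pi * \<i> * of_int (fst k))) * torus_char k x)"
  "partial2 (\<lambda>x. c * torus_char k x) = (\<lambda>x. (c * (2 * pi * \<i> * of_int (snd k))) * torus_char k x)"
  unfolding partial1_def[abs_def] partial2_def[abs_def] frechet_derivative_at[OF torus_char_has_derivative, symmetric]
  by (simp_all add: mult_ac)

lemma partial_torus_char':
  "partial1 (torus_char k) = (\<lambda>x. (2 * pi * \<i> * of_int (fst k)) * torus_char k x)"
  "partial2 (torus_char k) = (\<lambda>x. (2 * pi * \<i> * of_int (snd k)) * torus_char k x)"
  using partial_torus_char[of 1 k] by simp_all

text \<open>All iterated partial derivatives of a character are scalar multiples of it. This is the
  invariant of the induction and the reason for the factor \<open>c\<close> in the derivative rules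
  above.\<close>

lemma torus_char_test_function: "torus_char k \<in> test_functions"
proof -
  have form: "\<exists>c. \<psi> = (\<lambda>x. c * torus_char k x)" if "\<psi> \<in> iterated_partials (torus_char k)" for \<psi>
    using that
  proof induction
    case base
    show ?case by (intro exI[of _ 1]) simp
  qed (use partial_torus_char in blast)+
  have "\<psi> differentiable_on UNIV" if "\<psi> \<in> iterated_partials (torus_char k)" for \<psi>
  proof -
    from that obtain c where "\<psi> = (\<lambda>x. c * torus_char k x)" using form by blast
    then show ?thesis
      using torus_char_has_derivative[of c k] has_derivative_at_withinI
      unfolding differentiable_on_def differentiable_def by blast
  qed
  then show ?thesis by (simp add: test_functions_def periodic_torus_char)
qed

lemma of_fun_torus_char: "of_fun f (\<lambda>x. c * torus_char (- k) x) = c * fcoeff f k"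
proof -
  have "of_fun f (\<lambda>x. c * torus_char (- k) x) = (\<integral>x. c * (of_real (f x) * cnj (torus_char k x)) \<partial>torus)"
    unfolding of_fun_def cnj_torus_char by (intro Bochner_Integration.integral_cong refl) (rule mult.left_commute)
  then show ?thesis by (simp only: integral_mult_right_zero fcoeff_def)
qed

lemma represents_torus_char:
  assumes "represents g T"
  shows "T (torus_char (- k)) = fcoeff g k"
  using assms torus_char_test_function[of "- k"] of_fun_torus_char[of g 1 k] by (simp add: represents_def)

lemma dist_partial1_torus_char:
  "dist_partial1 (of_fun f) (torus_char (- k)) = 2 * pi * \<i> * of_int (fst k) * fcoeff f k"
  unfolding dist_partial1_def partial_torus_char' of_fun_torus_char by simp

lemma eta_torus_char:
  "eta w (torus_char (- k)) = 2 * pi * \<i> * of_int (snd k) * fcoeff w k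
     - 2 * pi * \<i> * of_int (fst k) * fcoeff (\<lambda>x. 1 / 2 * (w x)\<^sup>2) k"
  unfolding eta_def dist_partial1_def dist_partial2_def partial_torus_char' of_fun_torus_char by simp

text \<open>Against a single character, orthogonality leaves one nonzero term of the defining
  series, so the infinite sum collapses and no summability of the coefficients of \<open>T\<close>
  comes into play.\<close>

lemma inv_abs_partial1_torus_char:
  assumes "fst k \<noteq> 0"
  shows "of_real (2 * pi * of_int \<bar>fst k\<bar>) * inv_abs_partial1 T (torus_char (- k)) = T (torus_char (- k))"
proof -
  obtain a b where k: "k = (a, b)" by (cases k)
  let ?\<kappa> = "(2 * pi * of_int a, 2 * pi * of_int b)"
  let ?f = "\<lambda>\<kappa>. of_real (1 / \<bar>fst \<kappa>\<bar>) * fourier_coeff T \<kappa> * (\<integral>x. fourier_char \<kappa> x * torus_char (- k) x \<partial>torus)"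
  have zero: "?f \<kappa> = 0" if \<kappa>: "\<kappa> \<in> freqs" "\<kappa> \<noteq> ?\<kappa>" for \<kappa>
  proof -
    obtain c d where cd: "\<kappa> = (2 * pi * of_int c, 2 * pi * of_int d)"
      using \<kappa>(1) by (auto simp: freqs_def)
    then have "(c, d) + (- k) \<noteq> 0" using \<kappa>(2) k by (auto simp: zero_prod_def)
    then have "(\<integral>x. torus_char (c, d) x * torus_char (- k) x \<partial>torus) = 0"
      unfolding torus_char_add[symmetric] integral_torus_char by simp
    then show ?thesis unfolding cd fourier_char_eq_torus_char by simp
  qed
  have "inv_abs_partial1 T (torus_char (- k)) = infsum ?f {?\<kappa>}"
    unfolding inv_abs_partial1_def
    by (rule infsum_cong_neutral) (use assms k zero in \<open>auto simp: freqs_def\<close>)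
  also have "\<dots> = of_real (1 / \<bar>2 * pi * of_int a\<bar>) * T (torus_char (- k)) * (\<integral>x. torus_char k x * torus_char (- k) x \<partial>torus)"
    by (simp add: fourier_coeff_eq fourier_char_eq_torus_char k del: minus_prod_def uminus_Pair)
  also have "(\<integral>x. torus_char k x * torus_char (- k) x \<partial>torus) = 1"
    unfolding torus_char_add[symmetric] integral_torus_char by simp
  finally show ?thesis
    using assms by (simp add: k abs_mult)
qed

lemma fcoeff_vanishing_mean1:
  assumes "vanishing_mean1 (of_fun w)" "fst k = 0"
  shows "fcoeff w k = 0"
proof -
  obtain b where k: "k = (0, b)" using assms(2) by (cases k) auto
  have "(2 * pi * of_int 0, 2 * pi * of_int b) \<in> freqs"
    unfolding freqs_def by blast
  then have "fourier_coeff (of_fun w) (2 * pi * of_int 0, 2 * pi * of_int b) = 0"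
    using assms(1) by (auto simp: vanishing_mean1_def)
  then show ?thesis
    unfolding fourier_coeff_eq using of_fun_torus_char[of w 1 k] k by simp
qed

section \<open>From the energy bound to Fourier coefficients\<close>

lemma square_integral_finite:
  assumes "square_integral T < \<infinity>"
  obtains g where "represents g T" "square_integral T = ennreal (\<integral>x. (g x)\<^sup>2 \<partial>torus)"
proof -
  have ex: "\<exists>g. represents g T"
    using assms by (auto simp: square_integral_def split: if_splits)
  define g where "g = (SOME g. represents g T)"
  have g: "represents g T" unfolding g_def using ex by (rule someI_ex)
  then have "integrable torus (\<lambda>x. (g x)\<^sup>2)" by (simp add: represents_def L2_torus_def)
  from nn_integral_eq_integral[OF this]
  have "square_integral T = ennreal (\<integral>x. (g x)\<^sup>2 \<partial>torus)"
    using ex by (simp add: square_integral_def g_def)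
  with g show ?thesis by (rule that)
qed

text \<open>Both coefficients in the energy are positive, so an infinite integral would make it
  infinite. Positivity matters, since a zero coefficient times infinity is 0 in
  \<open>ennreal\<close>.\<close>

lemma energy_eps_representatives:
  assumes \<epsilon>: "\<epsilon> > 0" and C: "energy_eps \<epsilon> w \<le> ennreal c" "c \<ge> 0"
  obtains q v where "represents q (inv_abs_partial1 (eta w))" "represents v (dist_partial1 (of_fun w))"
    "(\<integral>x. (q x)\<^sup>2 \<partial>torus) / \<epsilon> + \<epsilon> * (\<integral>x. (v x)\<^sup>2 \<partial>torus) \<le> 2 * c"
proof -
  let ?I = "square_integral (inv_abs_partial1 (eta w))" and ?J = "square_integral (dist_partial1 (of_fun w))"
  have fin: "ennreal (1 / 2) * (ennreal (1 / \<epsilon>) * ?I + ennreal \<epsilon> * ?J) < \<infinity>"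
    using C(1) unfolding energy_eps_def by (rule le_less_trans) simp
  have "?I < \<infinity>"
    using fin \<epsilon> by (auto simp: ennreal_mult_less_top less_top[symmetric] ennreal_mult_eq_top_iff)
  moreover have "?J < \<infinity>"
    using fin \<epsilon> by (auto simp: ennreal_mult_less_top less_top[symmetric] ennreal_mult_eq_top_iff)
  ultimately obtain q v where
    q: "represents q (inv_abs_partial1 (eta w))" "?I = ennreal (\<integral>x. (q x)\<^sup>2 \<partial>torus)" and
    v: "represents v (dist_partial1 (of_fun w))" "?J = ennreal (\<integral>x. (v x)\<^sup>2 \<partial>torus)"
    by (metis square_integral_finite)
  let ?i = "\<integral>x. (q x)\<^sup>2 \<partial>torus" and ?j = "\<integral>x. (v x)\<^sup>2 \<partial>torus"
  have "ennreal (1 / 2 * (1 / \<epsilon> * ?i + \<epsilon> * ?j)) = energy_eps \<epsilon> w"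
  proof -
    have "0 \<le> 1 / \<epsilon> * ?i" "0 \<le> \<epsilon> * ?j" using \<epsilon> by auto
    then have "ennreal (1 / 2 * (1 / \<epsilon> * ?i + \<epsilon> * ?j)) = ennreal (1 / 2) * (ennreal (1 / \<epsilon> * ?i) + ennreal (\<epsilon> * ?j))"
      by (subst ennreal_mult) auto
    then show ?thesis
      unfolding energy_eps_def q(2) v(2) using \<epsilon> by (simp only: ennreal_mult' less_imp_le zero_le_divide_1_iff)
  qed
  then have "ennreal (1 / 2 * (1 / \<epsilon> * ?i + \<epsilon> * ?j)) \<le> ennreal c"
    using C(1) by simp
  then have "1 / 2 * (1 / \<epsilon> * ?i + \<epsilon> * ?j) \<le> c"
    using C(2) by (simp only: ennreal_le_iff)
  then have "?i / \<epsilon> + \<epsilon> * ?j \<le> 2 * c" by simp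
  with q(1) v(1) show ?thesis by (rule that)
qed

text \<open>For the increments only \<open>A * B \<le> c\<close> is required; it follows from
  \<open>2 * a * b \<le> a\<^sup>2 + b\<^sup>2\<close> for \<open>A / sqrt \<epsilon>\<close> and
  \<open>sqrt \<epsilon> * B\<close>, where \<epsilon> cancels. The last estimate reads the equation
  at one frequency: the quadratic term is bounded by the L^1 norm of w^2 / 2, the other by
  \<open>A\<close>, and there \<epsilon> is replaced by its upper bound.\<close>

lemma admissible_fourier:
  assumes w: "w \<in> admissible" and \<epsilon>: "\<epsilon> > 0" "\<epsilon> \<le> \<epsilon>\<^sub>0" and C: "energy_eps \<epsilon> w \<le> ennreal c" "c \<ge> 0"
  shows "fst k = 0 \<Longrightarrow> fcoeff w k = 0"
    and "\<lbrakk>finite S; 0 \<le> h; h \<le> 1; s > 0\<rbrakk> \<Longrightarrow>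
      (\<Sum>k\<in>S. (norm ((torus_char k (h, 0) - 1) * fcoeff w k))\<^sup>2) \<le> s\<^sup>2 + 48 * (1 + 1 / s\<^sup>2) * (4 * c * h)"
    and "of_int \<bar>snd k\<bar> * norm (fcoeff w k) \<le> of_int \<bar>fst k\<bar> * ((\<integral>x. (w x)\<^sup>2 \<partial>torus) / 2 + sqrt (2 * c * \<epsilon>\<^sub>0))"
proof -
  have wL: "w \<in> L2_torus" and mean: "vanishing_mean1 (of_fun w)"
    using w by (auto simp: admissible_def)
  show 0: "fst k = 0 \<Longrightarrow> fcoeff w k = 0" for k
    by (rule fcoeff_vanishing_mean1[OF mean])
  obtain q v where q: "represents q (inv_abs_partial1 (eta w))" and v: "represents v (dist_partial1 (of_fun w))"
    and qv: "(\<integral>x. (q x)\<^sup>2 \<partial>torus) / \<epsilon> + \<epsilon> * (\<integral>x. (v x)\<^sup>2 \<partial>torus) \<le> 2 * c"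
    using energy_eps_representatives[OF \<epsilon>(1) C] .
  have qL: "q \<in> L2_torus" and vL: "v \<in> L2_torus" using q v by (auto simp: represents_def)
  note L = L2_torusD[OF wL] L2_torusD[OF qL] L2_torusD[OF vL]
  define A where "A = sqrt (\<integral>x. (q x)\<^sup>2 \<partial>torus)"
  define B where "B = sqrt (\<integral>x. (v x)\<^sup>2 \<partial>torus)"
  have A: "A \<ge> 0" "A\<^sup>2 = (\<integral>x. (q x)\<^sup>2 \<partial>torus)" and B: "B \<ge> 0" "B\<^sup>2 = (\<integral>x. (v x)\<^sup>2 \<partial>torus)"
    by (simp_all add: A_def B_def)
  have AB: "A * B \<le> c"
  proof -
    let ?e = "sqrt \<epsilon>"
    have "2 * (A / ?e) * (?e * B) \<le> (A / ?e)\<^sup>2 + (?e * B)\<^sup>2"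
      by (rule sum_squares_bound)
    also have "\<dots> = (\<integral>x. (q x)\<^sup>2 \<partial>torus) / \<epsilon> + \<epsilon> * (\<integral>x. (v x)\<^sup>2 \<partial>torus)"
      using \<epsilon> A B by (simp add: power_divide power_mult_distrib)
    also have "2 * (A / ?e) * (?e * B) = 2 * (A * B)" using \<epsilon> by simp
    finally show ?thesis using qv by simp
  qed
  have A2: "A\<^sup>2 \<le> 2 * c * \<epsilon>\<^sub>0"
  proof -
    have "0 \<le> \<epsilon> * (\<integral>x. (v x)\<^sup>2 \<partial>torus)" using \<epsilon> by simp
    then have "A\<^sup>2 / \<epsilon> \<le> 2 * c" using qv unfolding A(2) by linarith
    then have "A\<^sup>2 \<le> 2 * c * \<epsilon>" using \<epsilon> by (simp add: pos_divide_le_eq)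
    also have "\<dots> \<le> 2 * c * \<epsilon>\<^sub>0" using \<epsilon> C(2) by (intro mult_left_mono) auto
    finally show ?thesis .
  qed
  have vw: "fcoeff v k = 2 * pi * \<i> * of_int (fst k) * fcoeff w k" for k
    using represents_torus_char[OF v, of k] unfolding dist_partial1_torus_char by simp
  have qw: "2 * pi * of_int \<bar>fst k\<bar> * fcoeff q k
      = 2 * pi * \<i> * of_int (snd k) * fcoeff w k - 2 * pi * \<i> * of_int (fst k) * fcoeff (\<lambda>x. 1 / 2 * (w x)\<^sup>2) k" for k
  \<comment> \<open>The distribution |d_1|^-1 eta_w carries no information at k_1 = 0. There the
    equation holds because the vanishing mean makes the coefficient of \<open>w\<close>
    zero.\<close>
  proof (cases "fst k = 0")
    case True
    then show ?thesis by (simp add: 0)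
  next
    case False
    show ?thesis
      using inv_abs_partial1_torus_char[OF False, of "eta w"] eta_torus_char[of w k]
      unfolding represents_torus_char[OF q] by simp
  qed
  show "(\<Sum>k\<in>S. (norm ((torus_char k (h, 0) - 1) * fcoeff w k))\<^sup>2) \<le> s\<^sup>2 + 48 * (1 + 1 / s\<^sup>2) * (4 * c * h)"
    if "finite S" "0 \<le> h" "h \<le> 1" "s > 0"
  proof -
    have "(\<Sum>k\<in>S. (norm ((torus_char k (h, 0) - 1) * fcoeff w k))\<^sup>2) \<le> s\<^sup>2 + 48 * (1 + 1 / s\<^sup>2) * (4 * A * B * h)"
      by (rule increment_coeff_bound[OF L(1,2) L(7,8) L(4,5) vw qw A(1) B(1)])
         (use that A B in auto)
    also have "\<dots> \<le> s\<^sup>2 + 48 * (1 + 1 / s\<^sup>2) * (4 * c * h)"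
      using AB that by (intro add_left_mono mult_left_mono mult_right_mono) auto
    finally show ?thesis .
  qed
  have "norm (2 * pi * \<i> * of_int (snd k) * fcoeff w k)
      = norm (2 * pi * of_int \<bar>fst k\<bar> * fcoeff q k + 2 * pi * \<i> * of_int (fst k) * fcoeff (\<lambda>x. 1 / 2 * (w x)\<^sup>2) k)"
    unfolding qw by simp
  also have "\<dots> \<le> norm (2 * pi * of_int \<bar>fst k\<bar> * fcoeff q k) + norm (2 * pi * \<i> * of_int (fst k) * fcoeff (\<lambda>x. 1 / 2 * (w x)\<^sup>2) k)"
    by (rule norm_triangle_ineq)
  finally have "2 * pi * (of_int \<bar>snd k\<bar> * norm (fcoeff w k))
      \<le> 2 * pi * (of_int \<bar>fst k\<bar> * norm (fcoeff q k) + of_int \<bar>fst k\<bar> * norm (fcoeff (\<lambda>x. 1 / 2 * (w x)\<^sup>2) k))"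
    by (simp add: norm_mult distrib_left mult.assoc)
  then have "of_int \<bar>snd k\<bar> * norm (fcoeff w k)
      \<le> of_int \<bar>fst k\<bar> * norm (fcoeff q k) + of_int \<bar>fst k\<bar> * norm (fcoeff (\<lambda>x. 1 / 2 * (w x)\<^sup>2) k)"
    by (rule mult_left_le_imp_le) simp
  also have "\<dots> = of_int \<bar>fst k\<bar> * (norm (fcoeff (\<lambda>x. 1 / 2 * (w x)\<^sup>2) k) + norm (fcoeff q k))"
    by (simp add: distrib_left)
  also have "\<dots> \<le> of_int \<bar>fst k\<bar> * ((\<integral>x. (w x)\<^sup>2 \<partial>torus) / 2 + sqrt (2 * c * \<epsilon>\<^sub>0))"
  proof (intro mult_left_mono add_mono)
    have "norm (fcoeff (\<lambda>x. 1 / 2 * (w x)\<^sup>2) k) \<le> (\<integral>x. \<bar>1 / 2 * (w x)\<^sup>2\<bar> \<partial>torus)"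
      using L(2) by (intro norm_fc_le) simp
    then show "norm (fcoeff (\<lambda>x. 1 / 2 * (w x)\<^sup>2) k) \<le> (\<integral>x. (w x)\<^sup>2 \<partial>torus) / 2"
      by (simp add: abs_mult)
    have "(norm (fcoeff q k))\<^sup>2 \<le> (\<integral>x. (q x)\<^sup>2 \<partial>torus)"
      using bessel[of "{k}" q] L by simp
    also have "\<dots> \<le> 2 * c * \<epsilon>\<^sub>0" using A2 A(2) by simp
    finally show "norm (fcoeff q k) \<le> sqrt (2 * c * \<epsilon>\<^sub>0)"
      by (rule real_le_rsqrt)
  qed simp
  finally show "of_int \<bar>snd k\<bar> * norm (fcoeff w k) \<le> of_int \<bar>fst k\<bar> * ((\<integral>x. (w x)\<^sup>2 \<partial>torus) / 2 + sqrt (2 * c * \<epsilon>\<^sub>0))" .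
qed

text \<open>Averaging over \<open>h \<in> [0, H]\<close>: the mean of \<open>\<bar>e\<^sup>i\<^sup>m\<^sup>h - 1\<bar>\<^sup>2\<close> is bounded below
  once \<open>\<bar>m\<bar> H\<close> is.\<close>

lemma sum_le_of_increments:
  assumes S: "finite S" and H: "H > 0"
    and inc: "\<And>h. 0 \<le> h \<Longrightarrow> h \<le> H \<Longrightarrow> (\<Sum>k\<in>S. (norm ((torus_char k (h, 0) - 1) * c k))\<^sup>2) \<le> T"
    and freq: "\<And>k. k \<in> S \<Longrightarrow> 1 \<le> of_int \<bar>fst k\<bar> * H"
  shows "(\<Sum>k\<in>S. (norm (c k))\<^sup>2) \<le> T"
proof -
  define m where "m k = 2 * pi * real_of_int (fst k)" for k :: "int \<times> int"
  define F where "F k = 2 * H - 2 * sin (m k * H) / m k" for k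
  have m0: "m k \<noteq> 0" if "k \<in> S" for k
    using freq[OF that] by (auto simp: m_def)
  have eq: "(norm ((torus_char k (h, 0) - 1) * c k))\<^sup>2 = (2 - 2 * cos (m k * h)) * (norm (c k))\<^sup>2" for k h
  proof -
    have "(norm (torus_char k (h, 0) - 1))\<^sup>2 = (cos (m k * h) - 1)\<^sup>2 + (sin (m k * h))\<^sup>2"
      by (simp add: torus_char_def m_def cmod_power2 mult.assoc)
    also have "\<dots> = 2 - 2 * cos (m k * h)"
      using sin_cos_squared_add[of "m k * h"] by (simp add: power2_diff)
    finally show ?thesis by (simp add: norm_mult power_mult_distrib)
  qed
  have int: "((\<lambda>h. (norm ((torus_char k (h, 0) - 1) * c k))\<^sup>2) has_integral F k * (norm (c k))\<^sup>2) {0..H}"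
    if k: "k \<in> S" for k
  proof -
    have "((\<lambda>h. 2 - 2 * cos (m k * h)) has_integral
        (2 * H - 2 * sin (m k * H) / m k) - (2 * 0 - 2 * sin (m k * 0) / m k)) {0..H}"
    proof (rule fundamental_theorem_of_calculus)
      fix h
      have "((\<lambda>h. 2 * h - 2 * sin (m k * h) / m k) has_real_derivative 2 - 2 * cos (m k * h)) (at h)"
        using m0[OF k] by (auto intro!: derivative_eq_intros)
      then show "((\<lambda>h. 2 * h - 2 * sin (m k * h) / m k) has_vector_derivative 2 - 2 * cos (m k * h)) (at h within {0..H})"
        unfolding has_real_derivative_iff_has_vector_derivative by (rule has_vector_derivative_at_within)
    qed (use H in simp)
    then have "((\<lambda>h. 2 - 2 * cos (m k * h)) has_integral F k) {0..H}" by (simp add: F_def)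
    then show ?thesis unfolding eq by (rule has_integral_mult_left)
  qed
  have "((\<lambda>h. \<Sum>k\<in>S. (norm ((torus_char k (h, 0) - 1) * c k))\<^sup>2) has_integral (\<Sum>k\<in>S. F k * (norm (c k))\<^sup>2)) {0..H}"
    by (intro has_integral_sum S int)
  moreover have "((\<lambda>h. T) has_integral T * H) {0..H}"
    using has_integral_const_real[of T 0 H] H by (simp add: mult.commute)
  ultimately have le: "(\<Sum>k\<in>S. F k * (norm (c k))\<^sup>2) \<le> T * H"
    by (rule has_integral_le) (use inc in auto)
  \<comment> \<open>\<open>F k\<close> is the integral of the squared modulus over [0, H]: a main
    term \<open>2 * H\<close> and an oscillating one of size at most 2 / |m k|, which the frequency
    condition bounds by \<open>H\<close>.\<close>
  have "H * (\<Sum>k\<in>S. (norm (c k))\<^sup>2) \<le> (\<Sum>k\<in>S. F k * (norm (c k))\<^sup>2)"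
    unfolding sum_distrib_left
  proof (intro sum_mono mult_right_mono)
    fix k assume k: "k \<in> S"
    have "\<bar>2 * sin (m k * H) / m k\<bar> \<le> 2 / \<bar>m k\<bar>"
      by (simp add: abs_mult divide_right_mono)
    also have "2 / \<bar>m k\<bar> \<le> H"
    proof -
      have "1 \<le> of_int \<bar>fst k\<bar> * H" by (rule freq[OF k])
      also have "\<dots> \<le> pi * (of_int \<bar>fst k\<bar> * H)"
        using H pi_ge_two by (intro mult_right_mono[of 1 pi, simplified]) auto
      finally have "2 \<le> H * \<bar>m k\<bar>" by (simp add: m_def abs_mult mult_ac)
      then show ?thesis using m0[OF k] by (simp add: pos_divide_le_eq)
    qed
    finally show "H \<le> F k" unfolding F_def by linarith
  qed simp
  then have "H * (\<Sum>k\<in>S. (norm (c k))\<^sup>2) \<le> H * T" using le by (simp add: mult.commute)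
  then show ?thesis using H by simp
qed

section \<open>Uniform decay of the Fourier tails\<close>

text \<open>The terms are dominated by the telescoping differences of \<open>1 / n\<close>, so the
  positive integers beyond \<open>L\<close> give at most \<open>1 / L\<close>; the negative ones
  double this.\<close>

lemma sum_inverse_squares_le:
  fixes N :: "int set"
  assumes N: "finite N" and L: "L \<ge> 1" and gt: "\<And>n. n \<in> N \<Longrightarrow> \<bar>n\<bar> > int L"
  shows "(\<Sum>n\<in>N. 1 / (of_int n)\<^sup>2) \<le> 2 / real L"
proof -
  have nat: "(\<Sum>n\<in>{L<..U}. 1 / (real n)\<^sup>2) \<le> 1 / real L" for U
  proof (cases "L \<le> U")
    case True
    then have "(\<Sum>n\<in>{L<..U}. 1 / (real n)\<^sup>2) \<le> 1 / real L - 1 / real U"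
    proof (induction U rule: dec_induct)
      case (step U)
      have U: "real U > 0" using L step.hyps by simp
      have "1 / (real (Suc U))\<^sup>2 \<le> 1 / real U - 1 / real (Suc U)"
      proof -
        have "1 / real U - 1 / real (Suc U) = 1 / (real U * real (Suc U))"
          using U by (simp add: field_simps)
        moreover have "1 / (real (Suc U))\<^sup>2 \<le> 1 / (real U * real (Suc U))"
          using U by (intro divide_left_mono) (auto simp: power2_eq_square)
        ultimately show ?thesis by simp
      qed
      moreover have "{L<..Suc U} = insert (Suc U) {L<..U}" using step.hyps by auto
      ultimately show ?case using step.IH by simp
    qed simp
    also have "\<dots> \<le> 1 / real L" by simp
    finally show ?thesis .
  next
    case False then show ?thesis by simp
  qed
  define U where "U = Max (insert 0 ((\<lambda>n. nat \<bar>n\<bar>) ` N))"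
  let ?P = "int ` {L<..U}" and ?M = "(\<lambda>n. - int n) ` {L<..U}"
  have "N \<subseteq> ?P \<union> ?M"
  proof
    fix n assume n: "n \<in> N"
    then have "nat \<bar>n\<bar> \<le> U" using N by (auto simp: U_def)
    then have "nat \<bar>n\<bar> \<in> {L<..U}" using gt[OF n] by auto
    then show "n \<in> ?P \<union> ?M"
      by (cases "n \<ge> 0") (auto simp: image_iff intro!: bexI[of _ "nat \<bar>n\<bar>"])
  qed
  then have "(\<Sum>n\<in>N. 1 / (real_of_int n)\<^sup>2) \<le> (\<Sum>n\<in>?P \<union> ?M. 1 / (of_int n)\<^sup>2)"
    by (intro sum_mono2) auto
  also have "\<dots> \<le> (\<Sum>n\<in>?P. 1 / (of_int n)\<^sup>2) + (\<Sum>n\<in>?M. 1 / (of_int n)\<^sup>2)"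
    by (subst sum.union_disjoint) (auto simp: disjoint_iff)
  also have "\<dots> = (\<Sum>n\<in>{L<..U}. 1 / (real n)\<^sup>2) + (\<Sum>n\<in>{L<..U}. 1 / (real n)\<^sup>2)"
    by (subst (1 2) sum.reindex) (auto simp: inj_on_def)
  also have "\<dots> \<le> 2 / real L" using nat[of U] by simp
  finally show ?thesis .
qed

theorem proposition2p9:
  fixes \<epsilon>\<^sub>0 :: real and C\<^sub>3 :: ennreal
    and \<epsilon> :: "nat \<Rightarrow> real" and w :: "nat \<Rightarrow> real \<times> real \<Rightarrow> real"
  assumes "\<epsilon>\<^sub>0 > 0"
    and "C\<^sub>3 < \<infinity>"
    and "\<And>n. \<epsilon> n > 0"
    and "\<And>n. \<bar>\<epsilon> n\<bar> \<le> \<epsilon>\<^sub>0"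
    and "\<And>n. w n \<in> admissible"
    and "\<And>n. energy_eps (\<epsilon> n) (w n) \<le> C\<^sub>3"
  shows "precompact_L2 w"
proof -
  define c where "c = enn2real C\<^sub>3"
  have c: "c \<ge> 0" "ennreal c = C\<^sub>3" using assms(2) by (simp_all add: c_def)
  have wL: "w n \<in> L2_torus" for n using assms(5) by (simp add: admissible_def)
  have \<epsilon>: "\<epsilon> n \<le> \<epsilon>\<^sub>0" for n using assms(3,4) by (metis abs_of_pos)
  note F = admissible_fourier[OF assms(5) assms(3) \<epsilon> assms(6)[folded c(2)] c(1)]
  \<comment> \<open>The increment estimate at \<open>s = 1\<close> and shifts up to 1:
    \<open>384 = 48 * 2 * 4\<close>. Averaging over [0, 1] reaches every frequency with nonzero k_1,
    since then |k_1| is at least 1. Hence \<open>T\<close> bounds the squared L^2 norms uniformly in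
    \<open>n\<close>.\<close>
  define T where "T = 1 + 384 * c"
  have T: "(\<Sum>k\<in>S. (norm (fcoeff (w n) k))\<^sup>2) \<le> T" if S: "finite S" for S n
  proof -
    have "(\<Sum>k\<in>S. (norm (fcoeff (w n) k))\<^sup>2) = (\<Sum>k\<in>{k \<in> S. fst k \<noteq> 0}. (norm (fcoeff (w n) k))\<^sup>2)"
      using S F(1) by (intro sum.mono_neutral_right) auto
    also have "\<dots> \<le> T"
    proof (rule sum_le_of_increments[where H = 1])
      fix h :: real assume h: "0 \<le> h" "h \<le> 1"
      have "(\<Sum>k\<in>{k \<in> S. fst k \<noteq> 0}. (norm ((torus_char k (h, 0) - 1) * fcoeff (w n) k))\<^sup>2)
          \<le> 1\<^sup>2 + 48 * (1 + 1 / 1\<^sup>2) * (4 * c * h)"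
        using S h by (intro F(2)) auto
      also have "\<dots> \<le> T" using h c(1) by (simp add: T_def mult_left_le)
      finally show "(\<Sum>k\<in>{k \<in> S. fst k \<noteq> 0}. (norm ((torus_char k (h, 0) - 1) * fcoeff (w n) k))\<^sup>2) \<le> T" .
    qed (use S in auto)
    finally show ?thesis .
  qed
  have T0: "T \<ge> 0" using c(1) by (simp add: T_def)
  \<comment> \<open>The factor of |k_1| in the third part of \<open>admissible_fourier\<close>, made
    uniform in \<open>n\<close> by bounding the squared norm of \<open>w n\<close> by
    \<open>T\<close>.\<close>
  define D where "D = T / 2 + sqrt (2 * c * \<epsilon>\<^sub>0)"
  have D0: "D \<ge> 0" using T0 c(1) assms(1) by (simp add: D_def)
  have slow: "of_int \<bar>snd k\<bar> * norm (fcoeff (w n) k) \<le> of_int \<bar>fst k\<bar> * D" for n k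
  proof -
    have "(\<integral>x. (w n x)\<^sup>2 \<partial>torus) \<le> T"
      using L2_torusD[OF wL] T by (intro parseval_le) auto
    then have "of_int \<bar>fst k\<bar> * ((\<integral>x. (w n x)\<^sup>2 \<partial>torus) / 2 + sqrt (2 * c * \<epsilon>\<^sub>0)) \<le> of_int \<bar>fst k\<bar> * D"
      unfolding D_def by (intro mult_left_mono) auto
    with F(3)[of k n] show ?thesis by (rule order_trans)
  qed
  show ?thesis
  proof (rule precompact_L2_fourier[OF wL])
    show "norm (fcoeff (w n) k) \<le> sqrt T" for n k
      using T[of "{k}" n] by (intro real_le_rsqrt) simp
    fix e :: real assume e: "e > 0"
    \<comment> \<open>The coefficient of \<open>h\<close> in the increment estimate when
      \<open>s\<^sup>2 = e / 4\<close>. The choice of \<open>H\<close> keeps the term linear in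
      \<open>h\<close> below another \<open>e / 4\<close>.\<close>
    define a where "a = 48 * (1 + 1 / (e / 4)) * (4 * c)"
    have a: "a \<ge> 0" using e c(1) by (simp add: a_def)
    define H where "H = min 1 (e / (4 * (a + 1)))"
    have H: "H > 0" "H \<le> 1" "a * H \<le> e / 4"
    proof -
      show "H > 0" "H \<le> 1" using e a by (auto simp: H_def)
      have "a * H \<le> a * (e / (4 * (a + 1)))" using a by (intro mult_left_mono) (auto simp: H_def)
      also have "\<dots> = e / 4 * (a / (a + 1))" by simp
      also have "\<dots> \<le> e / 4 * 1" using a e by (intro mult_left_mono) (auto simp: divide_le_eq_1)
      finally show "a * H \<le> e / 4" by simp
    qed
    \<comment> \<open>Above this threshold |k_1| times \<open>H\<close> is at least 1, as averaging
      over shifts in [0, H] requires.\<close>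
    define X where "X = nat \<lceil>1 / H\<rceil>"
    have X: "1 \<le> real X * H"
    proof -
      have "1 / H \<le> real X" unfolding X_def by linarith
      then show ?thesis using H(1) by (simp add: pos_divide_le_eq)
    qed
    \<comment> \<open>There are \<open>2 * X + 1\<close> values of k_1 with |k_1| at most
      \<open>X\<close>. For each, the squared coefficients are at most
      \<open>(real X * D)\<^sup>2\<close> over k_2 squared, and the sum over |k_2| beyond
      \<open>L\<close> adds the factor \<open>2 / L\<close>; so \<open>b / L\<close> bounds this
      part of the tail.\<close>
    define b where "b = (2 * real X + 1) * (real X * D)\<^sup>2 * 2"
    have b: "b \<ge> 0" by (simp add: b_def)
    define L where "L = max 1 (nat \<lceil>b / (e / 2)\<rceil>)"
    have L: "L \<ge> 1" "b / real L \<le> e / 2"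
    proof -
      show L1: "L \<ge> 1" by (simp add: L_def)
      have "b / (e / 2) \<le> real (nat \<lceil>b / (e / 2)\<rceil>)" by linarith
      also have "\<dots> \<le> real L" by (simp add: L_def)
      finally show "b / real L \<le> e / 2" using e L1 by (simp add: field_simps)
    qed
    let ?K = "{- int X..int X} \<times> {- int L..int L}"
    have "(\<Sum>k\<in>S. (norm (fcoeff (w n) k))\<^sup>2) \<le> e" if S: "finite S" "S \<inter> ?K = {}" for n S
    proof -
      define S1 where "S1 = {k \<in> S. int X < \<bar>fst k\<bar>}"
      define S2 where "S2 = S - S1"
      have fin: "finite S1" "finite S2" using S(1) by (auto simp: S1_def S2_def)
      have S1: "(\<Sum>k\<in>S1. (norm (fcoeff (w n) k))\<^sup>2) \<le> e / 2"
      proof (rule sum_le_of_increments[OF fin(1) H(1)])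
        fix h assume h: "0 \<le> h" "h \<le> H"
        have "(\<Sum>k\<in>S1. (norm ((torus_char k (h, 0) - 1) * fcoeff (w n) k))\<^sup>2)
            \<le> (sqrt (e / 4))\<^sup>2 + 48 * (1 + 1 / (sqrt (e / 4))\<^sup>2) * (4 * c * h)"
          using fin h H(2) e by (intro F(2)) auto
        also have "\<dots> = e / 4 + a * h" using e by (simp add: a_def)
        also have "\<dots> \<le> e / 4 + a * H" using h a by (intro add_left_mono mult_left_mono) auto
        also have "\<dots> \<le> e / 2" using H(3) by simp
        finally show "(\<Sum>k\<in>S1. (norm ((torus_char k (h, 0) - 1) * fcoeff (w n) k))\<^sup>2) \<le> e / 2" .
      next
        fix k assume "k \<in> S1"
        then have "int X \<le> \<bar>fst k\<bar>" by (simp add: S1_def)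
        then have "real X \<le> of_int \<bar>fst k\<bar>" by linarith
        then have "real X * H \<le> of_int \<bar>fst k\<bar> * H" using H(1) by (intro mult_right_mono) auto
        with X show "1 \<le> of_int \<bar>fst k\<bar> * H" by linarith
      qed
      have mem: "\<bar>fst k\<bar> \<le> int X" "\<bar>snd k\<bar> > int L" if "k \<in> S2" for k
      proof -
        show le: "\<bar>fst k\<bar> \<le> int X" using that by (auto simp: S2_def S1_def)
        have "k \<notin> ?K" using that S(2) by (auto simp: S2_def)
        then show "\<bar>snd k\<bar> > int L" using le by (cases k) auto
      qed
      have "(\<Sum>k\<in>S2. (norm (fcoeff (w n) k))\<^sup>2) \<le> (\<Sum>k\<in>S2. (real X * D)\<^sup>2 * (1 / (of_int (snd k))\<^sup>2))"
      proof (rule sum_mono)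
        fix k assume k: "k \<in> S2"
        have pos: "real_of_int \<bar>snd k\<bar> > 0" using mem(2)[OF k] by linarith
        have "of_int \<bar>snd k\<bar> * norm (fcoeff (w n) k) \<le> real X * D"
          using slow[of k n] mem(1)[OF k] D0
          by (elim order_trans) (intro mult_right_mono; simp)
        then have "norm (fcoeff (w n) k) \<le> real X * D / of_int \<bar>snd k\<bar>"
          using pos by (simp add: pos_le_divide_eq mult.commute)
        then have "(norm (fcoeff (w n) k))\<^sup>2 \<le> (real X * D / of_int \<bar>snd k\<bar>)\<^sup>2"
          by (intro power_mono) auto
        then show "(norm (fcoeff (w n) k))\<^sup>2 \<le> (real X * D)\<^sup>2 * (1 / (of_int (snd k))\<^sup>2)"
          by (simp add: power_divide)
      qed
      \<comment> \<open>Enlarging the index set to a product of an interval in k_1 and the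
        projection of \<open>S2\<close> to k_2 lets the sum factorize; the summand depends on k_2
        only.\<close>
      also have "\<dots> \<le> (\<Sum>k\<in>{- int X..int X} \<times> snd ` S2. (real X * D)\<^sup>2 * (1 / (of_int (snd k))\<^sup>2))"
        using fin mem(1) by (intro sum_mono2) (force simp: abs_le_iff)+
      also have "\<dots> = (2 * real X + 1) * ((real X * D)\<^sup>2 * (\<Sum>l\<in>snd ` S2. 1 / (of_int l)\<^sup>2))"
        by (simp add: sum.cartesian_product' sum_distrib_left)
      also have "\<dots> \<le> (2 * real X + 1) * ((real X * D)\<^sup>2 * (2 / real L))"
        using fin mem(2) by (intro mult_left_mono sum_inverse_squares_le L) auto
      also have "\<dots> = b / real L" by (simp add: b_def)
      also have "\<dots> \<le> e / 2" by (rule L(2))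
      finally have S2: "(\<Sum>k\<in>S2. (norm (fcoeff (w n) k))\<^sup>2) \<le> e / 2" .
      have "S = S1 \<union> S2" "S1 \<inter> S2 = {}" by (auto simp: S1_def S2_def)
      then have "(\<Sum>k\<in>S. (norm (fcoeff (w n) k))\<^sup>2) = (\<Sum>k\<in>S1. (norm (fcoeff (w n) k))\<^sup>2) + (\<Sum>k\<in>S2. (norm (fcoeff (w n) k))\<^sup>2)"
        using fin by (simp add: sum.union_disjoint)
      then show ?thesis using S1 S2 by linarith
    qed
    then show "\<exists>K. finite K \<and> (\<forall>n S. finite S \<and> S \<inter> K = {} \<longrightarrow> (\<Sum>k\<in>S. (norm (fcoeff (w n) k))\<^sup>2) \<le> e)"
      by (intro exI[of _ ?K]) auto
  qed
qed

end
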